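(* Fix real numbers $\lambda>\mu>0$ and a Borel set $S\subset\mathbb{R}^d$ with $\mathcal{L}S\in(0,\infty)$, where $\mathcal{L}$ denotes Lebesgue measure on $\mathbb{R}^d$. Let $\Pi$ be a homogeneous Poisson point process of intensity $\lambda$ on $S$. Let $X$ and $Y$ be Poisson random variables with respective means $\lambda\,\mathcal{L}S$ and $\mu\,\mathcal{L}S$. The following are equivalent. (i) There exists a measurable function $f$ (from the set of simple point measures on $S$ to itself) such that $f(\Pi)$ is a homogeneous Poisson point process of intensity $\mu$ on $S$, and every point of $f(\Pi)$ is a point of $\Pi$ almost surely. (ii) There exists an integer $k\geq 0$ such that $$\mathbb{P}(X=k)\leq \mathbb{P}(Y=k)\quad\text{and}\quad \mathbb{P}(X\leq k+1)\leq \mathbb{P}(Y\leq k).$$ (iii) There is no integer $k\geq 0$ such that $$\mathbb{P}(X=k+1)> \mathbb{P}(Y=k+1)\quad\text{and}\quad \mathbb{P}(X\leq k+1)> \mathbb{P}(Y\leq k).$$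
   Context: Point processes are viewed as random simple point measures on $S$ (finite measures taking values in $\{0,1,2,\dots\}$ with mass at most one at each point), with the usual $\sigma$-algebra generated by the evaluation maps $\nu\mapsto\nu(A)$, $A\subseteq S$ Borel. A point of a simple point measure $\nu$ is an $x\in S$ with $\nu(\{x\})=1$. *)

theory Defs
  imports "HOL-Probability.Probability"
begin

definition simple_point_measures :: "'a::euclidean_space set \<Rightarrow> 'a measure set" where
  "simple_point_measures S =
    {\<nu>. sets \<nu> = sets (restrict_space borel S) \<and> finite_measure \<nu> \<and>
        (\<forall>A\<in>sets \<nu>. emeasure \<nu> A \<in> \<nat>) \<and> (\<forall>x\<in>S. emeasure \<nu> {x} \<le> 1)}"

definition point_measure_space :: "'a::euclidean_space set \<Rightarrow> 'a measure measure" where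
  "point_measure_space S =
    sigma (simple_point_measures S)
      {(\<lambda>\<nu>. emeasure \<nu> A) -` B \<inter> simple_point_measures S | A B.
        A \<in> sets (restrict_space borel S) \<and> B \<in> sets borel}"

definition points :: "'a measure \<Rightarrow> 'a set" where
  "points \<nu> = {x \<in> space \<nu>. emeasure \<nu> {x} = 1}"

(* The library's poisson_pmf is specified for positive rates only; rate 0 (which occurs as
   the rate of the number of points in a Lebesgue null set) is the point mass at 0. *)
definition poisson_law :: "real \<Rightarrow> nat pmf" where
  "poisson_law r = (if r = 0 then return_pmf 0 else poisson_pmf r)"

definition (in prob_space) poisson_variable :: "('a \<Rightarrow> nat) \<Rightarrow> real \<Rightarrow> bool" where
  "poisson_variable X r \<longleftrightarrow>
    random_variable (count_space UNIV) X \<and>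
    distr M (count_space UNIV) X = measure_pmf (poisson_law r)"

(* Counts are of type ennreal, so the Poisson law on nat is transported along of_nat. *)
definition (in prob_space) poisson_process ::
    "('b::euclidean_space) set \<Rightarrow> real \<Rightarrow> ('a \<Rightarrow> 'b measure) \<Rightarrow> bool" where
  "poisson_process S r \<Phi> \<longleftrightarrow>
    random_variable (point_measure_space S) \<Phi> \<and>
    (\<forall>A\<in>sets (restrict_space borel S).
      distr M borel (\<lambda>\<omega>. emeasure (\<Phi> \<omega>) A) =
      distr (measure_pmf (poisson_law (r * measure lborel A))) borel (of_nat :: nat \<Rightarrow> ennreal)) \<and>
    (\<forall>n. \<forall>A :: nat \<Rightarrow> 'b set.
      (\<forall>i<n. A i \<in> sets (restrict_space borel S)) \<and> disjoint_family_on A {..<n} \<longrightarrow>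
      indep_vars (\<lambda>_. borel) (\<lambda>i \<omega>. emeasure (\<Phi> \<omega>) (A i)) {..<n})"

end

theory Submission
  imports Defs
begin

text \<open>
  Given its number of points, a Poisson process is a uniform sample, whatever its intensity.

  If a deterministic thinning keeps some configurations of \<open>k + 1\<close> points intact, comparing the two
  laws on exactly these configurations gives \<open>P(X = k + 1) \<le> P(Y = k + 1)\<close>. Otherwise every configuration
  of at most \<open>k + 1\<close> points is mapped to one of at most \<open>k\<close> points, so \<open>P(X \<le> k + 1) \<le> P(Y \<le> k)\<close>.

  Conversely, keep configurations of at most \<open>k\<close> points and couple the rest of the law of \<open>X\<close> with the rest
  of the law of \<open>Y\<close> so that the number of points strictly decreases; this is possible because
  \<open>P(X \<le> j + 1) \<le> P(Y \<le> j)\<close> propagates from \<open>j = k\<close> to all \<open>j \<ge> k\<close>. It remains to select, deterministically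
  from \<open>n\<close> points, a uniform proper subset of given random size. Let \<open>F\<close> map the uniform law on \<open>S\<close> to
  the uniform law on the unit interval, and let \<open>l\<close> be the least level whose dyadic cells separate the values of
  \<open>F\<close> at the \<open>n\<close> points. The fractional part of \<open>2\<^sup>l\<close> times the sum of these values is uniform and independent
  of any \<open>n - 1\<close> of the points; it decides which ranks, with respect to \<open>F\<close>, are selected.
\<close>

section \<open>Comparison and coupling of two Poisson laws\<close>

text \<open>No external randomness is available: how many points to retain, and which, must be read
  off the positions, yet the retained points must look like a fresh uniform sample. The randomness
  is therefore taken from a discarded point, whose position inside its cell is free information.
  This is why a configuration is either kept whole or loses at least one point, and why the counts
  need a strict coupling. Summing over all points makes the mark symmetric, hence a function of the
  point measure; freezing all but one point turns it into a rotation of a uniform variable.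

  That the output is again Poisson is checked through its law: it is identified as a Poisson mixture
  of samples, and independence is inherited from \<open>\<Phi>\<close> through the density of one
  mixture with respect to the other, a product over disjoint sets. The propagation in
  \<open>j\<close> rests on the ratio of \<open>P(X = j + 1)\<close> to \<open>P(Y = j)\<close>,
  whose successive quotients increase in \<open>j\<close>.\<close>

lemma incseq_intervals:
  fixes f :: "nat \<Rightarrow> real"
  assumes "incseq f" "f \<longlonglongrightarrow> L"
  shows "disjoint_family (\<lambda>n. {f n..<f (Suc n)})" "(\<Union>n. {f n..<f (Suc n)}) = {f 0..<L}"
proof -
  show "disjoint_family (\<lambda>n. {f n..<f (Suc n)})"
  proof -
    have "{f m..<f (Suc m)} \<inter> {f n..<f (Suc n)} = {}" if "m < n" for m n
      using incseqD[OF assms(1), of "Suc m" n] that by auto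
    then show ?thesis unfolding disjoint_family_on_def by (metis Int_commute nat_neq_iff)
  qed
  show "(\<Union>n. {f n..<f (Suc n)}) = {f 0..<L}"
  proof (intro equalityI subsetI)
    fix x assume "x \<in> (\<Union>n. {f n..<f (Suc n)})"
    then obtain n where "f n \<le> x" "x < f (Suc n)" by auto
    then show "x \<in> {f 0..<L}"
      using incseqD[OF assms(1), of 0 n] incseq_le[OF assms, of "Suc n"] by auto
  next
    fix x assume x: "x \<in> {f 0..<L}"
    then have "\<exists>n. x < f n"
      using order_tendstoD(1)[OF assms(2), of x] by (auto simp: eventually_sequentially)
    \<comment> \<open>The interval containing \<open>x\<close> ends at the first value of
      \<open>f\<close> above \<open>x\<close>; this index is not 0 because
      \<open>f 0 \<le> x\<close>.\<close>
    then obtain n where n: "x < f n" "\<And>m. m < n \<Longrightarrow> \<not> x < f m"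
      using exists_least_iff[of "\<lambda>n. x < f n"] by blast
    moreover from this x have "n \<noteq> 0" by (metis atLeastLessThan_iff leD)
    ultimately have "x \<in> {f (n - 1)..<f (Suc (n - 1))}" using n(1) n(2)[of "n - 1"] by (simp add: not_less)
    then show "x \<in> (\<Union>n. {f n..<f (Suc n)})" by blast
  qed
qed

lemma pmf_nat_sums: "pmf (p :: nat pmf) sums 1"
proof -
  have "(\<integral>\<^sup>+n. ennreal (pmf p n) \<partial>count_space UNIV) = 1"
    by (simp add: nn_integral_pmf measure_pmf.emeasure_space_1[simplified])
  then have "(\<Sum>n. ennreal (pmf p n)) = ennreal 1"
    by (simp add: nn_integral_count_space_nat)
  then have "(\<lambda>n. ennreal (pmf p n)) sums ennreal 1"
    using summable_sums[OF summableI, of "\<lambda>n. ennreal (pmf p n)"] by simp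
  then show ?thesis by (subst (asm) sums_ennreal) auto
qed

text \<open>The quantile coupling of the parts of the two laws that are not already matched on
  \<open>{..k}\<close>; the assumption on the distribution functions makes it strictly decreasing.\<close>

lemma strict_thinning_coupling:
  fixes p q :: "nat pmf"
  assumes le: "\<And>n. n \<le> k \<Longrightarrow> pmf p n \<le> pmf q n"
    and cdf: "\<And>j. k \<le> j \<Longrightarrow> (\<Sum>i\<le>Suc j. pmf p i) \<le> (\<Sum>i\<le>j. pmf q i)"
  obtains \<pi> :: "nat \<Rightarrow> nat pmf"
  where "bind_pmf p \<pi> = q" "\<And>n. n \<le> k \<Longrightarrow> \<pi> n = return_pmf n"
    "\<And>n m. k < n \<Longrightarrow> m \<in> set_pmf (\<pi> n) \<Longrightarrow> m < n"
proof -
  \<comment> \<open>\<open>A 0\<close> is the mass of \<open>p\<close> on \<open>{..k}\<close>,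
    which stays in place. The interval from \<open>A n\<close> to \<open>A (Suc n)\<close> has
    length \<open>pmf p (n + Suc k)\<close> and represents the source value
    \<open>n + Suc k\<close>.\<close>
  define A where "A n = (\<Sum>i<n + Suc k. pmf p i)" for n
  \<comment> \<open>\<open>t\<close> is what remains of \<open>q\<close> once the mass of
    \<open>p\<close> on \<open>{..k}\<close> is matched. \<open>T\<close> starts at
    \<open>A 0\<close>, so that source and target intervals tile the same interval from
    \<open>A 0\<close> to 1; the overlaps \<open>w\<close> are the transported masses.\<close>
  define t where "t m = (if m \<le> k then pmf q m - pmf p m else pmf q m)" for m
  define T where "T m = A 0 + (\<Sum>i<m. t i)" for m
  define w where "w n m = emeasure lborel ({A n..<A (Suc n)} \<inter> {T m..<T (Suc m)})" for n m
  have t: "0 \<le> t m" for m using le by (auto simp: t_def)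
  have A: "incseq A" "A \<longlonglongrightarrow> 1" "A (Suc n) - A n = pmf p (n + Suc k)" for n
  proof -
    show *: "A (Suc n) - A n = pmf p (n + Suc k)" for n by (simp add: A_def)
    have "A n \<le> A (Suc n)" for n using *[of n] pmf_nonneg[of p "n + Suc k"] by linarith
    then show "incseq A" by (rule incseq_SucI)
    show "A \<longlonglongrightarrow> 1"
      unfolding A_def using pmf_nat_sums[of p] by (intro LIMSEQ_ignore_initial_segment) (simp add: sums_def)
  qed
  have T_large: "T m = (\<Sum>i<m. pmf q i)" if "k < m" for m
  proof -
    have split: "(\<Sum>i<m. f i) = (\<Sum>i<Suc k. f i) + (\<Sum>i=Suc k..<m. f i)" for f :: "nat \<Rightarrow> real"
      using sum.atLeastLessThan_concat[of 0 "Suc k" m f] that by (simp only: lessThan_atLeast0 zero_le Suc_leI)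
    have "(\<Sum>i<Suc k. t i) = (\<Sum>i<Suc k. pmf q i) - A 0"
      by (simp add: t_def A_def sum_subtractf del: sum.lessThan_Suc)
    moreover have "(\<Sum>i=Suc k..<m. t i) = (\<Sum>i=Suc k..<m. pmf q i)"
      by (intro sum.cong) (auto simp: t_def)
    ultimately show ?thesis
      unfolding T_def split by simp
  qed
  have T: "incseq T" "T \<longlonglongrightarrow> 1" "T (Suc n) - T n = t n" for n
  proof -
    show "incseq T" using t by (auto simp: T_def intro!: incseq_SucI)
    have "(\<lambda>m. \<Sum>i<m. pmf q i) \<longlonglongrightarrow> 1" using pmf_nat_sums[of q] by (simp add: sums_def)
    then show "T \<longlonglongrightarrow> 1"
      by (rule Lim_transform_eventually) (auto simp: eventually_sequentially T_large intro!: exI[of _ "Suc k"])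
  qed (simp add: T_def)
  note IA = incseq_intervals[OF A(1,2)] and IT = incseq_intervals[OF T(1,2)]
  have "A 0 = T 0" by (simp add: T_def)
  have sum_w: "(\<Sum>m. w n m) = ennreal (pmf p (n + Suc k))" for n
  proof -
    have "(\<Sum>m. w n m) = emeasure lborel (\<Union>m. {A n..<A (Suc n)} \<inter> {T m..<T (Suc m)})"
      unfolding w_def using IT(1) by (intro suminf_emeasure) (auto simp: disjoint_family_on_def)
    also have "(\<Union>m. {A n..<A (Suc n)} \<inter> {T m..<T (Suc m)}) = {A n..<A (Suc n)} \<inter> {A 0..<1}"
      unfolding Int_UN_distrib[symmetric] IT(2) \<open>A 0 = T 0\<close> ..
    also have "\<dots> = {A n..<A (Suc n)}" using IA(2) by blast
    finally show ?thesis
      using A incseq_SucD[OF A(1), of n] by simp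
  qed
  have sum_w': "(\<Sum>n. w n m) = ennreal (t m)" for m
  proof -
    have "(\<Sum>n. w n m) = emeasure lborel (\<Union>n. {A n..<A (Suc n)} \<inter> {T m..<T (Suc m)})"
      unfolding w_def using IA(1) by (intro suminf_emeasure) (auto simp: disjoint_family_on_def)
    also have "(\<Union>n. {A n..<A (Suc n)} \<inter> {T m..<T (Suc m)}) = {T 0..<1} \<inter> {T m..<T (Suc m)}"
      unfolding \<open>A 0 = T 0\<close>[symmetric] IA(2)[symmetric] by blast
    also have "\<dots> = {T m..<T (Suc m)}" using IT(2) by blast
    finally show ?thesis
      using T incseq_SucD[OF T(1), of m] by simp
  qed
  \<comment> \<open>With \<open>j = n + k\<close> the hypothesis says that the source interval of
    the value \<open>n + Suc k\<close> ends no later than the target interval of that same value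
    begins. Hence it meets only strictly smaller targets.\<close>
  have w0: "w n m = 0" if "n + Suc k \<le> m" for n m
  proof -
    have "A (Suc n) \<le> T (n + Suc k)"
      using cdf[of "n + k"] by (subst T_large) (auto simp: A_def lessThan_Suc_atMost[symmetric] simp del: sum.lessThan_Suc)
    also have "\<dots> \<le> T m" using that by (intro incseqD[OF T(1)])
    finally have "{A n..<A (Suc n)} \<inter> {T m..<T (Suc m)} = {}" by auto
    then show ?thesis unfolding w_def by (simp only: emeasure_empty)
  qed
  have w_fin: "w n m \<noteq> \<infinity>" for n m
  proof -
    have "w n m \<le> emeasure lborel {A n..<A (Suc n)}" unfolding w_def by (intro emeasure_mono) auto
    also have "\<dots> < \<infinity>" using incseq_SucD[OF A(1), of n] by simp
    finally show ?thesis by simp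
  qed
  \<comment> \<open>When \<open>pmf p n = 0\<close> there is no mass to normalise by;
    \<open>k\<close> is a convenient default, being below \<open>n\<close>, so that the strict
    decrease holds for every \<open>n > k\<close>.\<close>
  define \<pi> where "\<pi> n = (if n \<le> k then return_pmf n
      else if pmf p n = 0 then return_pmf k
      else embed_pmf (\<lambda>m. enn2real (w (n - Suc k) m) / pmf p n))" for n
  have \<pi>_w: "ennreal (pmf p n) * ennreal (pmf (\<pi> n) m) = w (n - Suc k) m" 
    and \<pi>_pos: "pmf p n \<noteq> 0 \<Longrightarrow> pmf (\<pi> n) m = enn2real (w (n - Suc k) m) / pmf p n" if n: "k < n" for n m
  proof -
    have nk: "n - Suc k + Suc k = n" using n by simp
    show *: "pmf (\<pi> n) m = enn2real (w (n - Suc k) m) / pmf p n" if pos: "pmf p n \<noteq> 0" for m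
    proof -
      have "ennreal (enn2real (w (n - Suc k) m) / pmf p n) = w (n - Suc k) m / ennreal (pmf p n)" for m
        using pos w_fin[of "n - Suc k" m] pmf_nonneg[of p n]
        by (subst divide_ennreal[symmetric]) (auto simp: less_top)
      then have "(\<integral>\<^sup>+m. ennreal (enn2real (w (n - Suc k) m) / pmf p n) \<partial>count_space UNIV)
          = (\<integral>\<^sup>+m. w (n - Suc k) m / ennreal (pmf p n) \<partial>count_space UNIV)" by simp
      also have "\<dots> = (\<Sum>m. w (n - Suc k) m) / ennreal (pmf p n)"
        by (subst nn_integral_divide) (auto simp: nn_integral_count_space_nat)
      also have "\<dots> = 1"
        using pos pmf_nonneg[of p n] by (simp only: sum_w nk) (simp add: ennreal_divide_self)
      finally show ?thesis
        using n pos by (simp add: \<pi>_def pmf_embed_pmf)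
    qed
    show "ennreal (pmf p n) * ennreal (pmf (\<pi> n) m) = w (n - Suc k) m"
    proof (cases "pmf p n = 0")
      case True
      have "w (n - Suc k) m \<le> (\<Sum>m. w (n - Suc k) m)"
        using sum_le_suminf[of "w (n - Suc k)" "{m}"] by simp
      also have "\<dots> = 0" using True by (simp only: sum_w nk) simp
      finally show ?thesis using True by simp
    next
      case False
      then have "pmf p n * pmf (\<pi> n) m = enn2real (w (n - Suc k) m)" by (simp add: *)
      then show ?thesis using w_fin[of "n - Suc k" m] 
        by (simp add: ennreal_mult'[symmetric] less_top)
    qed
  qed
  show thesis
  proof (rule that[of \<pi>])
    show "\<pi> n = return_pmf n" if "n \<le> k" for n using that by (simp add: \<pi>_def)
    show "m < n" if "k < n" "m \<in> set_pmf (\<pi> n)" for n m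
    proof (cases "pmf p n = 0")
      case True
      then show ?thesis using that by (simp add: \<pi>_def)
    next
      case False
      then have "w (n - Suc k) m \<noteq> 0" using that \<pi>_pos[of n m] by (auto simp: set_pmf_iff)
      then show ?thesis using w0[of "n - Suc k" m] that by force
    qed
    show "bind_pmf p \<pi> = q"
    proof (rule pmf_eqI)
      fix m
      have "ennreal (pmf (bind_pmf p \<pi>) m) = (\<Sum>n. ennreal (pmf p n) * ennreal (pmf (\<pi> n) m))"
        by (simp add: ennreal_pmf_bind nn_integral_measure_pmf nn_integral_count_space_nat)
      also have "\<dots> = (\<Sum>n. ennreal (pmf p (n + Suc k)) * ennreal (pmf (\<pi> (n + Suc k)) m))
          + (\<Sum>n<Suc k. ennreal (pmf p n) * ennreal (pmf (\<pi> n) m))"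
        by (rule suminf_offset) simp
      also have "(\<Sum>n. ennreal (pmf p (n + Suc k)) * ennreal (pmf (\<pi> (n + Suc k)) m)) = (\<Sum>n. w n m)"
        by (intro suminf_cong) (subst \<pi>_w, auto)
      also have "(\<Sum>n<Suc k. ennreal (pmf p n) * ennreal (pmf (\<pi> n) m))
          = (\<Sum>n<Suc k. if n = m then ennreal (pmf p n) else 0)"
        by (intro sum.cong) (auto simp: \<pi>_def pmf_return indicator_def)
      also have "\<dots> = ennreal (if m \<le> k then pmf p m else 0)"
        by (simp add: less_Suc_eq_le del: sum.lessThan_Suc)
      also have "(\<Sum>n. w n m) + ennreal (if m \<le> k then pmf p m else 0) = ennreal (pmf q m)"
        using le[of m] by (simp add: sum_w' t_def flip: ennreal_plus)
      finally show "pmf (bind_pmf p \<pi>) m = pmf q m" by simp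
    qed
  qed
qed

section \<open>Likelihood ratios and sign changes for two Poisson laws\<close>

locale two_rates =
  fixes a b :: real
  assumes b: "0 < b" and ab: "b < a"
begin

abbreviation "p \<equiv> pmf (poisson_pmf a)"
abbreviation "q \<equiv> pmf (poisson_pmf b)"

lemma p_eq: "p n = a ^ n / fact n * exp (- a)" and q_eq: "q n = b ^ n / fact n * exp (- b)"
  using b ab by auto

lemma q_pos: "q n > 0" using b by (simp add: q_eq)

text \<open>The likelihood ratio of the two laws at \<open>n\<close> is geometric,
  \<open>c * r ^ n\<close>: \<open>r\<close> is the ratio of the rates and \<open>c\<close> the
  ratio of the masses at 0.\<close>

definition "r = a / b"
definition "c = exp (b - a)"

lemma r: "r > 1" and c: "c > 0" using b ab by (auto simp: r_def c_def)

lemma p_q: "p n = c * r ^ n * q n"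
  using b ab by (simp add: p_eq q_eq c_def r_def exp_diff exp_minus power_divide field_simps)

lemma p_le_q_iff: "p n \<le> q n \<longleftrightarrow> c * r ^ n \<le> 1"
  using q_pos[of n] by (simp add: p_q mult_le_cancel_right1)

text \<open>The likelihood ratio increases with \<open>n\<close>, so the set where \<open>p\<close>
  lies below \<open>q\<close> is an initial segment.\<close>

lemma p_le_q_mono: "p n \<le> q n \<Longrightarrow> m \<le> n \<Longrightarrow> p m \<le> q m"
  unfolding p_le_q_iff using r c power_increasing[of m n r] mult_left_mono[of "r ^ m" "r ^ n" c]
  by linarith

lemma p_le_q_0: "p 0 \<le> q 0" using ab by (simp add: p_le_q_iff c_def)

lemma p_gt_q_large: "\<exists>N. \<forall>n\<ge>N. q n < p n"
proof -
  obtain N where N: "1 / c < r ^ N" using real_arch_pow[OF r(1)] by auto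
  have "q n < p n" if "N \<le> n" for n
  proof -
    have "1 / c < r ^ n" using N power_increasing[OF that, of r] r by linarith
    then show ?thesis using c p_le_q_iff[of n] by (simp add: field_simps)
  qed
  then show ?thesis by blast
qed

text \<open>This is the likelihood ratio of \<open>X - 1\<close> to \<open>Y\<close> at
  \<open>j\<close>. Whether it exceeds 1 decides whether the difference \<open>D\<close> of the
  shifted distribution functions goes up or down.\<close>

definition "h j = c * a * r ^ j / (j + 1)" for j :: nat

lemma p_Suc: "p (Suc j) = h j * q j"
proof -
  have "q (Suc j) = q j * (b / (j + 1))" by (simp add: q_eq field_simps)
  then have "p (Suc j) = c * (r * b) * r ^ j / (j + 1) * q j"
    unfolding p_q[of "Suc j"] by (simp add: mult_ac)
  also have "r * b = a" using b by (simp add: r_def)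
  finally show ?thesis by (simp add: h_def)
qed

lemma p_Suc_less: "q j < p (Suc j) \<longleftrightarrow> 1 < h j"
  using q_pos[of j] by (simp add: p_Suc)

lemma h_Suc: "h (Suc j) = h j * (r * (j + 1) / (j + 2))"
  by (simp add: h_def divide_simps)

lemma h_pos: "h j > 0" using b ab r c by (simp add: h_def)

text \<open>The quotient of consecutive values is \<open>r * (j + 1) / (j + 2)\<close>, which
  increases with \<open>j\<close>. So once \<open>h\<close> has risen across the level 1 it can
  never come back.\<close>

lemma h_unimodal:
  assumes "i \<le> j" "h i \<le> 1" "1 < h j" "j \<le> l"
  shows "1 < h l"
proof -
  have "\<exists>m. i \<le> m \<and> m < j \<and> h m \<le> 1 \<and> 1 < h (Suc m)"
    using assms(1-3)
  proof (induction j rule: dec_induct)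
    case (step n)
    then show ?case by (cases "1 < h n") (auto intro: less_SucI exI[of _ n])
  qed simp
  then obtain m where m: "i \<le> m" "m < j" "h m \<le> 1" "1 < h (Suc m)" by auto
  \<comment> \<open>An upward crossing between \<open>m\<close> and \<open>Suc m\<close> forces the
    quotient of the two values above 1, and the quotient then stays there.\<close>
  have "1 < r * (m + 1) / (m + 2)"
  proof (rule ccontr)
    assume "\<not> 1 < r * (m + 1) / (m + 2)"
    then have "h (Suc m) \<le> h m * 1"
      unfolding h_Suc using h_pos[of m] by (intro mult_left_mono) auto
    then show False using m by simp
  qed
  then have rm: "real m + 2 < r * (m + 1)" by (simp add: field_simps)
  have step: "h n \<le> h (Suc n)" if "m \<le> n" for n
  proof -
    have "real n + 2 \<le> r * (n + 1)"
    proof -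
      have "r * (n + 1) - (n + 2) = (r * (m + 1) - (m + 2)) + (r - 1) * (real n - real m)"
        by (simp add: algebra_simps)
      moreover have "0 \<le> (r - 1) * (real n - real m)" using r that by simp
      ultimately show ?thesis using rm by linarith
    qed
    then have "1 \<le> r * (n + 1) / (n + 2)" by (simp add: field_simps)
    then have "h n * 1 \<le> h n * (r * (n + 1) / (n + 2))"
      using h_pos[of n] by (intro mult_left_mono) auto
    then show ?thesis unfolding h_Suc by simp
  qed
  have "h (Suc m) \<le> h l"
  proof -
    have "Suc m \<le> l" using \<open>m < j\<close> \<open>j \<le> l\<close> by simp
    then show ?thesis
    proof (induction l rule: dec_induct)
      case (step n)
      then show ?case using \<open>\<And>n. m \<le> n \<Longrightarrow> h n \<le> h (Suc n)\<close>[of n] by linarith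
    qed simp
  qed
  then show ?thesis using m by simp
qed

text \<open>The difference of the distribution functions of \<open>X - 1\<close> and
  \<open>Y\<close> at \<open>j\<close>; the second condition in (ii) is
  \<open>D k \<le> 0\<close>.\<close>

definition "D j = (\<Sum>i\<le>Suc j. p i) - (\<Sum>i\<le>j. q i)"

lemma D_Suc: "D (Suc j) = D j + (p (Suc (Suc j)) - q (Suc j))"
  by (simp add: D_def)

lemma D_lim: "D \<longlonglongrightarrow> 0"
proof -
  have "(\<lambda>j. \<Sum>i\<le>j. pmf s i) \<longlonglongrightarrow> 1" for s :: "nat pmf"
    using pmf_nat_sums[of s] by (simp add: sums_def_le)
  from LIMSEQ_Suc[OF this[of "poisson_pmf a"]] this[of "poisson_pmf b"]
  have "(\<lambda>j. (\<Sum>i\<le>Suc j. p i) - (\<Sum>i\<le>j. q i)) \<longlonglongrightarrow> 1 - 1" by (rule tendsto_diff)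
  then show ?thesis by (simp add: D_def[abs_def])
qed

text \<open>If \<open>D\<close> became positive after \<open>k\<close>, it would have to rise
  between \<open>k\<close> and \<open>j\<close>, and later fail to rise at some step because its
  limit is 0. By the shape of \<open>h\<close>, the ratio would then exceed 1 all the way from 0 to
  \<open>k\<close>, which makes \<open>D k\<close> itself positive.\<close>

lemma D_le_0_mono:
  assumes "D k \<le> 0" "k \<le> j"
  shows "D j \<le> 0"
proof (rule ccontr)
  assume "\<not> D j \<le> 0"
  then have Dj: "D j > 0" by simp
  have "\<exists>i. k \<le> i \<and> i < j \<and> D i < D (Suc i)"
  proof (rule ccontr)
    assume "\<not> ?thesis"
    then have "\<And>i. k \<le> i \<Longrightarrow> i < j \<Longrightarrow> D (Suc i) \<le> D i" by force
    with \<open>k \<le> j\<close> have "D j \<le> D k" by (induction j rule: dec_induct) (auto intro: order_trans)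
    then show False using Dj assms by simp
  qed
  then obtain i where i: "k \<le> i" "i < j" "1 < h (Suc i)"
    by (auto simp: D_Suc p_Suc_less)
  \<comment> \<open>Otherwise \<open>D\<close> would be nondecreasing from \<open>j\<close> on, and
    a positive value could not come down to the limit 0.\<close>
  have "\<exists>l\<ge>j. h (Suc l) \<le> 1"
  proof (rule ccontr)
    assume "\<not> ?thesis"
    then have "1 < h (Suc l)" if "j \<le> l" for l using that by force
    then have inc: "D l \<le> D (Suc l)" if "j \<le> l" for l
      using that p_Suc_less[of "Suc l"] by (simp add: D_Suc del: pmf_poisson)
    have "D j \<le> D l" if "j \<le> l" for l
      using that by (induction l rule: dec_induct) (auto intro: order_trans inc)
    then have "D j \<le> 0" using D_lim by (intro LIMSEQ_le_const) auto
    then show False using Dj by simp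
  qed
  then obtain l where l: "j \<le> l" "h (Suc l) \<le> 1" by auto
  \<comment> \<open>With \<open>h m \<le> 1\<close> there would be an upward crossing by
    \<open>Suc i\<close>, after which \<open>h\<close> stays above 1, against the choice of
    \<open>l\<close>. Summed over \<open>m \<le> k\<close>, with \<open>p 0\<close> in addition,
    this gives \<open>D k > 0\<close>.\<close>
  have "q m < p (Suc m)" if "m \<le> k" for m
    using h_unimodal[of m "Suc i" "Suc l"] that i l by (force simp: p_Suc_less)
  then have "(\<Sum>m\<le>k. q m) \<le> (\<Sum>m\<le>k. p (Suc m))" by (intro sum_mono) (auto intro: less_imp_le)
  moreover have "(\<Sum>m\<le>Suc k. p m) = p 0 + (\<Sum>m\<le>k. p (Suc m))" by (rule sum.atMost_Suc_shift)
  moreover have "p 0 > 0" using b ab by (simp add: p_eq)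
  ultimately have "D k > 0" by (simp add: D_def)
  then show False using assms by simp
qed

theorem existence_iff_no_obstruction:
  "(\<exists>k. p k \<le> q k \<and> (\<Sum>i\<le>Suc k. p i) \<le> (\<Sum>i\<le>k. q i)) \<longleftrightarrow>
    \<not> (\<exists>k. p (Suc k) > q (Suc k) \<and> (\<Sum>i\<le>Suc k. p i) > (\<Sum>i\<le>k. q i))" (is "?L \<longleftrightarrow> ?R")
proof
  assume ?L
  then obtain k where k: "p k \<le> q k" "D k \<le> 0" by (auto simp: D_def)
  show ?R
  proof
    assume "\<exists>k. p (Suc k) > q (Suc k) \<and> (\<Sum>i\<le>Suc k. p i) > (\<Sum>i\<le>k. q i)"
    then obtain l where l: "q (Suc l) < p (Suc l)" "D l > 0" by (auto simp: D_def)
    \<comment> \<open>An obstruction at \<open>l\<close> has \<open>p\<close> above \<open>q\<close>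
      at \<open>Suc l\<close>, hence beyond the initial segment that contains \<open>k\<close>; from
      \<open>k\<close> on, \<open>D\<close> is not positive.\<close>
    have "k \<le> l" using p_le_q_mono[OF k(1), of "Suc l"] l(1) by force
    then show False using D_le_0_mono[OF k(2)] l(2) by force
  qed
next
  assume R: ?R
  obtain N where N: "\<And>n. N \<le> n \<Longrightarrow> q n < p n" using p_gt_q_large by auto
  \<comment> \<open>At the end of the initial segment the first half of (iii) holds at
    \<open>Suc k\<close> automatically, so the absence of an obstruction yields the comparison of
    distribution functions.\<close>
  define k where "k = (GREATEST n. p n \<le> q n)"
  have bound: "\<And>n. p n \<le> q n \<Longrightarrow> n \<le> N" using N by (meson leD nle_le)
  have k: "p k \<le> q k"
    unfolding k_def by (rule GreatestI_nat[of "\<lambda>n. p n \<le> q n" 0 N]) (use p_le_q_0 bound in auto)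
  have "\<not> p (Suc k) \<le> q (Suc k)"
    using Greatest_le_nat[of "\<lambda>n. p n \<le> q n" "Suc k" N] bound by (force simp: k_def)
  then have "\<not> (\<Sum>i\<le>k. q i) < (\<Sum>i\<le>Suc k. p i)" using R by (meson not_le)
  then show ?L using k by (meson not_le)
qed

end

section \<open>Simple point measures\<close>

lemma simple_point_measuresD:
  assumes "\<nu> \<in> simple_point_measures S"
  shows "sets \<nu> = sets (restrict_space borel S)" "space \<nu> = S" "finite_measure \<nu>"
    "A \<in> sets \<nu> \<Longrightarrow> emeasure \<nu> A \<in> \<nat>"
    "x \<in> S \<Longrightarrow> emeasure \<nu> {x} \<le> 1"
proof -
  show s: "sets \<nu> = sets (restrict_space borel S)"
    using assms by (auto simp: simple_point_measures_def)
  show "space \<nu> = S"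
    using sets_eq_imp_space_eq[OF s] by (simp add: space_restrict_space)
qed (use assms in \<open>auto simp: simple_point_measures_def\<close>)

lemma space_point_measure_space [simp]:
  "space (point_measure_space S) = simple_point_measures S"
  unfolding point_measure_space_def by (rule space_measure_of) auto

lemma sets_point_measure_space:
  "sets (point_measure_space S) = sigma_sets (simple_point_measures S)
      {(\<lambda>\<nu>. emeasure \<nu> A) -` B \<inter> simple_point_measures S | A B.
        A \<in> sets (restrict_space borel S) \<and> B \<in> sets borel}"
  unfolding point_measure_space_def by (rule sets_measure_of) auto

lemma measurable_emeasure_point_measure_space [measurable]:
  assumes "A \<in> sets (restrict_space borel S)"
  shows "(\<lambda>\<nu>. emeasure \<nu> A) \<in> borel_measurable (point_measure_space S)"
  by (rule measurableI) (use assms in \<open>auto simp: sets_point_measure_space intro!: sigma_sets.Basic\<close>)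

lemma measurable_point_measure_spaceI:
  assumes "\<And>x. x \<in> space N \<Longrightarrow> f x \<in> simple_point_measures S"
    and "\<And>A. A \<in> sets (restrict_space borel S) \<Longrightarrow> (\<lambda>x. emeasure (f x) A) \<in> borel_measurable N"
  shows "f \<in> N \<rightarrow>\<^sub>M point_measure_space S"
  unfolding point_measure_space_def
proof (rule measurable_measure_of)
  fix y assume "y \<in> {(\<lambda>\<nu>. emeasure \<nu> A) -` B \<inter> simple_point_measures S | A B.
        A \<in> sets (restrict_space borel S) \<and> B \<in> sets borel}"
  then obtain A B where y: "y = (\<lambda>\<nu>. emeasure \<nu> A) -` B \<inter> simple_point_measures S"
    and A: "A \<in> sets (restrict_space borel S)" and B: "B \<in> sets borel" by auto
  have "f -` y \<inter> space N = (\<lambda>x. emeasure (f x) A) -` B \<inter> space N"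
    using assms(1) by (auto simp: y)
  then show "f -` y \<inter> space N \<in> sets N"
    using measurable_sets[OF assms(2)[OF A] B] by simp
qed (use assms(1) in auto)

lemma sets_restrict_borel_subset: "A \<in> sets (restrict_space borel S) \<Longrightarrow> A \<subseteq> S"
  using sets.sets_into_space[of A "restrict_space borel S"] by (simp add: space_restrict_space)

lemma singleton_in_restrict_borel:
  "x \<in> S \<Longrightarrow> {x} \<in> sets (restrict_space borel (S :: 'a::t1_space set))"
  by (auto simp: sets_restrict_space intro!: image_eqI[of _ _ "{x}"])

lemma ennreal_Nats_less_1: "(x::ennreal) \<in> \<nat> \<Longrightarrow> x < 1 \<Longrightarrow> x = 0"
  by (elim Nats_cases) (metis less_one of_nat_0 of_nat_1 of_nat_less_iff)

text \<open>An integer-valued finite measure is purely atomic. Around a point that is not an atom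
  the masses of shrinking balls tend to 0, and being integers they reach 0. A countable base then
  covers all points that are not atoms by countably many null sets.\<close>

lemma simple_point_measure_atoms:
  assumes \<nu>: "\<nu> \<in> simple_point_measures S"
  shows finite_points: "finite (points \<nu>)"
    and points_subset: "points \<nu> \<subseteq> S"
    and emeasure_eq_card_points:
      "A \<in> sets (restrict_space borel S) \<Longrightarrow> emeasure \<nu> A = of_nat (card (A \<inter> points \<nu>))"
proof -
  note D = simple_point_measuresD[OF \<nu>]
  interpret finite_measure \<nu> by (rule D)
  show sub: "points \<nu> \<subseteq> S" using D by (auto simp: points_def)
  have single: "{x} \<in> sets \<nu>" if "x \<in> S" for x
    using that by (simp add: D singleton_in_restrict_borel)
  have card: "emeasure \<nu> C = of_nat (card C)" if "finite C" "C \<subseteq> points \<nu>" for C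
  proof -
    have "emeasure \<nu> C = (\<Sum>x\<in>C. emeasure \<nu> {x})"
      using that sub by (intro emeasure_eq_sum_singleton) (auto intro!: single)
    also have "\<dots> = (\<Sum>x\<in>C. 1)" using that by (intro sum.cong) (auto simp: points_def)
    finally show ?thesis by simp
  qed
  have "emeasure \<nu> S \<in> \<nat>" using D(4)[of S] D(2) sets.top[of \<nu>] by simp
  then obtain N where N: "emeasure \<nu> S = of_nat N" by (auto elim: Nats_cases)
  show fin: "finite (points \<nu>)"
  proof (rule ccontr)
    assume "infinite (points \<nu>)"
    then obtain C where C: "C \<subseteq> points \<nu>" "finite C" "card C = Suc N"
      by (metis infinite_arbitrarily_large)
    have "emeasure \<nu> C \<le> emeasure \<nu> S"
      using C sub D(2) sets.top[of \<nu>] by (intro emeasure_mono) auto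
    then show False using card[of C] C N by (simp del: of_nat_Suc)
  qed
  obtain \<B> :: "'a set set" where \<B>: "countable \<B>" "topological_basis \<B>"
    using ex_countable_basis by blast
  define \<Z> where "\<Z> = {W\<in>\<B>. emeasure \<nu> (W \<inter> S) = 0}"
  have open_sets: "W \<inter> S \<in> sets \<nu>" if "open W" for W
    using that by (auto simp: D sets_restrict_space)
  have "(\<Union>W\<in>\<Z>. W \<inter> S) \<in> null_sets \<nu>"
    using \<B> by (intro null_sets_UN')
      (auto simp: \<Z>_def topological_basis_open intro!: null_setsI open_sets)
  moreover have "S - points \<nu> \<subseteq> (\<Union>W\<in>\<Z>. W \<inter> S)"
  proof
    fix x assume x: "x \<in> S - points \<nu>"
    have "emeasure \<nu> {x} \<in> \<nat>" "emeasure \<nu> {x} \<le> 1" "emeasure \<nu> {x} \<noteq> 1"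
      using x D single[of x] by (auto simp: points_def)
    then have x0: "emeasure \<nu> {x} = 0" by (auto intro: ennreal_Nats_less_1)
    define A where "A n = ball x (1 / real (Suc n)) \<inter> S" for n
    have A: "A n \<in> sets \<nu>" for n unfolding A_def by (rule open_sets) simp
    have "(\<Inter>n. A n) = {x}"
    proof -
      have "y = x" if "y \<in> (\<Inter>n. A n)" for y
      proof (rule ccontr)
        assume "y \<noteq> x"
        then have "dist x y > 0" by simp
        then obtain n where "1 / real (Suc n) < dist x y" by (rule nat_approx_posE)
        with that show False by (auto simp: A_def dest!: INT_D[of _ _ _ n]) (metis not_less_iff_gr_or_eq)
      qed
      then show ?thesis using x by (auto simp: A_def)
    qed
    moreover have "(\<lambda>n. emeasure \<nu> (A n)) \<longlonglongrightarrow> emeasure \<nu> (\<Inter>n. A n)"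
    proof (rule Lim_emeasure_decseq)
      show "decseq A"
        unfolding A_def by (intro decseq_SucI Int_mono subset_ball) (auto simp: divide_simps)
    qed (use A in \<open>auto\<close>)
    ultimately have "(\<lambda>n. emeasure \<nu> (A n)) \<longlonglongrightarrow> 0" using x0 by simp
    \<comment> \<open>Integrality turns convergence to 0 into being equal to 0: a mass below 1
      vanishes.\<close>
    then have "eventually (\<lambda>n. emeasure \<nu> (A n) < 1) sequentially"
      by (rule order_tendstoD) simp
    then obtain n where "emeasure \<nu> (A n) < 1" by (auto simp: eventually_sequentially)
    then have n0: "emeasure \<nu> (A n) = 0" using D(4)[OF A] by (auto intro: ennreal_Nats_less_1)
    obtain W where W: "W \<in> \<B>" "x \<in> W" "W \<subseteq> ball x (1 / real (Suc n))"
      using topological_basisE[OF \<B>(2), of "ball x (1 / real (Suc n))" x] by auto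
    have "emeasure \<nu> (W \<inter> S) \<le> emeasure \<nu> (A n)"
      using W A by (intro emeasure_mono) (auto simp: A_def)
    with W n0 x show "x \<in> (\<Union>W\<in>\<Z>. W \<inter> S)" by (auto simp: \<Z>_def)
  qed
  moreover have P: "points \<nu> \<in> sets \<nu>"
    by (rule sets.countable) (use fin sub single countable_finite in auto)
  ultimately have null: "S - points \<nu> \<in> null_sets \<nu>"
    using sets.Diff[OF sets.top[of \<nu>] P] by (auto simp: D(2) intro: null_sets_subset)
  show "emeasure \<nu> A = of_nat (card (A \<inter> points \<nu>))" if "A \<in> sets (restrict_space borel S)"
  proof -
    have A: "A \<in> sets \<nu>" "A \<subseteq> S" using that D(1) sets_restrict_borel_subset[OF that] by auto
    have "emeasure \<nu> (A - (S - points \<nu>)) = emeasure \<nu> A"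
      using A null by (intro emeasure_Diff_null_set)
    moreover have "A - (S - points \<nu>) = A \<inter> points \<nu>" using A by auto
    ultimately show ?thesis using card[of "A \<inter> points \<nu>"] fin by auto
  qed
qed

lemma simple_point_measure_eqI:
  assumes "\<nu> \<in> simple_point_measures S" "\<nu>' \<in> simple_point_measures S" "points \<nu> = points \<nu>'"
  shows "\<nu> = \<nu>'"
  using assms by (intro measure_eqI)
    (auto simp: simple_point_measuresD emeasure_eq_card_points)

text \<open>Balls whose radius is half the distance to the nearest other point are disjoint. This
  lets \<open>j\<close> points be witnessed by \<open>j\<close> disjoint basic sets.\<close>

lemma finite_disjoint_basis:
  fixes T :: "'a::metric_space set"
  assumes "finite T" "topological_basis \<B>"
  obtains W where "\<And>x. x \<in> T \<Longrightarrow> W x \<in> \<B>" "\<And>x. x \<in> T \<Longrightarrow> x \<in> W x" "disjoint_family_on W T"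
proof -
  have "\<forall>x\<in>T. \<exists>d>0. \<forall>y\<in>T. y \<noteq> x \<longrightarrow> d \<le> dist x y"
    using finite_set_avoid[OF assms(1)] by blast
  then obtain d where d: "\<And>x. x \<in> T \<Longrightarrow> d x > 0"
    "\<And>x y. x \<in> T \<Longrightarrow> y \<in> T \<Longrightarrow> y \<noteq> x \<Longrightarrow> d x \<le> dist x y" by metis
  have "\<forall>x\<in>T. \<exists>W\<in>\<B>. x \<in> W \<and> W \<subseteq> ball x (d x / 2)"
    using d topological_basisE[OF assms(2)] by (metis centre_in_ball half_gt_zero open_ball)
  then obtain W where W: "\<And>x. x \<in> T \<Longrightarrow> W x \<in> \<B> \<and> x \<in> W x \<and> W x \<subseteq> ball x (d x / 2)"
    by metis
  have "W x \<inter> W y = {}" if xy: "x \<in> T" "y \<in> T" "x \<noteq> y" for x y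
  proof (rule ccontr)
    assume "W x \<inter> W y \<noteq> {}"
    then obtain z where "z \<in> ball x (d x / 2)" "z \<in> ball y (d y / 2)" using W[OF xy(1)] W[OF xy(2)] by blast
    then have "dist x y < d x / 2 + d y / 2"
      using dist_triangle[of x y z] by (simp add: dist_commute)
    moreover have "d x \<le> dist x y" "d y \<le> dist x y"
      using d(2)[of x y] d(2)[of y x] xy by (auto simp: dist_commute)
    ultimately show False by linarith
  qed
  then show ?thesis using W that[of W] by (auto simp: disjoint_family_on_def)
qed

text \<open>A simple point measure has at least \<open>j\<close> points in \<open>A\<close> iff it charges the traces on \<open>A\<close>
  of \<open>j\<close> disjoint members of a countable base; so void events generate.\<close>

lemma sets_point_measure_space_void:
  "sets (point_measure_space S) = sigma_sets (simple_point_measures S)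
     {{\<nu>\<in>simple_point_measures S. emeasure \<nu> A = 0} | A. A \<in> sets (restrict_space borel S)}"
    (is "_ = sigma_sets ?\<Omega> ?G")
proof
  define N where "N = sigma ?\<Omega> ?G"
  have N: "space N = ?\<Omega>" "sets N = sigma_sets ?\<Omega> ?G"
    unfolding N_def by (auto intro!: space_measure_of sets_measure_of)
  have void: "{\<nu>\<in>?\<Omega>. emeasure \<nu> A = 0} \<in> sets N" if "A \<in> sets (restrict_space borel S)" for A
    unfolding N using that by (intro sigma_sets.Basic) auto
  have nonvoid: "{\<nu>\<in>?\<Omega>. emeasure \<nu> A \<noteq> 0} \<in> sets N" if "A \<in> sets (restrict_space borel S)" for A
    using sets.sets_Collect_neg[of N "\<lambda>\<nu>. emeasure \<nu> A = 0"] void[OF that] by (simp add: N)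
  obtain \<B> :: "'a set set" where \<B>: "countable \<B>" "topological_basis \<B>"
    using ex_countable_basis by blast
  have ge: "{\<nu>\<in>?\<Omega>. j \<le> card (A \<inter> points \<nu>)} \<in> sets N"
    if A: "A \<in> sets (restrict_space borel S)" for A j
  proof -
    \<comment> \<open>Finite subfamilies of a countable base are countable in number, so the union
      over \<open>I\<close> is a countable one.\<close>
    define I where "I = {\<W>. finite \<W> \<and> \<W> \<subseteq> \<B> \<and> card \<W> = j \<and> disjoint \<W>}"
    have AW: "A \<inter> W \<in> sets (restrict_space borel S)" if "W \<in> \<B>" for W
    proof -
      have "A \<inter> W = A \<inter> (S \<inter> W)" using sets_restrict_borel_subset[OF A] by auto
      moreover have "S \<inter> W \<in> sets (restrict_space borel S)"
        using topological_basis_open[OF \<B>(2) that] by (auto simp: sets_restrict_space)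
      ultimately show ?thesis using A by (metis sets.Int)
    qed
    have "{\<nu>\<in>?\<Omega>. j \<le> card (A \<inter> points \<nu>)}
      = (\<Union>\<W>\<in>I. {\<nu>\<in>?\<Omega>. \<forall>W\<in>\<W>. emeasure \<nu> (A \<inter> W) \<noteq> 0})"
    proof (intro equalityI subsetI)
      fix \<nu> assume "\<nu> \<in> {\<nu>\<in>?\<Omega>. j \<le> card (A \<inter> points \<nu>)}"
      then have \<nu>: "\<nu> \<in> ?\<Omega>" and "j \<le> card (A \<inter> points \<nu>)" by auto
      then obtain T where T: "T \<subseteq> A \<inter> points \<nu>" "card T = j" "finite T"
        using obtain_subset_with_card_n by metis
      obtain W where W: "\<And>x. x \<in> T \<Longrightarrow> W x \<in> \<B>" "\<And>x. x \<in> T \<Longrightarrow> x \<in> W x" "disjoint_family_on W T"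
        using finite_disjoint_basis[OF T(3) \<B>(2)] by metis
      have "inj_on W T"
        using W(2,3) unfolding inj_on_def disjoint_family_on_def by blast
      moreover have "disjoint (W ` T)"
        using W(3) by (rule disjoint_family_on_disjoint_image)
      ultimately have "W ` T \<in> I" using T W by (auto simp: I_def card_image)
      moreover have "emeasure \<nu> (A \<inter> W x) \<noteq> 0" if "x \<in> T" for x
        using that W(1)[OF that] W(2)[OF that] T(1) finite_points[OF \<nu>]
        by (auto simp: emeasure_eq_card_points[OF \<nu> AW])
      ultimately show "\<nu> \<in> (\<Union>\<W>\<in>I. {\<nu>\<in>?\<Omega>. \<forall>W\<in>\<W>. emeasure \<nu> (A \<inter> W) \<noteq> 0})"
        using \<nu> by (intro UN_I[of "W ` T"]) auto
    next
      fix \<nu> assume "\<nu> \<in> (\<Union>\<W>\<in>I. {\<nu>\<in>?\<Omega>. \<forall>W\<in>\<W>. emeasure \<nu> (A \<inter> W) \<noteq> 0})"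
      then obtain \<W> where \<W>: "\<W> \<in> I" and \<nu>: "\<nu> \<in> ?\<Omega>"
        and "\<And>W. W \<in> \<W> \<Longrightarrow> emeasure \<nu> (A \<inter> W) \<noteq> 0" by auto
      then have "\<forall>W\<in>\<W>. A \<inter> W \<inter> points \<nu> \<noteq> {}"
        using \<W> by (fastforce simp: emeasure_eq_card_points[OF \<nu> AW] I_def)
      then have "\<forall>W\<in>\<W>. \<exists>x. x \<in> A \<inter> W \<inter> points \<nu>" by blast
      \<comment> \<open>Disjoint members contain different points, so one point chosen in each
        bounds the count from below.\<close>
      then obtain z where z: "\<And>W. W \<in> \<W> \<Longrightarrow> z W \<in> A \<inter> W \<inter> points \<nu>" by metis
      have "inj_on z \<W>"
      proof (rule inj_onI)
        fix V W assume VW: "V \<in> \<W>" "W \<in> \<W>" "z V = z W"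
        then have "V \<inter> W \<noteq> {}" using z[of V] z[of W] by auto
        then show "V = W" using \<W> VW by (auto simp: I_def dest: disjointD)
      qed
      then have "j = card (z ` \<W>)" using \<W> by (simp add: card_image I_def)
      also have "\<dots> \<le> card (A \<inter> points \<nu>)"
        using z finite_points[OF \<nu>] by (intro card_mono) auto
      finally show "\<nu> \<in> {\<nu>\<in>?\<Omega>. j \<le> card (A \<inter> points \<nu>)}" using \<nu> by simp
    qed
    also have "\<dots> \<in> sets N"
    proof (rule sets.countable_UN'')
      show "countable I"
        unfolding I_def by (rule countable_subset[OF _ countable_Collect_finite_subset[OF \<B>(1)]]) auto
      show "{\<nu>\<in>?\<Omega>. \<forall>W\<in>\<W>. emeasure \<nu> (A \<inter> W) \<noteq> 0} \<in> sets N" if "\<W> \<in> I" for \<W>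
        using that nonvoid[OF AW] sets.sets_Collect_finite_All[of \<W> N "\<lambda>W \<nu>. emeasure \<nu> (A \<inter> W) \<noteq> 0"]
        by (auto simp: I_def N(1))
    qed
    finally show ?thesis .
  qed
  have meas: "(\<lambda>\<nu>. emeasure \<nu> A) \<in> borel_measurable N" if A: "A \<in> sets (restrict_space borel S)" for A
  proof -
    have "(\<lambda>\<nu>. card (A \<inter> points \<nu>)) \<in> N \<rightarrow>\<^sub>M count_space UNIV"
    proof (subst measurable_count_space_eq2_countable, safe)
      fix j
      have "(\<lambda>\<nu>. card (A \<inter> points \<nu>)) -` {j} \<inter> space N
        = {\<nu>\<in>?\<Omega>. j \<le> card (A \<inter> points \<nu>)} - {\<nu>\<in>?\<Omega>. Suc j \<le> card (A \<inter> points \<nu>)}"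
        by (auto simp: N)
      then show "(\<lambda>\<nu>. card (A \<inter> points \<nu>)) -` {j} \<inter> space N \<in> sets N"
        using ge[OF A] by auto
    qed auto
    then have "(\<lambda>\<nu>. of_nat (card (A \<inter> points \<nu>)) :: ennreal) \<in> borel_measurable N"
      by measurable
    then show ?thesis
      by (rule measurable_cong[THEN iffD1, rotated]) (auto simp: N emeasure_eq_card_points A)
  qed
  show "sets (point_measure_space S) \<subseteq> sigma_sets ?\<Omega> ?G"
    unfolding sets_point_measure_space
  proof (rule sigma_sets_mono, safe)
    fix A :: "'a set" and B :: "ennreal set" assume "A \<in> sets (restrict_space borel S)" "B \<in> sets borel"
    then show "(\<lambda>\<nu>. emeasure \<nu> A) -` B \<inter> ?\<Omega> \<in> sigma_sets ?\<Omega> ?G"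
      using measurable_sets[OF meas, of A B] by (simp add: N)
  qed
  show "sigma_sets ?\<Omega> ?G \<subseteq> sets (point_measure_space S)"
    unfolding sets_point_measure_space
  proof (rule sigma_sets_mono, safe)
    fix A :: "'a set" assume "A \<in> sets (restrict_space borel S)"
    then show "{\<nu>\<in>?\<Omega>. emeasure \<nu> A = 0} \<in> sigma_sets ?\<Omega> {(\<lambda>\<nu>. emeasure \<nu> A) -` B \<inter> ?\<Omega> | A B.
        A \<in> sets (restrict_space borel S) \<and> B \<in> sets borel}"
      by (intro sigma_sets.Basic CollectI exI[of _ A] exI[of _ "{0}"]) auto
  qed
qed

text \<open>Void events are closed under intersection, since being empty on \<open>A\<close> and on
  \<open>B\<close> is being empty on their union. As they generate the sigma-algebra, void
  probabilities determine the law of a simple point process.\<close>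

theorem point_process_law_eqI:
  assumes "prob_space L" "prob_space L'"
    and L: "sets L = sets (point_measure_space S)" and L': "sets L' = sets (point_measure_space S)"
    and eq: "\<And>A. A \<in> sets (restrict_space borel S) \<Longrightarrow>
      emeasure L {\<nu>\<in>simple_point_measures S. emeasure \<nu> A = 0}
      = emeasure L' {\<nu>\<in>simple_point_measures S. emeasure \<nu> A = 0}"
  shows "L = L'"
proof -
  interpret L: prob_space L by fact
  interpret L': prob_space L' by fact
  let ?\<Omega> = "simple_point_measures S"
  let ?G = "{{\<nu>\<in>?\<Omega>. emeasure \<nu> A = 0} | A. A \<in> sets (restrict_space borel S)}"
  have sp: "space L = ?\<Omega>" "space L' = ?\<Omega>"
    using sets_eq_imp_space_eq[OF L] sets_eq_imp_space_eq[OF L'] by auto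
  show ?thesis
  proof (rule measure_eqI_generator_eq[where E = ?G and \<Omega> = ?\<Omega> and A = "\<lambda>_. ?\<Omega>"])
    show "Int_stable ?G"
    proof (rule Int_stableI, safe)
      fix A B :: "'a set" assume AB: "A \<in> sets (restrict_space borel S)" "B \<in> sets (restrict_space borel S)"
      have "{\<nu>\<in>?\<Omega>. emeasure \<nu> A = 0} \<inter> {\<nu>\<in>?\<Omega>. emeasure \<nu> B = 0} = {\<nu>\<in>?\<Omega>. emeasure \<nu> (A \<union> B) = 0}"
        using AB by (auto simp: emeasure_eq_card_points finite_points Int_Un_distrib2 sets.Un)
      then show "\<exists>C. {\<nu>\<in>?\<Omega>. emeasure \<nu> A = 0} \<inter> {\<nu>\<in>?\<Omega>. emeasure \<nu> B = 0} = {\<nu>\<in>?\<Omega>. emeasure \<nu> C = 0}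
          \<and> C \<in> sets (restrict_space borel S)"
        using AB by blast
    qed
    show "?G \<subseteq> Pow ?\<Omega>" by auto
    show "sets L = sigma_sets ?\<Omega> ?G" "sets L' = sigma_sets ?\<Omega> ?G"
      unfolding L L' by (rule sets_point_measure_space_void)+
    show "range (\<lambda>_. ?\<Omega>) \<subseteq> ?G" by (auto intro!: exI[of _ "{}"])
    show "emeasure L ?\<Omega> \<noteq> \<infinity>" using L.emeasure_space_1 sp by simp
  qed (use eq in auto)
qed

section \<open>Poisson processes as mixtures of independent samples\<close>

text \<open>The sum of the unit masses at the points of \<open>C\<close>, obtained as the image of
  counting measure under the inclusion into \<open>S\<close>.\<close>

definition point_sum :: "'a::euclidean_space set \<Rightarrow> 'a set \<Rightarrow> 'a measure" where
  "point_sum S C = distr (count_space C) (restrict_space borel S) (\<lambda>x. x)"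

lemma
  fixes C :: "'a::euclidean_space set"
  assumes C: "finite C" "C \<subseteq> S"
  shows emeasure_point_sum:
      "A \<in> sets (restrict_space borel S) \<Longrightarrow> emeasure (point_sum S C) A = of_nat (card (A \<inter> C))"
    and point_sum_simple: "point_sum S C \<in> simple_point_measures S"
    and points_point_sum: "points (point_sum S C) = C"
proof -
  have s: "sets (point_sum S C) = sets (restrict_space borel S)" by (simp add: point_sum_def)
  have sp: "space (point_sum S C) = S" by (simp add: point_sum_def space_restrict_space)
  have m: "(\<lambda>x. x) \<in> count_space C \<rightarrow>\<^sub>M restrict_space borel S"
    using C by (auto simp: space_restrict_space)
  show *: "emeasure (point_sum S C) A = of_nat (card (A \<inter> C))" if "A \<in> sets (restrict_space borel S)" for A
    using that m C by (simp add: point_sum_def emeasure_distr emeasure_count_space)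
  have *: "emeasure (point_sum S C) A = of_nat (card (A \<inter> C))" if "A \<in> sets (point_sum S C)" for A
    using * that s by simp
  have single: "{x} \<in> sets (point_sum S C)" if "x \<in> S" for x
    using that by (simp add: s singleton_in_restrict_borel)
  have one: "emeasure (point_sum S C) {x} = (if x \<in> C then 1 else 0)" if "x \<in> S" for x
    using *[OF single[OF that]] by auto
  have "finite_measure (point_sum S C)"
    using *[OF sets.top] by (intro finite_measureI) simp
  then show "point_sum S C \<in> simple_point_measures S"
    using * one by (auto simp: simple_point_measures_def s)
  show "points (point_sum S C) = C"
    using one C by (auto simp: points_def sp split: if_splits)
qed

lemma pmf_poisson_law:
  assumes "r \<ge> 0"
  shows "pmf (poisson_law r) n = r ^ n / fact n * exp (- r)"
  using assms by (cases "r = 0") (auto simp: poisson_law_def pmf_return indicator_def)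

locale window =
  fixes S :: "'a::euclidean_space set"
  assumes S [measurable]: "S \<in> sets borel"
    and S_pos: "0 < emeasure lborel S" and S_finite: "emeasure lborel S < \<infinity>"
begin

abbreviation "vol A \<equiv> measure lborel A"

lemma vol_S: "vol S > 0" "emeasure lborel S = ennreal (vol S)"
  using S_pos S_finite by (auto simp: measure_def enn2real_positive_iff)

lemma sets_window_borel: "A \<in> sets (restrict_space borel S) \<Longrightarrow> A \<in> sets borel"
  using S by (auto simp: sets_restrict_space)

definition "U = uniform_measure lborel S"

lemma sets_U [simp, measurable_cong]: "sets U = sets borel"
  and space_U [simp]: "space U = UNIV"
  by (auto simp: U_def)

lemma prob_space_U: "prob_space U"
  unfolding U_def using S_pos S_finite by (intro prob_space_uniform_measure) auto

lemma emeasure_U: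
  assumes [measurable]: "A \<in> sets borel"
  shows "emeasure U A = ennreal (vol (S \<inter> A) / vol S)"
proof -
  have "emeasure lborel (S \<inter> A) \<le> emeasure lborel S" by (intro emeasure_mono) auto
  then have "emeasure lborel (S \<inter> A) = ennreal (vol (S \<inter> A))"
    using S_finite by (intro emeasure_eq_ennreal_measure) auto
  then show ?thesis
    using vol_S by (simp add: U_def divide_ennreal)
qed

lemma AE_U_S: "AE x in U. x \<in> S"
  unfolding U_def using S_pos S_finite by (intro AE_uniform_measureI) auto

sublocale U: prob_space U by (rule prob_space_U)

sublocale U_prod: product_prob_space "\<lambda>_. U" I for I :: "nat set"
  by (intro product_prob_spaceI prob_space_U)

abbreviation "sample I \<equiv> PiM I (\<lambda>_::nat. U)"

lemma prob_space_sample: "prob_space (sample I)"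
  by (intro prob_space_PiM prob_space_U)

text \<open>Fubini for null sets: the exceptional event has a null section in the new coordinate for
  every choice of the others.\<close>

lemma AE_sample_insert:
  assumes "finite I" "i \<notin> I" and [measurable]: "Measurable.pred (sample (insert i I)) Q"
    and Q: "\<And>x. x \<in> space (sample I) \<Longrightarrow> AE z in U. Q (x(i := z))"
  shows "AE x in sample (insert i I). Q x"
proof -
  have "emeasure (sample (insert i I)) {x\<in>space (sample (insert i I)). \<not> Q x}
    = (\<integral>\<^sup>+x. indicator {x\<in>space (sample (insert i I)). \<not> Q x} x \<partial>sample (insert i I))"
    by simp
  also have "\<dots> = (\<integral>\<^sup>+x. \<integral>\<^sup>+z. indicator {x\<in>space (sample (insert i I)). \<not> Q x} (x(i := z)) \<partial>U \<partial>sample I)"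
    using assms(1,2) by (intro U_prod.product_nn_integral_insert) auto
  also have "\<dots> = (\<integral>\<^sup>+x. 0 \<partial>sample I)"
  proof (rule nn_integral_cong)
    fix x assume x: "x \<in> space (sample I)"
    have "(\<integral>\<^sup>+z. indicator {x\<in>space (sample (insert i I)). \<not> Q x} (x(i := z)) \<partial>U) = (\<integral>\<^sup>+z. 0 \<partial>U)"
      by (rule nn_integral_cong_AE) (use Q[OF x] in \<open>auto elim!: eventually_mono\<close>)
    then show "(\<integral>\<^sup>+z. indicator {x\<in>space (sample (insert i I)). \<not> Q x} (x(i := z)) \<partial>U) = 0" by simp
  qed
  finally show ?thesis
    by (intro AE_I'[of "{x\<in>space (sample (insert i I)). \<not> Q x}"]) (auto intro!: null_setsI)
qed

text \<open>With \<open>x i\<close> fixed, an independent coordinate \<open>x j\<close> hits the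
  value \<open>h (x i)\<close> with probability 0. This is applied to the identity, for distinct
  points, and to \<open>F\<close>, for distinct marks.\<close>

lemma AE_sample_inj:
  fixes h :: "'a \<Rightarrow> 'b::{second_countable_topology, t2_space}"
  assumes I: "finite I" and [measurable]: "h \<in> borel_measurable borel"
    and h: "\<And>c. emeasure U {z. h z = c} = 0"
  shows "AE x in sample I. inj_on (\<lambda>i. h (x i)) I"
proof -
  have "AE x in sample I. h (x i) \<noteq> h (x j)" if ij: "i \<in> I" "j \<in> I" "i \<noteq> j" for i j
  proof -
    have I': "I = insert j (I - {j})" using ij by auto
    have "AE x in sample (insert j (I - {j})). h (x i) \<noteq> h (x j)"
    proof (rule AE_sample_insert)
      have *: "(\<lambda>x. h (x k)) \<in> borel_measurable (sample (insert j (I - {j})))"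
        if "k \<in> I" for k
        by (rule measurable_compose[OF measurable_component_singleton, of _ _ _ "\<lambda>_. U"]) (use that in auto)
      show "Measurable.pred (sample (insert j (I - {j}))) (\<lambda>x. h (x i) \<noteq> h (x j))"
        unfolding pred_def using measurable_equality_set[of "\<lambda>x. h (x i)" "sample (insert j (I - {j}))" "\<lambda>x. h (x j)"] ij *
        by (intro sets.sets_Collect_neg) auto
      fix x
      have "AE z in U. h z \<noteq> h (x i)"
        using h[of "h (x i)"] by (intro AE_I'[of "{z. h z = h (x i)}"]) (auto intro!: null_setsI)
      then show "AE z in U. h ((x(j := z)) i) \<noteq> h ((x(j := z)) j)"
        using ij by (auto elim!: eventually_mono)
    qed (use I in auto)
    then show ?thesis by (subst I')
  qed
  then have "AE x in sample I. \<forall>i\<in>I. \<forall>j\<in>I. i \<noteq> j \<longrightarrow> h (x i) \<noteq> h (x j)"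
    using I by (auto simp: AE_finite_all)
  then show ?thesis by (auto elim!: eventually_mono simp: inj_on_def)
qed

lemma AE_sample_component:
  assumes I: "finite I" and P: "AE z in U. P z"
  shows "AE x in sample I. \<forall>i\<in>I. P (x i)"
  using I P by (auto simp: AE_finite_all intro!: AE_PiM_component prob_space_U)

lemma emeasure_U_single: "emeasure U {z. z = c} = 0"
  by (simp add: emeasure_U measure_lborel_singleton Int_insert_right)

definition "good I x \<longleftrightarrow> inj_on x I \<and> x ` I \<subseteq> S" for x :: "nat \<Rightarrow> 'a"

lemma AE_good:
  assumes "finite I"
  shows "AE x in sample I. good I x"
proof -
  have "AE x in sample I. inj_on (\<lambda>i. x i) I"
    by (rule AE_sample_inj) (use assms emeasure_U_single in auto)
  then show ?thesis
    using AE_sample_component[OF assms AE_U_S] by eventually_elim (auto simp: good_def)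
qed

lemma measurable_good [measurable]:
  assumes [simp]: "finite I"
  shows "Measurable.pred (sample I) (good I)"
proof -
  have "Measurable.pred (sample I) (\<lambda>x. x i = x j)" if [measurable]: "i \<in> I" "j \<in> I" for i j
    unfolding pred_def by measurable
  then have "Measurable.pred (sample I) (\<lambda>x. (\<forall>i\<in>I. \<forall>j\<in>I. x i = x j \<longrightarrow> i = j) \<and> (\<forall>i\<in>I. x i \<in> S))"
    by (auto intro!: pred_intros_finite pred_intros_logic)
  also have "(\<lambda>x. (\<forall>i\<in>I. \<forall>j\<in>I. x i = x j \<longrightarrow> i = j) \<and> (\<forall>i\<in>I. x i \<in> S)) = good I"
    by (auto simp: fun_eq_iff good_def inj_on_def)
  finally show ?thesis .
qed

text \<open>Off the almost sure event \<open>good\<close> the empty measure is used, so that every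
  value is a simple point measure.\<close>

definition "emp I x = point_sum S (if good I x then x ` I else {})"

lemma emp_simple: "finite I \<Longrightarrow> emp I x \<in> simple_point_measures S"
  by (auto simp: emp_def good_def intro!: point_sum_simple)

text \<open>Distinct coordinates are not counted twice, so the count is a sum of indicators over
  labels; in this form its measurability is visible.\<close>

lemma emeasure_emp:
  assumes "finite I" "A \<in> sets (restrict_space borel S)"
  shows "emeasure (emp I x) A = (if good I x then (\<Sum>i\<in>I. indicator A (x i)) else 0)"
proof (cases "good I x")
  case True
  then have "card (A \<inter> x ` I) = card (x ` {i\<in>I. x i \<in> A})"
    by (intro arg_cong[where f=card]) auto
  also have "\<dots> = card {i\<in>I. x i \<in> A}"
    using True by (intro card_image) (auto simp: good_def inj_on_def)
  also have "of_nat \<dots> = (\<Sum>i\<in>I. indicator A (x i) :: ennreal)"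
    using assms by (simp add: indicator_def sum.If_cases Int_def)
  finally show ?thesis
    using True assms by (auto simp: emp_def good_def emeasure_point_sum)
qed (use assms in \<open>auto simp: emp_def emeasure_point_sum\<close>)

lemma measurable_emp [measurable]:
  assumes I: "finite I"
  shows "emp I \<in> sample I \<rightarrow>\<^sub>M point_measure_space S"
proof (rule measurable_point_measure_spaceI)
  fix A assume A: "A \<in> sets (restrict_space borel S)"
  note [measurable] = sets_window_borel[OF A] measurable_good[OF I]
  show "(\<lambda>x. emeasure (emp I x) A) \<in> borel_measurable (sample I)"
    unfolding emeasure_emp[OF I A] by measurable
qed (use emp_simple[OF I] in auto)

text \<open>The binomial process: the conditional law of a Poisson process on \<open>S\<close> given
  that it has \<open>n\<close> points, whatever the intensity.\<close>

definition "law n = distr (sample {..<n}) (point_measure_space S) (emp {..<n})"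

lemma sets_law [simp, measurable_cong]: "sets (law n) = sets (point_measure_space S)"
  and space_law [simp]: "space (law n) = simple_point_measures S"
  by (auto simp: law_def)

lemma prob_space_law: "prob_space (law n)"
  unfolding law_def by (intro prob_space.prob_space_distr prob_space_sample measurable_emp) auto

lemma S_window [measurable]: "S \<in> sets (restrict_space borel S)"
  using sets.top[of "restrict_space borel S"] by (simp add: space_restrict_space)

lemma count_level_measurable [measurable]:
  assumes "A \<in> sets (restrict_space borel S)"
  shows "{\<nu>\<in>simple_point_measures S. emeasure \<nu> A = c} \<in> sets (point_measure_space S)"
  using measurable_sets[OF measurable_emeasure_point_measure_space[OF assms], of "{c}"]
  by (simp add: vimage_def Int_def conj_commute)

lemma AE_law_count: "AE \<nu> in law n. emeasure \<nu> S = of_nat n"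
proof -
  have "AE x in sample {..<n}. emeasure (emp {..<n} x) S = of_nat n"
    using AE_good[OF finite_lessThan, of n]
  proof eventually_elim
    case (elim x)
    then have "(\<Sum>i<n. indicator S (x i)) = (\<Sum>i<n. 1 :: ennreal)"
      by (intro sum.cong) (auto simp: good_def)
    then show ?case using elim S_window by (simp add: emeasure_emp)
  qed
  then show ?thesis
    unfolding law_def by (subst AE_distr_iff) (auto intro!: measurable_emp count_level_measurable S_window)
qed

text \<open>Almost surely, having no point in \<open>A\<close> means that each of \<open>n\<close>
  independent uniform coordinates avoids \<open>A\<close>.\<close>

lemma law_void:
  assumes A: "A \<in> sets (restrict_space borel S)"
  shows "emeasure (law n) {\<nu>\<in>simple_point_measures S. emeasure \<nu> A = 0} = ennreal ((1 - vol A / vol S) ^ n)"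
proof -
  have AS: "A \<subseteq> S" and [measurable]: "A \<in> sets borel"
    using A by (auto simp: sets_window_borel dest: sets_restrict_borel_subset)
  have V: "{\<nu>\<in>simple_point_measures S. emeasure \<nu> A = 0} \<in> sets (point_measure_space S)"
    by (rule count_level_measurable[OF A])
  have "emeasure (law n) {\<nu>\<in>simple_point_measures S. emeasure \<nu> A = 0}
    = emeasure (sample {..<n}) (emp {..<n} -` {\<nu>\<in>simple_point_measures S. emeasure \<nu> A = 0} \<inter> space (sample {..<n}))"
    unfolding law_def by (rule emeasure_distr) (auto intro: V measurable_emp)
  also have "\<dots> = emeasure (sample {..<n}) (PiE {..<n} (\<lambda>_. - A))"
  proof (rule emeasure_eq_AE)
    show "AE x in sample {..<n}. x \<in> emp {..<n} -` {\<nu>\<in>simple_point_measures S. emeasure \<nu> A = 0} \<inter> space (sample {..<n})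
        \<longleftrightarrow> x \<in> PiE {..<n} (\<lambda>_. - A)"
      using AE_good[OF finite_lessThan, of n] AE_space
      by eventually_elim
        (auto simp: emeasure_emp A emp_simple space_PiM PiE_iff indicator_def split: if_splits)
    show "emp {..<n} -` {\<nu>\<in>simple_point_measures S. emeasure \<nu> A = 0} \<inter> space (sample {..<n}) \<in> sets (sample {..<n})"
      by (rule measurable_sets[OF measurable_emp V]) simp
  qed auto
  also have "\<dots> = (\<Prod>i<n. emeasure U (- A))"
    by (intro U_prod.emeasure_PiM) auto
  also have "emeasure U (- A) = ennreal (1 - vol A / vol S)"
  proof -
    have "vol (S \<inter> - A) = vol S - vol A"
      using AS S_finite by (subst measure_Diff[symmetric]) (auto simp: Diff_eq)
    then show ?thesis using vol_S by (simp add: emeasure_U diff_divide_distrib)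
  qed
  also have "(\<Prod>i<n. ennreal (1 - vol A / vol S)) = ennreal ((1 - vol A / vol S) ^ n)"
  proof -
    have "vol A \<le> vol S"
      using AS S_finite by (intro measure_mono_fmeasurable) (auto simp: fmeasurable_def)
    then show ?thesis using vol_S by (simp add: ennreal_power)
  qed
  finally show ?thesis .
qed

text \<open>The mixed binomial representation: a Poisson number of independent uniform points. It
  reduces the comparison of two intensities to that of two laws on the integers.\<close>

definition "poisson_mix r = measure_pmf (poisson_pmf (r * vol S)) \<bind> law"

lemma law_kernel: "law \<in> measure_pmf p \<rightarrow>\<^sub>M subprob_algebra (point_measure_space S)"
  by (auto simp: space_subprob_algebra intro!: prob_space_imp_subprob_space prob_space_law)

lemma sets_poisson_mix [simp, measurable_cong]: "sets (poisson_mix r) = sets (point_measure_space S)"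
  and space_poisson_mix [simp]: "space (poisson_mix r) = simple_point_measures S"
  unfolding poisson_mix_def by (auto intro!: sets_bind space_bind[where N="point_measure_space S", simplified])

lemma emeasure_poisson_mix:
  "E \<in> sets (point_measure_space S) \<Longrightarrow>
    emeasure (poisson_mix r) E = (\<integral>\<^sup>+n. emeasure (law n) E \<partial>poisson_pmf (r * vol S))"
  unfolding poisson_mix_def by (rule emeasure_bind[OF _ law_kernel]) auto

lemma prob_space_poisson_mix: "prob_space (poisson_mix r)"
  unfolding poisson_mix_def
  by (rule prob_space.prob_space_bind[OF prob_space_measure_pmf _ law_kernel]) (auto intro: prob_space_law)

text \<open>\<open>law m\<close> is carried by configurations of \<open>m\<close> points, so only
  the term \<open>m = n\<close> of the mixture survives. Two intensities thus differ on
  \<open>E\<close> only by a Poisson weight.\<close>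

lemma emeasure_poisson_mix_count:
  assumes r: "r > 0" and E: "E \<in> sets (point_measure_space S)"
    and n: "\<And>\<nu>. \<nu> \<in> E \<Longrightarrow> emeasure \<nu> S = of_nat n"
  shows "emeasure (poisson_mix r) E = pmf (poisson_pmf (r * vol S)) n * emeasure (law n) E"
proof -
  have 0: "emeasure (law m) E = 0" if "m \<noteq> n" for m
  proof -
    have "AE \<nu> in law m. \<nu> \<notin> E"
      using AE_law_count[of m] by eventually_elim (use n that in \<open>force\<close>)
    moreover have "{\<nu>\<in>space (law m). \<not> \<nu> \<notin> E} = E"
      using sets.sets_into_space[OF E] by auto
    ultimately show ?thesis using E AE_iff_measurable[of E "law m" "\<lambda>\<nu>. \<nu> \<notin> E"] by simp
  qed
  have "emeasure (poisson_mix r) E = (\<integral>\<^sup>+m. ennreal (pmf (poisson_pmf (r * vol S)) m) * emeasure (law m) E \<partial>count_space UNIV)"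
    by (simp add: emeasure_poisson_mix[OF E] nn_integral_measure_pmf)
  also have "\<dots> = (\<integral>\<^sup>+m. ennreal (pmf (poisson_pmf (r * vol S)) n) * emeasure (law n) E * indicator {n} m \<partial>count_space UNIV)"
    by (intro nn_integral_cong) (auto simp: 0 indicator_def)
  finally show ?thesis by simp
qed

text \<open>It suffices to compare void probabilities. Averaging
  \<open>(1 - vol A / vol S) ^ n\<close> over the Poisson number of points is an exponential series
  with sum \<open>exp (- r * vol A)\<close>.\<close>

theorem distr_poisson_process:
  assumes "prob_space M" and P: "prob_space.poisson_process M S r \<Phi>" and r: "r > 0"
  shows "distr M (point_measure_space S) \<Phi> = poisson_mix r"
proof -
  interpret prob_space M by fact
  have \<Phi> [measurable]: "random_variable (point_measure_space S) \<Phi>"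
    using P by (simp add: poisson_process_def)
  show ?thesis
  proof (rule point_process_law_eqI)
    show "prob_space (distr M (point_measure_space S) \<Phi>)" by (rule prob_space_distr) (rule \<Phi>)
    show "prob_space (poisson_mix r)" by (rule prob_space_poisson_mix)
    fix A assume A: "A \<in> sets (restrict_space borel S)"
    let ?V = "{\<nu>\<in>simple_point_measures S. emeasure \<nu> A = 0}"
    have V: "?V \<in> sets (point_measure_space S)"
      by (rule count_level_measurable[OF A])
    have [measurable]: "(\<lambda>\<omega>. emeasure (\<Phi> \<omega>) A) \<in> borel_measurable M"
      by (rule measurable_compose[OF \<Phi> measurable_emeasure_point_measure_space[OF A]])
    have a: "0 \<le> r * vol A" using r by simp
    have "emeasure (distr M (point_measure_space S) \<Phi>) ?V = emeasure (distr M borel (\<lambda>\<omega>. emeasure (\<Phi> \<omega>) A)) {0}"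
      using V measurable_space[OF \<Phi>]
      by (auto simp: emeasure_distr intro!: arg_cong[where f="emeasure M"])
    also have "\<dots> = emeasure (distr (measure_pmf (poisson_law (r * vol A))) borel (of_nat :: nat \<Rightarrow> ennreal)) {0}"
      using P A by (simp add: poisson_process_def)
    also have "\<dots> = emeasure (measure_pmf (poisson_law (r * vol A))) {0}"
      by (subst emeasure_distr) (auto intro!: arg_cong2[where f=emeasure])
    also have "\<dots> = ennreal (exp (- r * vol A))"
      using a by (simp add: emeasure_pmf_single pmf_poisson_law)
    also have "\<dots> = emeasure (poisson_mix r) ?V"
    proof -
      have "vol A \<le> vol S" 
        using sets_restrict_borel_subset[OF A] S_finite sets_window_borel[OF A]
        by (intro measure_mono_fmeasurable) (auto simp: fmeasurable_def)
      then have pos: "0 \<le> 1 - vol A / vol S" using vol_S by simp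
      let ?s = "r * vol S"
      have s: "?s > 0" using r vol_S by simp
      have "emeasure (poisson_mix r) ?V = (\<integral>\<^sup>+n. ennreal (pmf (poisson_pmf ?s) n * (1 - vol A / vol S) ^ n) \<partial>count_space UNIV)"
        using pos by (simp add: emeasure_poisson_mix[OF V] law_void[OF A] nn_integral_measure_pmf ennreal_mult del: pmf_poisson)
      also have "\<dots> = (\<Sum>n. ennreal (pmf (poisson_pmf ?s) n * (1 - vol A / vol S) ^ n))"
        by (rule nn_integral_count_space_nat)
      also have "\<dots> = ennreal (exp (?s * (1 - vol A / vol S)) * exp (- ?s))"
      proof (rule suminf_ennreal_eq)
        have "(\<lambda>n. (?s * (1 - vol A / vol S)) ^ n /\<^sub>R fact n * exp (- ?s)) sums (exp (?s * (1 - vol A / vol S)) * exp (- ?s))"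
          by (intro sums_mult2 exp_converges)
        then show "(\<lambda>n. pmf (poisson_pmf ?s) n * (1 - vol A / vol S) ^ n) sums (exp (?s * (1 - vol A / vol S)) * exp (- ?s))"
          using s by (simp add: power_mult_distrib divide_inverse mult_ac)
      qed (use pos in simp)
      also have "exp (?s * (1 - vol A / vol S)) * exp (- ?s) = exp (- r * vol A)"
        using vol_S by (simp add: field_simps flip: exp_add)
      finally show ?thesis by simp
    qed
    finally show "emeasure (distr M (point_measure_space S) \<Phi>) ?V = emeasure (poisson_mix r) ?V" .
  qed auto
qed

end

section \<open>Change of intensity by a density\<close>

lemma poisson_law_density:
  assumes r: "r \<ge> 0" and "\<rho> > 0"
  shows "ennreal (pmf (poisson_law r) k) * ennreal (exp ((1 - \<rho>) * r) * \<rho> ^ k) = ennreal (pmf (poisson_law (\<rho> * r)) k)"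
proof -
  have "pmf (poisson_law r) k * (exp ((1 - \<rho>) * r) * \<rho> ^ k) = pmf (poisson_law (\<rho> * r)) k"
    using assms by (simp add: pmf_poisson_law power_mult_distrib left_diff_distrib exp_diff exp_minus field_simps)
  then show ?thesis by (simp flip: ennreal_mult')
qed

context window
begin

text \<open>On configurations of \<open>n\<close> points both mixtures are multiples of
  \<open>law n\<close>, so the density is the ratio of two Poisson weights. Writing the power of
  \<open>\<rho>\<close> with \<open>powr\<close> makes it a function of the total mass of
  \<open>\<nu>\<close>.\<close>

lemma poisson_mix_density:
  assumes r: "r > 0" and \<rho>: "\<rho> > 0" and E: "E \<in> sets (point_measure_space S)"
  shows "emeasure (poisson_mix (\<rho> * r)) E
    = (\<integral>\<^sup>+\<nu>. indicator E \<nu> * ennreal (exp ((1 - \<rho>) * (r * vol S)) * \<rho> powr enn2real (emeasure \<nu> S)) \<partial>poisson_mix r)"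
proof -
  define W where "W t = ennreal (exp ((1 - \<rho>) * (r * vol S)) * \<rho> powr t)" for t
  have [measurable]: "W \<in> borel_measurable borel" unfolding W_def by measurable
  note [measurable] = measurable_emeasure_point_measure_space[OF S_window] E
  have "(\<integral>\<^sup>+\<nu>. indicator E \<nu> * W (enn2real (emeasure \<nu> S)) \<partial>poisson_mix r)
    = (\<integral>\<^sup>+n. \<integral>\<^sup>+\<nu>. indicator E \<nu> * W (enn2real (emeasure \<nu> S)) \<partial>law n \<partial>poisson_pmf (r * vol S))"
    unfolding poisson_mix_def by (rule nn_integral_bind[OF _ law_kernel]) measurable
  also have "\<dots> = (\<integral>\<^sup>+n. emeasure (law n) E * W (real n) \<partial>poisson_pmf (r * vol S))"
  proof (rule nn_integral_cong)
    fix n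
    have "(\<integral>\<^sup>+\<nu>. indicator E \<nu> * W (enn2real (emeasure \<nu> S)) \<partial>law n) = (\<integral>\<^sup>+\<nu>. indicator E \<nu> * W (real n) \<partial>law n)"
      by (rule nn_integral_cong_AE) (use AE_law_count[of n] in \<open>auto elim!: eventually_mono\<close>)
    also have "\<dots> = emeasure (law n) E * W (real n)"
      by (subst nn_integral_multc) auto
    finally show "(\<integral>\<^sup>+\<nu>. indicator E \<nu> * W (enn2real (emeasure \<nu> S)) \<partial>law n) = emeasure (law n) E * W (real n)" .
  qed
  also have "\<dots> = (\<integral>\<^sup>+n. emeasure (law n) E \<partial>poisson_pmf (\<rho> * r * vol S))"
    unfolding nn_integral_measure_pmf
  proof (rule nn_integral_cong)
    fix n
    have "r * vol S \<noteq> 0" "\<rho> * (r * vol S) \<noteq> 0" using r \<rho> vol_S by auto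
    then have "ennreal (pmf (poisson_pmf (r * vol S)) n) * W (real n) = ennreal (pmf (poisson_pmf (\<rho> * (r * vol S))) n)"
      using poisson_law_density[of "r * vol S" \<rho> n] r \<rho> vol_S
      by (simp add: poisson_law_def W_def powr_realpow del: pmf_poisson)
    then show "ennreal (pmf (poisson_pmf (r * vol S)) n) * (emeasure (law n) E * W (real n))
      = ennreal (pmf (poisson_pmf (\<rho> * r * vol S)) n) * emeasure (law n) E"
      unfolding mult.assoc by (metis mult.left_commute mult.commute)
  qed
  finally show ?thesis by (simp add: emeasure_poisson_mix[OF E] W_def)
qed

text \<open>The joint law of the counts is not computed from samples. The law of
  \<open>\<Psi>\<close> has a density with respect to that of \<open>\<Phi>\<close> which is a
  product over any finite partition of \<open>S\<close>; so independence of counts passes from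
  \<open>\<Phi>\<close> to \<open>\<Psi>\<close>, and each factor turns a Poisson weight of
  intensity \<open>lam\<close> into one of intensity \<open>mu\<close>.\<close>

theorem poisson_processI_distr:
  assumes M: "prob_space M" and P: "prob_space.poisson_process M S lam \<Phi>" and lam: "lam > 0" and mu: "mu > 0"
    and \<Psi>: "\<Psi> \<in> M \<rightarrow>\<^sub>M point_measure_space S"
    and distr: "distr M (point_measure_space S) \<Psi> = poisson_mix mu"
  shows "prob_space.poisson_process M S mu \<Psi>"
proof -
  interpret prob_space M by fact
  have \<Phi>: "random_variable (point_measure_space S) \<Phi>"
    and marg: "\<And>A. A \<in> sets (restrict_space borel S) \<Longrightarrow> distr M borel (\<lambda>\<omega>. emeasure (\<Phi> \<omega>) A) =
      distr (measure_pmf (poisson_law (lam * vol A))) borel (of_nat :: nat \<Rightarrow> ennreal)"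
    and indep: "\<And>(n::nat) A. (\<And>i. i < n \<Longrightarrow> A i \<in> sets (restrict_space borel S)) \<Longrightarrow> disjoint_family_on A {..<n} \<Longrightarrow>
      indep_vars (\<lambda>_. borel) (\<lambda>i \<omega>. emeasure (\<Phi> \<omega>) (A i)) {..<n}"
    using P unfolding poisson_process_def by simp_all
  note [measurable] = \<Phi> \<Psi>
  have cnt\<Phi> [measurable]: "(\<lambda>\<omega>. emeasure (\<Phi> \<omega>) A) \<in> borel_measurable M"
    and cnt\<Psi> [measurable]: "(\<lambda>\<omega>. emeasure (\<Psi> \<omega>) A) \<in> borel_measurable M"
    if "A \<in> sets (restrict_space borel S)" for A
    using measurable_compose[OF \<Phi> measurable_emeasure_point_measure_space[OF that]]
      measurable_compose[OF \<Psi> measurable_emeasure_point_measure_space[OF that]] by auto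
  define \<rho> where "\<rho> = mu / lam"
  have \<rho>: "\<rho> > 0" "\<rho> * lam = mu" using lam mu by (auto simp: \<rho>_def)
  define w where "w a z = ennreal (exp ((1 - \<rho>) * (lam * a)) * \<rho> powr enn2real z)" for a z
  have [measurable]: "w a \<in> borel_measurable borel" for a unfolding w_def by measurable
  have dens: "emeasure M {\<omega>\<in>space M. \<Psi> \<omega> \<in> E} = (\<integral>\<^sup>+\<omega>. indicator E (\<Phi> \<omega>) * w (vol S) (emeasure (\<Phi> \<omega>) S) \<partial>M)"
    if E [measurable]: "E \<in> sets (point_measure_space S)" for E
  proof -
    have "emeasure M {\<omega>\<in>space M. \<Psi> \<omega> \<in> E} = emeasure (poisson_mix (\<rho> * lam)) E"
      unfolding \<rho>(2) distr[symmetric]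
      by (subst emeasure_distr) (auto intro!: arg_cong[where f="emeasure M"])
    also have "\<dots> = (\<integral>\<^sup>+\<nu>. indicator E \<nu> * w (vol S) (emeasure \<nu> S) \<partial>poisson_mix lam)"
      unfolding w_def by (rule poisson_mix_density[OF lam \<rho>(1) E])
    also have "\<dots> = (\<integral>\<^sup>+\<omega>. indicator E (\<Phi> \<omega>) * w (vol S) (emeasure (\<Phi> \<omega>) S) \<partial>M)"
      unfolding distr_poisson_process[OF M P lam, symmetric]
      using measurable_emeasure_point_measure_space[OF S_window]
      by (subst nn_integral_distr) auto
    finally show ?thesis .
  qed
  have single: "(\<integral>\<^sup>+\<omega>. indicator B (emeasure (\<Phi> \<omega>) A) * w (vol A) (emeasure (\<Phi> \<omega>) A) \<partial>M)
      = emeasure (distr (measure_pmf (poisson_law (mu * vol A))) borel (of_nat :: nat \<Rightarrow> ennreal)) B"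
    if A: "A \<in> sets (restrict_space borel S)" and [measurable]: "B \<in> sets borel" for A B
  proof -
    have "(\<integral>\<^sup>+\<omega>. indicator B (emeasure (\<Phi> \<omega>) A) * w (vol A) (emeasure (\<Phi> \<omega>) A) \<partial>M)
      = (\<integral>\<^sup>+z. indicator B z * w (vol A) z \<partial>distr M borel (\<lambda>\<omega>. emeasure (\<Phi> \<omega>) A))"
      using A by (subst nn_integral_distr) auto
    also have "\<dots> = (\<integral>\<^sup>+k. indicator B (of_nat k) * w (vol A) (of_nat k) \<partial>poisson_law (lam * vol A))"
      unfolding marg[OF A] by (subst nn_integral_distr) auto
    also have "\<dots> = (\<integral>\<^sup>+k. indicator B (of_nat k) \<partial>poisson_law (mu * vol A))"
      unfolding nn_integral_measure_pmf
    proof (rule nn_integral_cong)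
      fix k :: nat
      have "ennreal (pmf (poisson_law (lam * vol A)) k) * w (vol A) (of_nat k) = ennreal (pmf (poisson_law (mu * vol A)) k)"
        using poisson_law_density[of "lam * vol A" \<rho> k] lam \<rho>
        by (simp add: w_def powr_realpow mult.assoc[symmetric])
      then show "ennreal (pmf (poisson_law (lam * vol A)) k) * (indicator B (of_nat k) * w (vol A) (of_nat k))
        = ennreal (pmf (poisson_law (mu * vol A)) k) * indicator B (of_nat k)"
        by (metis mult.left_commute mult.commute)
    qed
    also have "\<dots> = (\<integral>\<^sup>+z. indicator B z \<partial>distr (measure_pmf (poisson_law (mu * vol A))) borel (of_nat :: nat \<Rightarrow> ennreal))"
      by (subst nn_integral_distr) auto
    finally show ?thesis by simp
  qed
  have joint: "emeasure M {\<omega>\<in>space M. \<forall>i<n. emeasure (\<Psi> \<omega>) (A i) \<in> B i}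
      = (\<Prod>i<n. emeasure (distr (measure_pmf (poisson_law (mu * vol (A i)))) borel (of_nat :: nat \<Rightarrow> ennreal)) (B i))"
    if A: "\<And>i. i < n \<Longrightarrow> A i \<in> sets (restrict_space borel S)" and disj: "disjoint_family_on A {..<n}"
      and B: "\<And>i. i < n \<Longrightarrow> B i \<in> sets borel" for n :: nat and A B
  proof -
    \<comment> \<open>The density depends on the mass of all of \<open>S\<close>. Adding the
      complement as the member with index \<open>n\<close>, with the trivial constraint
      \<open>B' n = UNIV\<close>, completes the given sets to a partition.\<close>
    define A' where "A' i = (if i < n then A i else S - (\<Union>j<n. A j))" for i
    define B' where "B' i = (if i < n then B i else UNIV)" for i
    have B' [measurable]: "B' i \<in> sets borel" for i using B by (auto simp: B'_def)
    have A' [measurable]: "A' i \<in> sets (restrict_space borel S)" for i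
      using A S_window by (auto simp: A'_def)
    have disj': "disjoint_family_on A' {..<Suc n}"
      using disj by (auto simp: disjoint_family_on_def A'_def)
    have un: "(\<Union>i<Suc n. A' i) = S"
    proof
      show "(\<Union>i<Suc n. A' i) \<subseteq> S" using A' sets_restrict_borel_subset by blast
      show "S \<subseteq> (\<Union>i<Suc n. A' i)"
        unfolding lessThan_Suc by (auto simp: A'_def)
    qed
    have vol_sum: "vol S = (\<Sum>i<Suc n. vol (A' i))"
    proof -
      have "vol (\<Union>i<Suc n. A' i) = (\<Sum>i<Suc n. vol (A' i))"
      proof (rule measure_finite_Union)
        fix i
        have "emeasure lborel (A' i) \<le> emeasure lborel S"
          using sets_restrict_borel_subset[OF A'[of i]] by (intro emeasure_mono) auto
        then show "emeasure lborel (A' i) \<noteq> \<infinity>" using S_finite by auto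
      qed (use disj' A' sets_window_borel in auto)
      then show ?thesis by (simp only: un)
    qed
    \<comment> \<open>Volume and mass are additive over the partition, and exponential and power
      turn these sums into products.\<close>
    have w_sum: "w (vol S) (emeasure \<nu> S) = (\<Prod>i<Suc n. w (vol (A' i)) (emeasure \<nu> (A' i)))"
      if \<nu>: "\<nu> \<in> simple_point_measures S" for \<nu>
    proof -
      interpret \<nu>: finite_measure \<nu> using \<nu> by (rule simple_point_measuresD)
      have "(\<Sum>i<Suc n. emeasure \<nu> (A' i)) = emeasure \<nu> (\<Union>i<Suc n. A' i)"
        by (rule sum_emeasure[OF _ disj']) (use A' simple_point_measuresD(1)[OF \<nu>] in blast, simp)
      then have "emeasure \<nu> S = (\<Sum>i<Suc n. emeasure \<nu> (A' i))" by (simp only: un)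
      then have 1: "enn2real (emeasure \<nu> S) = (\<Sum>i<Suc n. enn2real (emeasure \<nu> (A' i)))"
        using enn2real_sum[of "{..<Suc n}" "\<lambda>i. emeasure \<nu> (A' i)"] \<nu>.emeasure_finite
        unfolding o_def less_top[symmetric] by metis
      have "exp ((1 - \<rho>) * (lam * vol S)) * \<rho> powr enn2real (emeasure \<nu> S)
        = (\<Prod>i<Suc n. exp ((1 - \<rho>) * (lam * vol (A' i)))) * (\<Prod>i<Suc n. \<rho> powr enn2real (emeasure \<nu> (A' i)))"
      proof (rule arg_cong2[where f="(*)"])
        show "exp ((1 - \<rho>) * (lam * vol S)) = (\<Prod>i<Suc n. exp ((1 - \<rho>) * (lam * vol (A' i))))"
          unfolding vol_sum sum_distrib_left by (rule exp_sum) simp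
        show "\<rho> powr enn2real (emeasure \<nu> S) = (\<Prod>i<Suc n. \<rho> powr enn2real (emeasure \<nu> (A' i)))"
          unfolding 1 using \<rho>(1) by (intro powr_sum) auto
      qed
      then show ?thesis
        unfolding w_def by (simp only: prod.distrib[symmetric]) (rule prod_ennreal[symmetric], simp)
    qed
    define E where "E = {\<nu>\<in>simple_point_measures S. \<forall>i\<in>{..<n}. emeasure \<nu> (A i) \<in> B i}"
    have E: "E \<in> sets (point_measure_space S)"
    proof -
      have "{\<nu>\<in>space (point_measure_space S). emeasure \<nu> (A i) \<in> B i} \<in> sets (point_measure_space S)" if "i \<in> {..<n}" for i
        using measurable_sets[OF measurable_emeasure_point_measure_space[OF A] B, of i i] that
        by (simp add: vimage_def Int_def conj_commute)
      then have "{\<nu>\<in>space (point_measure_space S). \<forall>i\<in>{..<n}. emeasure \<nu> (A i) \<in> B i} \<in> sets (point_measure_space S)"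
        by (intro sets.sets_Collect_finite_All) auto
      then show ?thesis by (simp add: E_def)
    qed
    have "{\<omega>\<in>space M. \<forall>i<n. emeasure (\<Psi> \<omega>) (A i) \<in> B i} = {\<omega>\<in>space M. \<Psi> \<omega> \<in> E}"
      using measurable_space[OF \<Psi>] by (auto simp: E_def)
    then have "emeasure M {\<omega>\<in>space M. \<forall>i<n. emeasure (\<Psi> \<omega>) (A i) \<in> B i}
      = (\<integral>\<^sup>+\<omega>. indicator E (\<Phi> \<omega>) * w (vol S) (emeasure (\<Phi> \<omega>) S) \<partial>M)"
      using dens[OF E] by simp
    also have "\<dots> = (\<integral>\<^sup>+\<omega>. (\<Prod>i<Suc n. indicator (B' i) (emeasure (\<Phi> \<omega>) (A' i)) * w (vol (A' i)) (emeasure (\<Phi> \<omega>) (A' i))) \<partial>M)"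
    proof (rule nn_integral_cong)
      fix \<omega> assume "\<omega> \<in> space M"
      then have \<nu>: "\<Phi> \<omega> \<in> simple_point_measures S" using measurable_space[OF \<Phi>] by auto
      have "indicator E (\<Phi> \<omega>) = (\<Prod>i<n. indicator (B i) (emeasure (\<Phi> \<omega>) (A i)) :: ennreal)"
        using \<nu> by (auto simp: E_def indicator_def prod_zero_iff)
      also have "\<dots> = (\<Prod>i<Suc n. indicator (B' i) (emeasure (\<Phi> \<omega>) (A' i)))"
        by (simp add: A'_def B'_def)
      finally show "indicator E (\<Phi> \<omega>) * w (vol S) (emeasure (\<Phi> \<omega>) S)
        = (\<Prod>i<Suc n. indicator (B' i) (emeasure (\<Phi> \<omega>) (A' i)) * w (vol (A' i)) (emeasure (\<Phi> \<omega>) (A' i)))"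
        by (simp only: w_sum[OF \<nu>] prod.distrib)
    qed
    also have "\<dots> = (\<Prod>i<Suc n. \<integral>\<^sup>+\<omega>. indicator (B' i) (emeasure (\<Phi> \<omega>) (A' i)) * w (vol (A' i)) (emeasure (\<Phi> \<omega>) (A' i)) \<partial>M)"
    proof (rule indep_vars_nn_integral)
      show "indep_vars (\<lambda>_. borel) (\<lambda>i \<omega>. indicator (B' i) (emeasure (\<Phi> \<omega>) (A' i)) * w (vol (A' i)) (emeasure (\<Phi> \<omega>) (A' i))) {..<Suc n}"
        by (rule indep_vars_compose2[OF indep[OF A' disj'], where Y="\<lambda>i z. indicator (B' i) z * w (vol (A' i)) z"]) measurable
    qed auto
    also have "\<dots> = (\<Prod>i<Suc n. emeasure (distr (measure_pmf (poisson_law (mu * vol (A' i)))) borel (of_nat :: nat \<Rightarrow> ennreal)) (B' i))"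
      by (intro prod.cong single) auto
    also have "\<dots> = (\<Prod>i<n. emeasure (distr (measure_pmf (poisson_law (mu * vol (A i)))) borel (of_nat :: nat \<Rightarrow> ennreal)) (B i))"
    proof -
      have "prob_space (distr (measure_pmf (poisson_law c)) borel (of_nat :: nat \<Rightarrow> ennreal))" for c
        by (rule measure_pmf.prob_space_distr) simp
      from prob_space.emeasure_space_1[OF this] show ?thesis by (simp add: A'_def B'_def)
    qed
    finally show ?thesis .
  qed
  have marg': "distr M borel (\<lambda>\<omega>. emeasure (\<Psi> \<omega>) A) =
      distr (measure_pmf (poisson_law (mu * vol A))) borel (of_nat :: nat \<Rightarrow> ennreal)"
    if A: "A \<in> sets (restrict_space borel S)" for A
  proof (rule measure_eqI)
    fix B :: "ennreal set" assume "B \<in> sets (distr M borel (\<lambda>\<omega>. emeasure (\<Psi> \<omega>) A))"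
    then have B: "B \<in> sets borel" by simp
    then show "emeasure (distr M borel (\<lambda>\<omega>. emeasure (\<Psi> \<omega>) A)) B
      = emeasure (distr (measure_pmf (poisson_law (mu * vol A))) borel (of_nat :: nat \<Rightarrow> ennreal)) B"
      using joint[of 1 "\<lambda>_. A" "\<lambda>_. B"] A cnt\<Psi>[OF A]
      by (simp add: emeasure_distr[OF cnt\<Psi>[OF A]] vimage_def Int_def conj_commute disjoint_family_on_def)
  qed simp
  have "indep_vars (\<lambda>_. borel) (\<lambda>i \<omega>. emeasure (\<Psi> \<omega>) (A i)) {..<n}"
    if A: "\<And>i. i < n \<Longrightarrow> A i \<in> sets (restrict_space borel S)" and disj: "disjoint_family_on A {..<n}"
    for n :: nat and A
  proof (cases "n = 0")
    case True
    then show ?thesis by (simp add: indep_vars_def2 indep_sets_def)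
  next
    case False
    let ?F = "\<lambda>i. {(\<lambda>\<omega>. emeasure (\<Psi> \<omega>) (A i)) -` B \<inter> space M | B. B \<in> sets (borel :: ennreal measure)}"
    have "indep_sets ?F {..<n}"
    proof (subst indep_sets_finite)
      show "\<forall>C\<in>Pi {..<n} ?F. prob (\<Inter>j\<in>{..<n}. C j) = (\<Prod>j\<in>{..<n}. prob (C j))"
      proof
        fix C assume "C \<in> Pi {..<n} ?F"
        then have "\<forall>i\<in>{..<n}. \<exists>B. B \<in> sets borel \<and> C i = (\<lambda>\<omega>. emeasure (\<Psi> \<omega>) (A i)) -` B \<inter> space M"
          unfolding Pi_iff mem_Collect_eq by metis
        then obtain B where B: "\<And>i. i < n \<Longrightarrow> B i \<in> sets borel"
          "\<And>i. i < n \<Longrightarrow> C i = (\<lambda>\<omega>. emeasure (\<Psi> \<omega>) (A i)) -` B i \<inter> space M" by (metis lessThan_iff)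
        have "(\<Inter>j\<in>{..<n}. C j) = {\<omega>\<in>space M. \<forall>i<n. emeasure (\<Psi> \<omega>) (A i) \<in> B i}"
          using False B(2) by auto
        then have "emeasure M (\<Inter>j\<in>{..<n}. C j) = (\<Prod>i<n. emeasure (distr M borel (\<lambda>\<omega>. emeasure (\<Psi> \<omega>) (A i))) (B i))"
          using joint[OF A disj B(1)] by (simp add: marg' A)
        also have "\<dots> = (\<Prod>i<n. emeasure M (C i))"
          by (intro prod.cong) (auto simp: emeasure_distr cnt\<Psi> A B)
        also have "\<dots> = ennreal (\<Prod>i<n. prob (C i))"
          by (simp add: emeasure_eq_measure prod_ennreal)
        finally show "prob (\<Inter>j\<in>{..<n}. C j) = (\<Prod>j\<in>{..<n}. prob (C j))"
          by (simp add: emeasure_eq_measure prod_nonneg)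
      qed
      show "?F i \<subseteq> events" if "i \<in> {..<n}" for i
        using that measurable_sets[OF cnt\<Psi>[OF A]] by auto
      show "space M \<in> ?F i" if "i \<in> {..<n}" for i
        by (auto intro!: exI[of _ UNIV])
    qed (use False in auto)
    then show ?thesis using cnt\<Psi> A by (auto simp: indep_vars_def2)
  qed
  then show ?thesis using \<Psi> marg' by (auto simp: poisson_process_def)
qed

end

section \<open>A uniform mark\<close>

lemma emeasure_lborel_translate:
  assumes "A \<in> sets borel"
  shows "emeasure lborel {s. s + t \<in> A} = emeasure lborel (A :: real set)"
proof -
  have "emeasure lborel A = emeasure (density (distr lborel borel (\<lambda>x. t + 1 * x)) (\<lambda>_. ennreal \<bar>1\<bar>)) A"
    using lborel_real_affine[of 1 t] by simp
  also have "\<dots> = emeasure lborel {s. s + t \<in> A}"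
    using assms by (simp add: emeasure_density emeasure_distr vimage_def add.commute)
  finally show ?thesis by simp
qed

lemma borel_measurable_frac [measurable]: "frac \<in> borel_measurable (borel :: real measure)"
  unfolding frac_def by measurable

text \<open>Rotations of the circle preserve length. With \<open>c = frac t\<close>, the shift
  carries the part of the unit interval below \<open>1 - c\<close> to the part above
  \<open>c\<close>, and wraps the rest around to the part below \<open>c\<close>.\<close>

lemma emeasure_frac_shift:
  assumes [measurable]: "B \<in> sets borel"
  shows "emeasure lborel {s\<in>{0..<1}. frac (s + t) \<in> B} = emeasure lborel (B \<inter> {0..<1 :: real})"
proof -
  define c where "c = frac t"
  have c: "0 \<le> c" "c < 1" by (auto simp: c_def frac_lt_1)
  have "frac (s + t) = frac (s + c)" for s
  proof -
    have "\<lfloor>s + c + of_int \<lfloor>t\<rfloor>\<rfloor> = \<lfloor>s + c\<rfloor> + \<lfloor>t\<rfloor>" by simp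
    then show ?thesis by (simp add: frac_def c_def)
  qed
  moreover have "frac (s + c) = (if s < 1 - c then s + c else s + (c - 1))" if "s \<in> {0..<1}" for s
    using that c by (auto simp: frac_unique_iff)
  ultimately have split: "{s\<in>{0..<1}. frac (s + t) \<in> B} = {s. s + c \<in> B \<inter> {c..<1}} \<union> {s. s + (c - 1) \<in> B \<inter> {0..<c}}"
    using c by (auto split: if_splits)
  have "emeasure lborel {s\<in>{0..<1}. frac (s + t) \<in> B} = emeasure lborel {s. s + c \<in> B \<inter> {c..<1}} + emeasure lborel {s. s + (c - 1) \<in> B \<inter> {0..<c}}"
    unfolding split using c by (intro plus_emeasure[symmetric]) auto
  also have "\<dots> = emeasure lborel (B \<inter> {c..<1}) + emeasure lborel (B \<inter> {0..<c})"
    by (intro arg_cong2[where f="(+)"] emeasure_lborel_translate) auto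
  also have "\<dots> = emeasure lborel (B \<inter> {c..<1} \<union> B \<inter> {0..<c})"
    by (intro plus_emeasure) auto
  also have "B \<inter> {c..<1} \<union> B \<inter> {0..<c} = B \<inter> {0..<1}" using c by auto
  finally show ?thesis .
qed

text \<open>The affine map \<open>s \<mapsto> (c + s) / r\<close> sends the unit interval onto the
  cell, scaling length by \<open>1 / r\<close>; what remains is a rotation by
  \<open>c + d\<close>.\<close>

lemma emeasure_cell_frac:
  assumes [measurable]: "B \<in> sets borel" and r: "r > 0"
  shows "emeasure lborel {t. \<lfloor>r * t\<rfloor> = c \<and> frac (r * t + d) \<in> B}
    = ennreal (1 / r) * emeasure lborel (B \<inter> {0..<1 :: real})"
proof -
  let ?A = "{t. \<lfloor>r * t\<rfloor> = c \<and> frac (r * t + d) \<in> B}"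
  have [measurable]: "?A \<in> sets borel" by measurable
  have "emeasure lborel ?A = emeasure (density (distr lborel borel (\<lambda>x. c / r + 1 / r * x)) (\<lambda>_. ennreal \<bar>1 / r\<bar>)) ?A"
    using lborel_real_affine[of "1 / r" "c / r"] r by simp
  also have "\<dots> = ennreal (1 / r) * emeasure lborel {s. c / r + 1 / r * s \<in> ?A}"
    using r by (simp add: emeasure_density nn_integral_cmult emeasure_distr vimage_def)
  also have "{s. c / r + 1 / r * s \<in> ?A} = {s\<in>{0..<1}. frac (s + (c + d)) \<in> B}"
  proof -
    have "r * (c / r + 1 / r * s) = s + c" for s :: real using r by (simp add: field_simps)
    then show ?thesis by (auto simp: floor_eq_iff ac_simps)
  qed
  also have "emeasure lborel \<dots> = emeasure lborel (B \<inter> {0..<1 :: real})"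
    by (rule emeasure_frac_shift) simp
  finally show ?thesis .
qed

text \<open>The unit interval is cut into consecutive intervals of lengths \<open>pmf w n\<close>.
  Outside it the value is a fixed element of the support, so that \<open>R v\<close> lies in the
  support for every \<open>v\<close> and not merely almost every \<open>v\<close>.\<close>

lemma pmf_quantile_nat:
  fixes w :: "nat pmf"
  shows "\<exists>R. R \<in> borel \<rightarrow>\<^sub>M count_space UNIV \<and> (\<forall>v. R v \<in> set_pmf w) \<and>
    (\<forall>n. emeasure lborel ({v. R v = n} \<inter> {0..<1 :: real}) = ennreal (pmf w n))"
proof -
  define f where "f n = (\<Sum>i<n. pmf w i)" for n
  have f: "incseq f" "f \<longlonglongrightarrow> 1" "f 0 = 0" and fS: "f (Suc n) = f n + pmf w n" for n
    using pmf_nat_sums[of w] by (simp_all add: f_def[abs_def] sums_def incseq_SucI)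
  note I = incseq_intervals[OF f(1,2), unfolded f(3)]
  obtain n0 where n0: "n0 \<in> set_pmf w" using set_pmf_not_empty[of w] by blast
  have "\<exists>!n. v \<in> {f n..<f (Suc n)}" if "v \<in> {0..<1}" for v
  proof -
    have "v \<in> (\<Union>n. {f n..<f (Suc n)})" unfolding I(2) by (rule that)
    then obtain n where "v \<in> {f n..<f (Suc n)}" by (rule UN_E)
    moreover have "m = n" if "v \<in> {f m..<f (Suc m)}" "v \<in> {f n..<f (Suc n)}" for m n
      using disjoint_family_onD[OF I(1) UNIV_I UNIV_I, of m n] that by (metis IntI empty_iff)
    ultimately show ?thesis by (metis ex1I)
  qed
  note ex1 = this
  define R where "R v = (if v \<in> {0..<1} then THE n. v \<in> {f n..<f (Suc n)} else n0)" for v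
  have R_iff: "R v = n \<longleftrightarrow> v \<in> {f n..<f (Suc n)}" if "v \<in> {0..<1}" for v n
    using theI'[OF ex1[OF that]] ex1[OF that] that unfolding R_def by metis
  have sub: "{f n..<f (Suc n)} \<subseteq> {0..<1}" for n unfolding I(2)[symmetric] by (rule UN_upper) simp
  have set_eq: "{v. R v = n} \<inter> {0..<1} = {f n..<f (Suc n)}" for n
    using R_iff[of _ n] sub[of n] by blast
  have out: "R v = n0" if "v \<notin> {0..<1}" for v using that unfolding R_def by (rule if_not_P)
  show ?thesis
  proof (intro exI[of _ R] conjI allI)
    show "R \<in> borel \<rightarrow>\<^sub>M count_space UNIV"
    proof (subst measurable_count_space_eq2_countable, intro conjI ballI)
      fix n
      have "R -` {n} \<inter> space borel = ({v. R v = n} \<inter> {0..<1}) \<union> (if n = n0 then - {0..<1} else {})"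
        using out by (auto simp del: atLeastLessThan_iff)
      then have "R -` {n} \<inter> space borel = {f n..<f (Suc n)} \<union> (if n = n0 then - {0..<1} else {})"
        by (simp only: set_eq)
      then show "R -` {n} \<inter> space borel \<in> sets borel" by simp
    qed auto
    show "R v \<in> set_pmf w" for v
    proof (cases "v \<in> {0..<1}")
      case True
      then have "v \<in> {f (R v)..<f (Suc (R v))}" using R_iff[of v "R v"] by simp
      then show ?thesis using pmf_nonneg[of w "R v"] by (auto simp: fS set_pmf_iff)
    next
      case False
      show ?thesis unfolding out[OF False] by (rule n0)
    qed
    show "emeasure lborel ({v. R v = n} \<inter> {0..<1}) = ennreal (pmf w n)" for n
      unfolding set_eq by (simp add: fS)
  qed
qed

lemma pmf_quantile:
  fixes w :: "'a pmf"
  obtains R :: "real \<Rightarrow> 'a" where "R \<in> borel \<rightarrow>\<^sub>M count_space UNIV" "\<And>v. R v \<in> set_pmf w"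
    "\<And>x. emeasure lborel ({v. R v = x} \<inter> {0..<1}) = ennreal (pmf w x)"
proof -
  let ?A = "set_pmf w"
  let ?t = "to_nat_on ?A"
  have inj: "inj_on ?t ?A" by (rule inj_on_to_nat_on) simp
  obtain R :: "real \<Rightarrow> nat" where R: "R \<in> borel \<rightarrow>\<^sub>M count_space UNIV" "\<And>v. R v \<in> set_pmf (map_pmf ?t w)"
    "\<And>n. emeasure lborel ({v. R v = n} \<inter> {0..<1}) = ennreal (pmf (map_pmf ?t w) n)"
    using pmf_quantile_nat[of "map_pmf ?t w"] by metis
  show thesis
  proof (rule that[of "\<lambda>v. from_nat_into ?A (R v)"])
    show "(\<lambda>v. from_nat_into ?A (R v)) \<in> borel \<rightarrow>\<^sub>M count_space UNIV"
      by (rule measurable_compose[OF R(1)]) simp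
    show *: "from_nat_into ?A (R v) \<in> ?A" for v
      by (rule from_nat_into[OF set_pmf_not_empty])
    fix x
    show "emeasure lborel ({v. from_nat_into ?A (R v) = x} \<inter> {0..<1}) = ennreal (pmf w x)"
    proof (cases "x \<in> ?A")
      case True
      have "from_nat_into ?A (R v) = x \<longleftrightarrow> R v = ?t x" for v
        using R(2)[of v] True inj by (auto simp: from_nat_into_to_nat_on)
      then show ?thesis using True inj by (simp add: R(3) pmf_map_inj)
    next
      case False
      then have "{v. from_nat_into ?A (R v) = x} = {}" using * by auto
      then show ?thesis using False by (simp add: set_pmf_iff)
    qed
  qed
qed

context window
begin

text \<open>The probability integral transform of a coordinate; it is atomless because hyperplanes are
  null.\<close>

lemma uniform_coordinate:
  obtains F :: "'a \<Rightarrow> real" where "F \<in> borel_measurable borel" "\<And>z. 0 \<le> F z" "\<And>z. F z \<le> 1"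
    "\<And>B. B \<in> sets borel \<Longrightarrow> emeasure U {z. F z \<in> B} = emeasure lborel (B \<inter> {0..<1})"
proof -
  obtain e :: 'a where e: "e \<in> Basis" using nonempty_Basis by blast
  define X where "X z = z \<bullet> e" for z :: 'a
  have X [measurable]: "X \<in> borel_measurable borel" unfolding X_def by measurable
  define D where "D = distr U borel X"
  interpret D: real_distribution D
    unfolding D_def by (intro real_distribution.intro U.prob_space_distr real_distribution_axioms.intro) auto
  interpret D: cdf_distribution D ..
  have atomless: "measure D {t} = 0" for t
  proof -
    have "negligible {z. e \<bullet> z = t}" using e by (intro negligible_hyperplane) auto
    then have "{z. e \<bullet> z = t} \<in> null_sets lborel"
      by (auto simp: negligible_iff_null_sets null_sets_completion_iff)
    then have "emeasure lborel {z. X z = t} = 0" by (simp add: X_def inner_commute null_setsD1)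
    then have "emeasure lborel (S \<inter> {z. X z = t}) = 0"
      using emeasure_mono[of "S \<inter> {z. X z = t}" "{z. X z = t}" lborel] by simp
    then have "emeasure U {z. X z = t} = 0" by (simp add: emeasure_U measure_def)
    then show ?thesis by (simp add: D_def measure_def emeasure_distr vimage_def)
  qed
  define G where "G = cdf D"
  have G [measurable]: "G \<in> borel_measurable borel" unfolding G_def by (rule D.measurable_C)
  have cont: "isCont G t" for t unfolding G_def using atomless by (simp add: D.isCont_cdf)
  \<comment> \<open>\<open>D.I\<close> is the generalised inverse: to the left of
    \<open>D.I \<omega>\<close> the function \<open>G\<close> stays below \<open>\<omega>\<close>,
    and continuity carries this bound to the point itself.\<close>
  have GI: "G (D.I \<omega>) = \<omega>" if "\<omega> \<in> {0<..<1}" for \<omega>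
  proof (rule antisym)
    have iff: "\<omega> \<le> G x \<longleftrightarrow> D.I \<omega> \<le> x" for x
      unfolding G_def using that by (intro D.pseudoinverse) auto
    show "\<omega> \<le> G (D.I \<omega>)" unfolding iff by simp
    have "(G \<longlongrightarrow> G (D.I \<omega>)) (at_left (D.I \<omega>))"
      using cont[of "D.I \<omega>"] by (auto simp: isCont_def intro: filterlim_at_split[THEN iffD1, THEN conjunct1])
    moreover have "eventually (\<lambda>x. G x \<le> \<omega>) (at_left (D.I \<omega>))"
      using iff by (auto simp: eventually_at_left_field not_le intro!: exI[of _ "D.I \<omega> - 1"] less_imp_le) (metis not_le)
    ultimately show "G (D.I \<omega>) \<le> \<omega>" by (rule tendsto_upperbound) simp
  qed
  show thesis
  proof (rule that[of "\<lambda>z. G (X z)"])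
    show "(\<lambda>z. G (X z)) \<in> borel_measurable borel" by measurable
    show "0 \<le> G (X z)" "G (X z) \<le> 1" for z by (simp_all add: G_def D.cdf_nonneg D.cdf_bounded_prob)
    fix B :: "real set" assume [measurable]: "B \<in> sets borel"
    have "emeasure U {z. G (X z) \<in> B} = emeasure D {x. G x \<in> B}"
      by (simp add: D_def emeasure_distr vimage_def)
    \<comment> \<open>Under Lebesgue measure on the open unit interval \<open>D.I\<close> has law
      \<open>D\<close>, and applying \<open>G\<close> to it gives back the uniform variable.\<close>
    also have "\<dots> = emeasure (distr (restrict_space lborel {0<..<1}) borel D.I) {x. G x \<in> B}"
      by (simp only: D.distr_I_eq_M)
    also have "\<dots> = emeasure (restrict_space lborel {0<..<1}) {\<omega>\<in>{0<..<1}. G (D.I \<omega>) \<in> B}"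
      by (subst emeasure_distr)
        (auto simp: space_restrict_space vimage_def Int_def intro!: D.measurable_CI[simplified] arg_cong2[where f=emeasure])
    also have "{\<omega>\<in>{0<..<1}. G (D.I \<omega>) \<in> B} = B \<inter> {0<..<1}" using GI by auto
    also have "emeasure (restrict_space lborel {0<..<1}) (B \<inter> {0<..<1}) = emeasure lborel (B \<inter> {0<..<1})"
      by (subst emeasure_restrict_space) auto
    also have "\<dots> = emeasure lborel (B \<inter> {0..<1})"
      using AE_lborel_singleton[of "0::real"] by (intro emeasure_eq_AE) (auto elim!: eventually_mono)
    finally show "emeasure U {z. G (X z) \<in> B} = emeasure lborel (B \<inter> {0..<1})" .
  qed
qed

end

section \<open>Deterministic selection\<close>

text \<open>A larger key has a strictly larger set of predecessors, so ranks are injective; they lie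
  below \<open>card J\<close>, and counting gives surjectivity.\<close>

lemma bij_betw_rank:
  fixes \<kappa> :: "'i \<Rightarrow> 'b::linorder"
  assumes J: "finite J" and inj: "inj_on \<kappa> J"
  shows "bij_betw (\<lambda>i. card {k\<in>J. \<kappa> k < \<kappa> i}) J {..<card J}"
proof -
  let ?r = "\<lambda>i. card {k\<in>J. \<kappa> k < \<kappa> i}"
  have less: "?r i < ?r j" if "i \<in> J" "j \<in> J" "\<kappa> i < \<kappa> j" for i j
  proof (rule psubset_card_mono)
    have "i \<in> {k\<in>J. \<kappa> k < \<kappa> j}" "i \<notin> {k\<in>J. \<kappa> k < \<kappa> i}" using that by auto
    moreover have "{k\<in>J. \<kappa> k < \<kappa> i} \<subseteq> {k\<in>J. \<kappa> k < \<kappa> j}"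
      using that(3) by (auto intro: less_trans)
    ultimately show "{k\<in>J. \<kappa> k < \<kappa> i} \<subset> {k\<in>J. \<kappa> k < \<kappa> j}" by blast
  qed (use J in simp)
  have "inj_on ?r J"
  proof (rule inj_onI)
    fix i j assume "i \<in> J" "j \<in> J" "?r i = ?r j"
    then have "\<not> \<kappa> i < \<kappa> j" "\<not> \<kappa> j < \<kappa> i" using less[of i j] less[of j i] by linarith+
    then have "\<kappa> i = \<kappa> j" by simp
    then show "i = j" using inj \<open>i \<in> J\<close> \<open>j \<in> J\<close> by (auto dest: inj_onD)
  qed
  moreover have "?r ` J \<subseteq> {..<card J}"
    using J by (auto intro!: psubset_card_mono)
  ultimately show ?thesis
    using card_subset_eq[of "{..<card J}" "?r ` J"] by (simp add: bij_betw_def card_image)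
qed

text \<open>Lets an independence statement be checked cell by cell: the same factor \<open>w\<close>
  on every cell of a countable partition is the factor for the whole.\<close>

lemma emeasure_countable_partition:
  assumes g: "g \<in> M \<rightarrow>\<^sub>M count_space (UNIV :: 'c::countable set)" and A: "A \<in> sets M"
    and eq: "\<And>v. emeasure M {x\<in>A. g x = v} = w * emeasure M {x\<in>space M. g x = v}"
  shows "emeasure M A = w * emeasure M (space M)"
proof -
  have gv: "{x\<in>space M. g x = v} \<in> sets M" for v
    using measurable_sets[OF g, of "{v}"] by (simp add: vimage_def Int_def conj_commute)
  have part: "emeasure M B = (\<integral>\<^sup>+v. emeasure M {x\<in>B. g x = v} \<partial>count_space UNIV)" if B: "B \<in> sets M" for B
  proof -
    have "{x\<in>B. g x = v} = B \<inter> {x\<in>space M. g x = v}" for v using sets.sets_into_space[OF B] by auto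
    then have "{x\<in>B. g x = v} \<in> sets M" for v using B gv[of v] by auto
    then have "emeasure M (\<Union>v\<in>UNIV. {x\<in>B. g x = v}) = (\<integral>\<^sup>+v. emeasure M {x\<in>B. g x = v} \<partial>count_space UNIV)"
      by (intro emeasure_UN_countable) (auto simp: disjoint_family_on_def)
    moreover have "(\<Union>v\<in>UNIV. {x\<in>B. g x = v}) = B" by auto
    ultimately show ?thesis by simp
  qed
  show ?thesis
    unfolding part[OF A] part[OF sets.top] by (simp add: eq nn_integral_cmult)
qed

section \<open>Dyadic cells, ranks and the selection rule\<close>

locale uniform_mark = window S for S :: "'a::euclidean_space set" +
  fixes F :: "'a \<Rightarrow> real"
  assumes F [measurable]: "F \<in> borel_measurable borel"
    and F_range: "0 \<le> F z" "F z \<le> 1"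
    and F_law: "B \<in> sets borel \<Longrightarrow> emeasure U {z. F z \<in> B} = emeasure lborel (B \<inter> {0..<1})"
begin

lemma F_atomless: "emeasure U {z. F z = c} = 0"
  using F_law[of "{c}"] by (simp add: Int_insert_left)

definition idx :: "nat \<Rightarrow> 'a \<Rightarrow> int" where
  "idx l z = \<lfloor>2 ^ l * F z\<rfloor>"

lemma measurable_idx [measurable]: "idx l \<in> borel \<rightarrow>\<^sub>M count_space UNIV"
  unfolding idx_def by measurable

text \<open>The upper end \<open>2 ^ l\<close> occurs exactly when \<open>F z = 1\<close>, which is
  a null event but not excluded.\<close>

lemma idx_range: "idx l z \<in> {0..2 ^ l}"
proof -
  have "2 ^ l * F z \<le> 2 ^ l * 1" by (intro mult_left_mono F_range) simp
  then have "\<lfloor>2 ^ l * F z\<rfloor> \<le> \<lfloor>2 ^ l :: real\<rfloor>" by (intro floor_mono) simp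
  moreover have "\<lfloor>2 ^ l :: real\<rfloor> = 2 ^ l" using floor_of_int[of "2 ^ l"] by simp
  ultimately show ?thesis using F_range by (simp add: idx_def)
qed

lemma idx_div: "idx l z = idx (l + i) z div 2 ^ i"
proof -
  have "idx l z = \<lfloor>2 ^ (l + i) * F z / real_of_int (2 ^ i)\<rfloor>"
    by (simp add: idx_def power_add)
  also have "\<dots> = idx (l + i) z div 2 ^ i"
    unfolding idx_def by (rule floor_divide_real_eq_div) simp
  finally show ?thesis .
qed

lemma idx_eq_mono: "idx l z = idx l z' \<Longrightarrow> l' \<le> l \<Longrightarrow> idx l' z = idx l' z'"
  using idx_div[of l' _ "l - l'"] by simp

text \<open>If no level separates the values, \<open>LEAST\<close> is an unspecified number;
  statements about ranks therefore assume \<open>separated\<close>, which holds almost surely for a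
  sample.\<close>

definition lev :: "'i set \<Rightarrow> ('i \<Rightarrow> 'a) \<Rightarrow> nat" where
  "lev J x = (LEAST l. inj_on (\<lambda>i. idx l (x i)) J)"

definition separated :: "'i set \<Rightarrow> ('i \<Rightarrow> 'a) \<Rightarrow> bool" where
  "separated J x \<longleftrightarrow> (\<exists>l. inj_on (\<lambda>i. idx l (x i)) J)"

text \<open>\<open>R\<close> names the set of ranks to be kept. Labels are kept abstract so that the
  rule applies both to a labelled sample, where coordinates can be integrated out, and to a set of
  points labelled by themselves, where it becomes a map of point measures.\<close>

definition sel :: "(real \<Rightarrow> nat set) \<Rightarrow> 'i set \<Rightarrow> ('i \<Rightarrow> 'a) \<Rightarrow> 'i set" where
  "sel R J x = {i\<in>J. card {k\<in>J. idx (lev J x) (x k) < idx (lev J x) (x i)}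
      \<in> R (frac (2 ^ lev J x * (\<Sum>i\<in>J. F (x i))))}"

lemma separated_lev: "separated J x \<Longrightarrow> inj_on (\<lambda>i. idx (lev J x) (x i)) J"
  unfolding separated_def lev_def by (rule LeastI_ex)

lemma idx_neq_large: "F z \<noteq> F z' \<Longrightarrow> eventually (\<lambda>l. idx l z \<noteq> idx l z') sequentially"
proof -
  assume "F z \<noteq> F z'"
  then have "0 < \<bar>F z - F z'\<bar>" by simp
  then obtain l where l: "1 / \<bar>F z - F z'\<bar> < 2 ^ l" using real_arch_pow[of 2] by auto
  have "idx l z \<noteq> idx l z'"
  proof
    assume "idx l z = idx l z'"
    then have "\<bar>2 ^ l * F z - 2 ^ l * F z'\<bar> < 1" unfolding idx_def by linarith
    then have "2 ^ l * \<bar>F z - F z'\<bar> < 1" by (simp add: abs_mult flip: right_diff_distrib)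
    then show False using l \<open>0 < \<bar>F z - F z'\<bar>\<close> by (simp add: field_simps)
  qed
  then show ?thesis
    unfolding eventually_sequentially using idx_eq_mono by blast
qed

lemma separatedI:
  assumes "finite J" "inj_on (\<lambda>i. F (x i)) J"
  shows "separated J x"
proof -
  have "eventually (\<lambda>l. \<forall>i\<in>J. \<forall>j\<in>J. i \<noteq> j \<longrightarrow> idx l (x i) \<noteq> idx l (x j)) sequentially"
  proof (intro eventually_ball_finite ballI assms(1))
    fix i j assume "i \<in> J" "j \<in> J"
    then show "eventually (\<lambda>l. i \<noteq> j \<longrightarrow> idx l (x i) \<noteq> idx l (x j)) sequentially"
      using idx_neq_large[of "x i" "x j"] assms(2) by (cases "i = j") (auto dest: inj_onD)
  qed
  then show ?thesis by (auto simp: separated_def inj_on_def eventually_sequentially)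
qed

text \<open>Level, ranks and the sum of the marks do not depend on how the points are labelled, so
  the selection from a sample descends to the set of its points.\<close>

lemma
  assumes x: "inj_on x J"
  shows separated_image: "separated (x ` J) (\<lambda>z. z) \<longleftrightarrow> separated J x"
    and sel_image: "sel R (x ` J) (\<lambda>z. z) = x ` sel R J x"
proof -
  have inj: "inj_on (\<lambda>z. idx l z) (x ` J) \<longleftrightarrow> inj_on (\<lambda>i. idx l (x i)) J" for l
    using comp_inj_on_iff[OF x, of "idx l"] by (simp add: o_def)
  have lev: "lev (x ` J) (\<lambda>z. z) = lev J x" by (simp add: lev_def inj)
  show "separated (x ` J) (\<lambda>z. z) \<longleftrightarrow> separated J x" by (simp add: separated_def inj)
  have card: "card {z\<in>x ` J. P z} = card {k\<in>J. P (x k)}" for P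
  proof -
    have "{z\<in>x ` J. P z} = x ` {k\<in>J. P (x k)}" by auto
    also have "card \<dots> = card {k\<in>J. P (x k)}"
      by (rule card_image) (rule inj_on_subset[OF x], auto)
    finally show ?thesis .
  qed
  show "sel R (x ` J) (\<lambda>z. z) = x ` sel R J x"
    unfolding sel_def lev card sum.reindex[OF x] o_def by auto
qed

text \<open>For \<open>0 \<le> c < 2 ^ l\<close> the cell is the preimage under \<open>F\<close> of
  a full interval of length \<open>1 / 2 ^ l\<close>, on which the fractional part is uniform. All
  other indices, including \<open>c = 2 ^ l\<close>, have probability 0.\<close>

lemma emeasure_U_cell_frac:
  assumes [measurable]: "B \<in> sets borel"
  shows "emeasure U {z. idx l z = c \<and> frac (2 ^ l * F z + d) \<in> B}
    = emeasure lborel (B \<inter> {0..<1}) * emeasure U {z. idx l z = c}"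
proof -
  have law: "emeasure U {z. idx l z = c \<and> frac (2 ^ l * F z + d) \<in> B}
      = emeasure lborel ({t. \<lfloor>2 ^ l * t\<rfloor> = c \<and> frac (2 ^ l * t + d) \<in> B} \<inter> {0..<1})"
    if [measurable]: "B \<in> sets borel" for B
    using F_law[of "{t. \<lfloor>2 ^ l * t\<rfloor> = c \<and> frac (2 ^ l * t + d) \<in> B}"] by (simp add: idx_def)
  show ?thesis
  proof (cases "c \<in> {0..<2 ^ l}")
    case True
    have "{t. \<lfloor>2 ^ l * t\<rfloor> = c \<and> frac (2 ^ l * t + d) \<in> B} \<inter> {0..<1}
        = {t. \<lfloor>2 ^ l * t\<rfloor> = c \<and> frac (2 ^ l * t + d) \<in> B}" for B
    proof -
      have "t \<in> {0..<1}" if "\<lfloor>2 ^ l * t\<rfloor> = c" for t :: real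
      proof -
        have "real_of_int c \<le> 2 ^ l * t" "2 ^ l * t < real_of_int c + 1" using that by linarith+
        moreover have "0 \<le> real_of_int c" using True by simp
        moreover have "real_of_int c + 1 \<le> 2 ^ l"
        proof -
          have "c + 1 \<le> 2 ^ l" using True by simp
          then have "real_of_int (c + 1) \<le> real_of_int (2 ^ l)" by (simp only: of_int_le_iff)
          then show ?thesis by simp
        qed
        ultimately have "0 \<le> 2 ^ l * t" "2 ^ l * t < 2 ^ l" by linarith+
        moreover have "(0 :: real) < 2 ^ l" by simp
        ultimately show ?thesis
          using mult_less_cancel_left_pos[of "2 ^ l" t 1] mult_le_cancel_left_pos[of "2 ^ l" 0 t]
          unfolding atLeastLessThan_iff mult_1_right mult_zero_right by blast
      qed
      then show ?thesis by auto
    qed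
    from law[unfolded this] have *: "emeasure U {z. idx l z = c \<and> frac (2 ^ l * F z + d) \<in> B}
        = ennreal (1 / 2 ^ l) * emeasure lborel (B \<inter> {0..<1})" if "B \<in> sets borel" for B
      using emeasure_cell_frac[OF that, of "2 ^ l" c d] that by simp
    show ?thesis
      \<comment> \<open>The case of \<open>UNIV\<close> gives the mass of the cell itself, so the
        constant \<open>1 / 2 ^ l\<close> can be replaced by it.\<close>
      using *[of B] *[of UNIV] by (simp add: mult.commute)
  next
    case False
    have "{t. \<lfloor>2 ^ l * t\<rfloor> = c \<and> frac (2 ^ l * t + d) \<in> B} \<inter> {0..<1} = {}" for B
    proof -
      have "c \<in> {0..<2 ^ l}" if "\<lfloor>2 ^ l * t\<rfloor> = c" "t \<in> {0..<1}" for t :: real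
      proof -
        have "2 ^ l * t < 2 ^ l * 1" using that(2) by (intro mult_strict_left_mono) auto
        then have "2 ^ l * t < real_of_int (2 ^ l)" by simp
        then have "\<lfloor>2 ^ l * t\<rfloor> < 2 ^ l" by (simp only: floor_less_iff)
        then show ?thesis using that by auto
      qed
      then show ?thesis using False by blast
    qed
    from law[unfolded this] show ?thesis
      using law[of UNIV, unfolded \<open>\<And>B. {t. \<lfloor>2 ^ l * t\<rfloor> = c \<and> frac (2 ^ l * t + d) \<in> B} \<inter> {0..<1} = {}\<close>] by simp
  qed
qed

text \<open>The level takes countably many values, and the labels ranked below \<open>i\<close> form
  one of finitely many subsets \<open>K\<close> of \<open>J\<close>. With these values fixed, only
  comparisons of cell indices and preimages under \<open>R\<close> remain.\<close>

lemma measurable_separation: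
  fixes N :: "'n measure" and x :: "'n \<Rightarrow> 'i \<Rightarrow> 'a"
  assumes J: "finite J" and x [measurable]: "\<And>i. i \<in> J \<Longrightarrow> (\<lambda>\<omega>. x \<omega> i) \<in> borel_measurable N"
    and R: "R \<in> borel \<rightarrow>\<^sub>M count_space UNIV"
  shows measurable_lev: "(\<lambda>\<omega>. lev J (x \<omega>)) \<in> N \<rightarrow>\<^sub>M count_space UNIV"
    and measurable_sel: "Measurable.pred N (\<lambda>\<omega>. sel R J (x \<omega>) = T)"
proof -
  have idx [measurable]: "(\<lambda>\<omega>. idx l (x \<omega> i)) \<in> N \<rightarrow>\<^sub>M count_space UNIV" if "i \<in> J" for i l
    by (rule measurable_compose[OF x[OF that] measurable_idx])
  have lt: "Measurable.pred N (\<lambda>\<omega>. idx l (x \<omega> i) < idx l (x \<omega> k))"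
    and eq: "Measurable.pred N (\<lambda>\<omega>. idx l (x \<omega> i) = idx l (x \<omega> k))" if [measurable]: "i \<in> J" "k \<in> J" for i k l
    by measurable
  show lev: "(\<lambda>\<omega>. lev J (x \<omega>)) \<in> N \<rightarrow>\<^sub>M count_space UNIV"
    unfolding lev_def
  proof (rule measurable_Least)
    fix l
    show "Measurable.pred N (\<lambda>\<omega>. inj_on (\<lambda>i. idx l (x \<omega> i)) J)"
      unfolding inj_on_def using J by (intro pred_intros_finite pred_intros_logic eq) auto
  qed
  have V: "(\<lambda>\<omega>. frac (2 ^ l * (\<Sum>i\<in>J. F (x \<omega> i)))) \<in> borel_measurable N" for l
    by measurable
  have RV: "Measurable.pred N (\<lambda>\<omega>. m \<in> R (frac (2 ^ l * (\<Sum>i\<in>J. F (x \<omega> i)))))" for l m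
    by (rule measurable_compose[OF measurable_compose[OF V R]]) simp
  have rank: "Measurable.pred N (\<lambda>\<omega>. card {k\<in>J. idx l (x \<omega> k) < idx l (x \<omega> i)}
      \<in> R (frac (2 ^ l * (\<Sum>i\<in>J. F (x \<omega> i)))))" if i: "i \<in> J" for i l
  proof -
    have "card {k\<in>J. idx l (x \<omega> k) < idx l (x \<omega> i)} \<in> R (frac (2 ^ l * (\<Sum>i\<in>J. F (x \<omega> i))))
      \<longleftrightarrow> (\<exists>K\<in>Pow J. (\<forall>k\<in>J. k \<in> K \<longleftrightarrow> idx l (x \<omega> k) < idx l (x \<omega> i))
        \<and> card K \<in> R (frac (2 ^ l * (\<Sum>i\<in>J. F (x \<omega> i)))))" for \<omega>
    proof
      assume "\<exists>K\<in>Pow J. (\<forall>k\<in>J. k \<in> K \<longleftrightarrow> idx l (x \<omega> k) < idx l (x \<omega> i))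
        \<and> card K \<in> R (frac (2 ^ l * (\<Sum>i\<in>J. F (x \<omega> i))))"
      then obtain K where K: "K \<subseteq> J" "\<forall>k\<in>J. k \<in> K \<longleftrightarrow> idx l (x \<omega> k) < idx l (x \<omega> i)"
        "card K \<in> R (frac (2 ^ l * (\<Sum>i\<in>J. F (x \<omega> i))))" by auto
      then have "K = {k\<in>J. idx l (x \<omega> k) < idx l (x \<omega> i)}" by auto
      then show "card {k\<in>J. idx l (x \<omega> k) < idx l (x \<omega> i)} \<in> R (frac (2 ^ l * (\<Sum>i\<in>J. F (x \<omega> i))))"
        using K(3) by simp
    qed (intro bexI[of _ "{k\<in>J. idx l (x \<omega> k) < idx l (x \<omega> i)}"], auto)
    then show ?thesis
      using J i by (simp only:) (intro pred_intros_finite pred_intros_logic lt RV, auto)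
  qed
  have "Measurable.pred N (\<lambda>\<omega>. card {k\<in>J. idx (lev J (x \<omega>)) (x \<omega> k) < idx (lev J (x \<omega>)) (x \<omega> i)}
      \<in> R (frac (2 ^ lev J (x \<omega>) * (\<Sum>i\<in>J. F (x \<omega> i)))))" if "i \<in> J" for i
    using rank[OF that] lev by (rule measurable_compose_countable)
  then have "Measurable.pred N (\<lambda>\<omega>. T \<subseteq> J \<and> (\<forall>i\<in>J. card {k\<in>J. idx (lev J (x \<omega>)) (x \<omega> k) < idx (lev J (x \<omega>)) (x \<omega> i)}
      \<in> R (frac (2 ^ lev J (x \<omega>) * (\<Sum>i\<in>J. F (x \<omega> i)))) \<longleftrightarrow> i \<in> T))"
    using J by (intro pred_intros_finite pred_intros_logic) auto
  also have "(\<lambda>\<omega>. T \<subseteq> J \<and> (\<forall>i\<in>J. card {k\<in>J. idx (lev J (x \<omega>)) (x \<omega> k) < idx (lev J (x \<omega>)) (x \<omega> i)}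
      \<in> R (frac (2 ^ lev J (x \<omega>) * (\<Sum>i\<in>J. F (x \<omega> i)))) \<longleftrightarrow> i \<in> T)) = (\<lambda>\<omega>. sel R J (x \<omega>) = T)"
    unfolding fun_eq_iff sel_def by blast
  finally show "Measurable.pred N (\<lambda>\<omega>. sel R J (x \<omega>) = T)" .
qed

text \<open>The core of the construction. As the point \<open>z\<close> with label \<open>j\<close> varies inside a dyadic cell of the
  separating level, neither that level nor the ranks change, while the fractional part that drives
  the selection runs uniformly through \<open>[0,1)\<close>. Hence the selection is independent of all
  points but one.\<close>

lemma sel_one_point:
  fixes y :: "'i \<Rightarrow> 'a"
  assumes J: "finite J" "j \<in> J" and T: "T \<subseteq> J" and y: "inj_on (\<lambda>i. F (y i)) (J - {j})"
    and R: "R \<in> borel \<rightarrow>\<^sub>M count_space UNIV" "\<And>v. R v \<subseteq> {..<card J}"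
    and w: "\<And>A. A \<subseteq> {..<card J} \<Longrightarrow> emeasure lborel ({v. R v = A} \<inter> {0..<1}) = w (card A)"
  shows "emeasure U {z. sel R J (y(j := z)) = T} = w (card T)"
proof -
  let ?x = "\<lambda>z. y(j := z)"
  have x: "(\<lambda>z. ?x z i) \<in> borel_measurable U" for i by (cases "i = j") auto
  have lev: "(\<lambda>z. lev J (?x z)) \<in> U \<rightarrow>\<^sub>M count_space UNIV"
    and sel: "Measurable.pred U (\<lambda>z. sel R J (?x z) = T)"
    using measurable_separation[where x="\<lambda>z. ?x z", OF J(1) x R(1)] by auto
  have "emeasure U {z. sel R J (?x z) = T} = w (card T) * emeasure U (space U)"
  proof (rule emeasure_countable_partition)
    show "{z. sel R J (?x z) = T} \<in> sets U" using sel by (simp add: pred_def)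
    have "(\<lambda>z. (lev J (?x z), idx (lev J (?x z)) z)) \<in> U \<rightarrow>\<^sub>M count_space UNIV"
    proof (rule measurable_compose_countable[where g="\<lambda>z. lev J (?x z)" and f="\<lambda>l z. (l, idx l z)"])
      fix l
      have "idx l \<in> U \<rightarrow>\<^sub>M count_space UNIV" by measurable
      then show "(\<lambda>z. (l, idx l z)) \<in> U \<rightarrow>\<^sub>M count_space UNIV" by (rule measurable_compose) simp
    qed (rule lev)
    then show "(\<lambda>z. (lev J (?x z), idx (lev J (?x z)) z)) \<in> U \<rightarrow>\<^sub>M count_space UNIV" .
    fix v :: "nat \<times> int"
    obtain l c where v: "v = (l, c)" by force
    let ?Z = "{z. (lev J (?x z), idx (lev J (?x z)) z) = v}"
    have Z_sets: "?Z \<in> sets borel"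
      using measurable_sets[OF \<open>(\<lambda>z. (lev J (?x z), idx (lev J (?x z)) z)) \<in> U \<rightarrow>\<^sub>M count_space UNIV\<close>, of "{v}"]
      by (simp add: vimage_def)
    have "emeasure U {z. z \<in> ?Z \<and> sel R J (?x z) = T} = w (card T) * emeasure U ?Z"
    proof (cases "\<exists>z0\<in>?Z. separated J (?x z0)")
      \<comment> \<open>If no \<open>z\<close> in this piece separates the points, then
        \<open>F z\<close> always coincides with the value at another label, and the piece is
        null.\<close>
      case False
      have "?Z \<subseteq> (\<Union>i\<in>J. {z. F z = F (y i)})"
      proof
        fix z assume "z \<in> ?Z"
        then have "\<not> inj_on (\<lambda>i. F (?x z i)) J" using False separatedI[OF J(1)] by blast
        then obtain a b where ab: "a \<in> J" "b \<in> J" "a \<noteq> b" "F (?x z a) = F (?x z b)"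
          by (auto simp: inj_on_def)
        then have "a = j \<or> b = j" using inj_onD[OF y, of a b] by (auto split: if_splits)
        then have "\<not> (\<forall>i\<in>J - {j}. F (y i) \<noteq> F z)"
          using ab by (elim disjE) (auto intro: bexI[of _ a] bexI[of _ b])
        then show "z \<in> (\<Union>i\<in>J. {z. F z = F (y i)})" by (auto simp: eq_commute)
      qed
      moreover have "(\<Union>i\<in>J. {z. F z = F (y i)}) \<in> null_sets U"
        using J(1) by (intro null_sets.finite_UN) (auto intro!: null_setsI F_atomless)
      ultimately have "emeasure U B = 0" if "B \<subseteq> ?Z" for B
        using that by (metis (no_types, lifting) emeasure_mono le_zero_eq null_setsD1 null_setsD2 order_trans)
      then show ?thesis by (simp add: subset_iff)
    next
      case True
      then obtain z0 where z0: "lev J (?x z0) = l" "idx l z0 = c" and sep: "inj_on (\<lambda>i. idx l (?x z0 i)) J"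
        using separated_lev by (fastforce simp: v)
      have same: "idx l' (?x z i) = idx l' (?x z0 i)" if "idx l z = c" "l' \<le> l" for z i l'
        using that z0(2) idx_eq_mono[of l z z0 l'] by auto
      \<comment> \<open>While \<open>z\<close> stays in its cell at level \<open>l\<close>, its
        coarser cells do not change either, so no coarser level can become separating.\<close>
      have lev_eq: "lev J (?x z) = l" if z: "idx l z = c" for z
        unfolding lev_def
      proof (rule Least_equality)
        show "inj_on (\<lambda>i. idx l (?x z i)) J" unfolding same[OF z order_refl] by (rule sep)
        fix l' assume l': "inj_on (\<lambda>i. idx l' (?x z i)) J"
        show "l \<le> l'"
        proof (rule ccontr)
          assume "\<not> l \<le> l'"
          then have "inj_on (\<lambda>i. idx l' (?x z0 i)) J" using l' same[OF z, of l'] by simp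
          then have "lev J (?x z0) \<le> l'" unfolding lev_def by (rule Least_le)
          then show False using z0 \<open>\<not> l \<le> l'\<close> by simp
        qed
      qed
      then have Z: "?Z = {z. idx l z = c}" by (auto simp: v)
      define \<rho> where "\<rho> i = card {k\<in>J. idx l (?x z0 k) < idx l (?x z0 i)}" for i
      have \<rho>: "bij_betw \<rho> J {..<card J}" unfolding \<rho>_def using bij_betw_rank[OF J(1) sep] .
      define d where "d = 2 ^ l * (\<Sum>i\<in>J - {j}. F (y i))"
      have sel_iff: "sel R J (?x z) = T \<longleftrightarrow> R (frac (2 ^ l * F z + d)) = \<rho> ` T" if z: "idx l z = c" for z
      proof -
        have "2 ^ l * (\<Sum>i\<in>J. F (?x z i)) = 2 ^ l * F z + d"
          using J by (simp add: sum.remove[OF J] d_def algebra_simps)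
        then have "sel R J (?x z) = {i\<in>J. \<rho> i \<in> R (frac (2 ^ l * F z + d))}"
          unfolding sel_def lev_eq[OF z] same[OF z order_refl] \<rho>_def by simp
        \<comment> \<open>As ranks are a bijection onto \<open>{..<card J}\<close> and
          \<open>R\<close> takes values inside it, the selected labels determine the whole rank
          set.\<close>
        moreover have "{i\<in>J. \<rho> i \<in> A} = T \<longleftrightarrow> A = \<rho> ` T" if "A \<subseteq> {..<card J}" for A
        proof
          assume "{i\<in>J. \<rho> i \<in> A} = T"
          then show "A = \<rho> ` T" using that \<rho> by (auto simp: bij_betw_def)
        next
          assume "A = \<rho> ` T"
          then show "{i\<in>J. \<rho> i \<in> A} = T" using T \<rho> by (auto simp: bij_betw_def inj_on_def)
        qed
        ultimately show ?thesis using R(2) by metis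
      qed
      have \<rho>T: "\<rho> ` T \<subseteq> {..<card J}" "card (\<rho> ` T) = card T"
        using \<rho> T by (auto simp: bij_betw_def intro!: card_image inj_on_subset[of \<rho> J])
      have B: "{v. R v = \<rho> ` T} \<in> sets borel"
        using measurable_sets[OF R(1), of "{\<rho> ` T}"] by (simp add: vimage_def)
      have "{z. z \<in> ?Z \<and> sel R J (?x z) = T} = {z. idx l z = c \<and> frac (2 ^ l * F z + d) \<in> {v. R v = \<rho> ` T}}"
        unfolding Z using sel_iff by auto
      then show ?thesis
        using emeasure_U_cell_frac[OF B, of l c d] w[OF \<rho>T(1)] by (simp add: Z \<rho>T(2))
    qed
    then show "emeasure U {z \<in> {z. sel R J (?x z) = T}. (lev J (?x z), idx (lev J (?x z)) z) = v}
      = w (card T) * emeasure U {z \<in> space U. (lev J (?x z), idx (lev J (?x z)) z) = v}"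
      by (simp add: conj_commute)
  qed
  then show ?thesis using U.emeasure_space_1 by simp
qed

end

section \<open>From labelled samples to measurable maps of point measures\<close>

context window
begin

text \<open>The coordinates with labels in \<open>T\<close> are independent and uniform, so
  relabelling \<open>T\<close> by \<open>{..<card T}\<close> gives the sample that defines
  \<open>law\<close>.\<close>

lemma emeasure_law:
  assumes J: "finite J" "T \<subseteq> J" and E: "E \<in> sets (point_measure_space S)"
  shows "emeasure (sample J) {x\<in>space (sample J). emp T x \<in> E} = emeasure (law (card T)) E"
proof -
  have T: "finite T" using J by (rule finite_subset[rotated])
  obtain f where f: "bij_betw f {..<card T} T"
    using ex_bij_betw_nat_finite[OF T] by (auto simp: atLeast0LessThan)
  define g where "g x = (\<lambda>n\<in>{..<card T}. x (f n))" for x :: "nat \<Rightarrow> 'a"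
  have fT: "inj_on f {..<card T}" "f ` {..<card T} = T" using f by (auto simp: bij_betw_def)
  have dist: "distr (sample J) (sample {..<card T}) g = sample {..<card T}"
    unfolding g_def using fT J by (intro distr_PiM_reindex prob_space_U) auto
  have g: "g \<in> sample J \<rightarrow>\<^sub>M sample {..<card T}"
    unfolding g_def using fT J by (intro measurable_restrict measurable_component_singleton) auto
  have emp_g: "emp {..<card T} (g x) = emp T x" for x
  proof -
    have "inj_on (g x) {..<card T} \<longleftrightarrow> inj_on (x \<circ> f) {..<card T}"
      by (rule inj_on_cong) (simp add: g_def)
    also have "\<dots> \<longleftrightarrow> inj_on x T"
      using comp_inj_on_iff[OF fT(1), of x] fT(2) by simp
    finally have "inj_on (g x) {..<card T} \<longleftrightarrow> inj_on x T" .
    moreover have "g x ` {..<card T} = x ` T"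
    proof -
      have "g x ` {..<card T} = x ` f ` {..<card T}" by (auto simp: g_def)
      then show ?thesis by (simp only: fT(2))
    qed
    ultimately show ?thesis by (simp add: emp_def good_def)
  qed
  have "emeasure (law (card T)) E = emeasure (distr (sample J) (sample {..<card T}) g) (emp {..<card T} -` E \<inter> space (sample {..<card T}))"
    unfolding law_def dist by (rule emeasure_distr[OF measurable_emp E]) simp
  also have "\<dots> = emeasure (sample J) (g -` (emp {..<card T} -` E \<inter> space (sample {..<card T})) \<inter> space (sample J))"
    by (rule emeasure_distr[OF g]) (rule measurable_sets[OF measurable_emp E], simp)
  also have "g -` (emp {..<card T} -` E \<inter> space (sample {..<card T})) \<inter> space (sample J) = {x\<in>space (sample J). emp T x \<in> E}"
    using measurable_space[OF g] by (auto simp: emp_g)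
  finally show ?thesis by simp
qed

lemma sample_component: "i \<in> J \<Longrightarrow> (\<lambda>x. x i) \<in> borel_measurable (sample J)"
  by (rule measurable_compose[OF measurable_component_singleton]) (auto intro: measurable_ident_sets)

lemma emp_event:
  assumes "finite J" "T \<subseteq> J" and E: "E \<in> sets (point_measure_space S)"
  shows "{x\<in>space (sample J). emp T x \<in> E} \<in> sets (sample J)"
proof -
  have "finite T" using assms finite_subset by auto
  have "(\<lambda>x. emp T (restrict x T)) \<in> sample J \<rightarrow>\<^sub>M point_measure_space S"
    by (rule measurable_compose[OF measurable_restrict_subset[OF assms(2)] measurable_emp[OF \<open>finite T\<close>]])
  moreover have "emp T (restrict x T) = emp T x" for x
    by (simp add: emp_def good_def cong: inj_on_cong)
  ultimately have "(\<lambda>x. emp T x) \<in> sample J \<rightarrow>\<^sub>M point_measure_space S" by simp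
  from measurable_sets[OF this E] show ?thesis by (simp add: vimage_def Int_def conj_commute)
qed

lemma measurable_card_points:
  assumes B: "B \<in> sets borel"
  shows "(\<lambda>\<nu>. card (B \<inter> points \<nu>)) \<in> point_measure_space S \<rightarrow>\<^sub>M count_space UNIV"
proof -
  have SB: "S \<inter> B \<in> sets (restrict_space borel S)" using B by (auto simp: sets_restrict_space)
  note [measurable] = measurable_emeasure_point_measure_space[OF SB]
  have "(\<lambda>\<nu>. nat \<lfloor>enn2real (emeasure \<nu> (S \<inter> B))\<rfloor>) \<in> point_measure_space S \<rightarrow>\<^sub>M count_space UNIV"
    by measurable
  then show ?thesis
  proof (rule measurable_cong[THEN iffD1, rotated])
    fix \<nu> assume "\<nu> \<in> space (point_measure_space S)"
    then have \<nu>: "\<nu> \<in> simple_point_measures S" by simp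
    have "S \<inter> B \<inter> points \<nu> = B \<inter> points \<nu>" using points_subset[OF \<nu>] by auto
    then show "nat \<lfloor>enn2real (emeasure \<nu> (S \<inter> B))\<rfloor> = card (B \<inter> points \<nu>)"
      using emeasure_eq_card_points[OF \<nu> SB] by simp
  qed
qed

end

context uniform_mark
begin

lemma idx_level_sets [measurable]: "{z. idx l z = b} \<in> sets borel" "{z. idx l z < b} \<in> sets borel"
  using measurable_sets[OF measurable_idx, of "{b}" l] measurable_sets[OF measurable_idx, of "{..<b}" l]
  by (simp_all add: vimage_def)

lemma sum_by_idx:
  assumes "finite C"
  shows "(\<Sum>z\<in>C. g z) = (\<Sum>b\<in>{0..2 ^ l}. \<Sum>z\<in>{z\<in>C. idx l z = b}. g z)"
  by (rule sum.group[symmetric]) (use assms idx_range in auto)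

text \<open>Rounding \<open>F\<close> down to multiples of \<open>1 / 2 ^ l\<close> turns the sum
  into a finite combination of counts in cells, which are measurable; the rounded sums converge as
  \<open>l\<close> grows.\<close>

lemma measurable_sum_points:
  "(\<lambda>\<nu>. \<Sum>z\<in>points \<nu>. F z) \<in> borel_measurable (point_measure_space S)"
proof (rule borel_measurable_LIMSEQ_real)
  let ?u = "\<lambda>l \<nu>. \<Sum>b\<in>{0..2 ^ l}. real_of_int b / 2 ^ l * real (card ({z. idx l z = b} \<inter> points \<nu>))"
  show "?u l \<in> borel_measurable (point_measure_space S)" for l
  proof -
    have [measurable]: "(\<lambda>\<nu>. real (card ({z. idx l z = b} \<inter> points \<nu>))) \<in> borel_measurable (point_measure_space S)" for b
      by (rule measurable_compose[OF measurable_card_points[OF idx_level_sets(1)]]) simp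
    show ?thesis by measurable
  qed
  fix \<nu> assume "\<nu> \<in> space (point_measure_space S)"
  then have C: "finite (points \<nu>)" using finite_points by auto
  have u: "?u l \<nu> = (\<Sum>z\<in>points \<nu>. real_of_int (idx l z) / 2 ^ l)" for l
  proof -
    have *: "(\<Sum>z\<in>{z\<in>points \<nu>. idx l z = b}. real_of_int (idx l z) / 2 ^ l)
        = real_of_int b / 2 ^ l * real (card ({z. idx l z = b} \<inter> points \<nu>))" for b
    proof -
      have "{z\<in>points \<nu>. idx l z = b} = {z. idx l z = b} \<inter> points \<nu>" by auto
      then show ?thesis by simp
    qed
    show ?thesis
      using sum_by_idx[OF C, of "\<lambda>z. real_of_int (idx l z) / 2 ^ l" l] by (simp only: *)
  qed
  have "(\<lambda>l. real_of_int (idx l z) / 2 ^ l) \<longlonglongrightarrow> F z" for z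
  proof (rule real_tendsto_sandwich)
    show "eventually (\<lambda>l. F z - (1 / 2) ^ l \<le> real_of_int (idx l z) / 2 ^ l) sequentially"
    proof (intro always_eventually allI)
      fix l :: nat
      have "2 ^ l * F z - 1 \<le> real_of_int (idx l z)" unfolding idx_def by linarith
      then have "(2 ^ l * F z - 1) / 2 ^ l \<le> real_of_int (idx l z) / 2 ^ l"
        by (rule divide_right_mono) simp
      then show "F z - (1 / 2) ^ l \<le> real_of_int (idx l z) / 2 ^ l"
        by (simp add: diff_divide_distrib power_divide)
    qed
    show "eventually (\<lambda>l. real_of_int (idx l z) / 2 ^ l \<le> F z) sequentially"
    proof (intro always_eventually allI)
      fix l :: nat
      have "real_of_int (idx l z) \<le> 2 ^ l * F z" unfolding idx_def by linarith
      then show "real_of_int (idx l z) / 2 ^ l \<le> F z" by (simp add: field_simps)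
    qed
    have "(\<lambda>l. F z - (1 / 2) ^ l) \<longlonglongrightarrow> F z - 0"
      by (intro tendsto_intros LIMSEQ_power_zero) simp
    then show "(\<lambda>l. F z - (1 / 2) ^ l) \<longlonglongrightarrow> F z" by simp
  qed simp
  then show "(\<lambda>l. ?u l \<nu>) \<longlonglongrightarrow> (\<Sum>z\<in>points \<nu>. F z)"
    unfolding u by (intro tendsto_sum)
qed

text \<open>Expresses separation at level \<open>l\<close> by finitely many counts, which makes it a
  measurable condition on the point measure.\<close>

lemma inj_idx_iff:
  assumes "finite C"
  shows "inj_on (idx l) C \<longleftrightarrow> (\<forall>b\<in>{0..2 ^ l}. card ({z. idx l z = b} \<inter> C) \<le> 1)"
proof
  assume inj: "inj_on (idx l) C"
  have "\<forall>x\<in>{z. idx l z = b} \<inter> C. \<forall>y\<in>{z. idx l z = b} \<inter> C. x = y" for b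
    using inj by (auto simp: inj_on_def)
  then show "\<forall>b\<in>{0..2 ^ l}. card ({z. idx l z = b} \<inter> C) \<le> 1"
    using assms by (auto simp: card_le_Suc0_iff_eq)
next
  assume R: "\<forall>b\<in>{0..2 ^ l}. card ({z. idx l z = b} \<inter> C) \<le> 1"
  show "inj_on (idx l) C"
  proof (rule inj_onI)
    fix x y assume "x \<in> C" "y \<in> C" "idx l x = idx l y"
    moreover have "card ({z. idx l z = idx l x} \<inter> C) \<le> 1" using R idx_range by blast
    then have "\<forall>u\<in>{z. idx l z = idx l x} \<inter> C. \<forall>v\<in>{z. idx l z = idx l x} \<inter> C. u = v"
      using card_le_Suc0_iff_eq[of "{z. idx l z = idx l x} \<inter> C"] assms by simp
    ultimately show "x = y" by auto
  qed
qed

text \<open>Configurations without a separating level are left unchanged, so that the result is a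
  sub-configuration everywhere.\<close>

definition thin :: "nat \<Rightarrow> (nat \<Rightarrow> real \<Rightarrow> nat set) \<Rightarrow> 'a measure \<Rightarrow> 'a measure" where
  "thin k R \<nu> = (if k < card (points \<nu>) \<and> separated (points \<nu>) (\<lambda>z. z)
    then point_sum S (sel (R (card (points \<nu>))) (points \<nu>) (\<lambda>z. z)) else \<nu>)"

lemma sel_subset: "sel R J x \<subseteq> J" by (auto simp: sel_def)

lemma
  assumes \<nu>: "\<nu> \<in> simple_point_measures S"
  shows thin_simple: "thin k R \<nu> \<in> simple_point_measures S"
    and points_thin: "points (thin k R \<nu>) \<subseteq> points \<nu>"
proof -
  let ?C = "sel (R (card (points \<nu>))) (points \<nu>) (\<lambda>z. z)"
  have "finite ?C" "?C \<subseteq> S"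
    by (rule finite_subset[OF sel_subset finite_points[OF \<nu>]], rule order_trans[OF sel_subset points_subset[OF \<nu>]])
  from point_sum_simple[OF this] points_point_sum[OF this] show
    "thin k R \<nu> \<in> simple_point_measures S" "points (thin k R \<nu>) \<subseteq> points \<nu>"
    using \<nu> by (simp_all add: thin_def sel_subset)
qed

lemma measurable_thin:
  assumes R: "\<And>n. R n \<in> borel \<rightarrow>\<^sub>M count_space UNIV"
  shows "thin k R \<in> point_measure_space S \<rightarrow>\<^sub>M point_measure_space S"
proof (rule measurable_point_measure_spaceI)
  let ?PM = "point_measure_space S"
  fix A assume A: "A \<in> sets (restrict_space borel S)"
  note cnt = measurable_card_points
  have N: "(\<lambda>\<nu>. card (points \<nu>)) \<in> ?PM \<rightarrow>\<^sub>M count_space UNIV"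
    using cnt[of UNIV] by simp
  have inj: "Measurable.pred ?PM (\<lambda>\<nu>. inj_on (idx l) (points \<nu>))" for l
  proof -
    have "Measurable.pred ?PM (\<lambda>\<nu>. \<forall>b\<in>{0..2 ^ l}. card ({z. idx l z = b} \<inter> points \<nu>) \<le> 1)"
      by (intro pred_intros_finite measurable_compose[OF cnt[OF idx_level_sets(1)]]) auto
    then show ?thesis
      by (rule measurable_cong[THEN iffD2, rotated]) (simp add: inj_idx_iff finite_points)
  qed
  have sep: "Measurable.pred ?PM (\<lambda>\<nu>. separated (points \<nu>) (\<lambda>z. z))"
    unfolding separated_def using inj by (intro pred_intros_countable) simp
  have lev: "(\<lambda>\<nu>. lev (points \<nu>) (\<lambda>z. z)) \<in> ?PM \<rightarrow>\<^sub>M count_space UNIV"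
    unfolding lev_def using inj by (intro measurable_Least) simp
  \<comment> \<open>All points of cell \<open>b\<close> share the same rank, the number of points in
    lower cells, so the retained mass in \<open>A\<close> is a finite sum over cells. Level
    \<open>l\<close> and number \<open>n\<close> are fixed here and replaced by their random values
    afterwards.\<close>
  define h where "h l n \<nu> = (\<Sum>b\<in>{0..2 ^ l}. if card ({z. idx l z < b} \<inter> points \<nu>) \<in> R n (frac (2 ^ l * (\<Sum>z\<in>points \<nu>. F z)))
      then of_nat (card ((A \<inter> {z. idx l z = b}) \<inter> points \<nu>)) else 0 :: ennreal)" for l n \<nu>
  have h: "h l n \<in> borel_measurable ?PM" for l n
  proof -
    have [measurable]: "Measurable.pred ?PM (\<lambda>\<nu>. card ({z. idx l z < b} \<inter> points \<nu>) \<in> R n (frac (2 ^ l * (\<Sum>z\<in>points \<nu>. F z))))" for b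
    proof (rule measurable_compose_countable[OF _ cnt[OF idx_level_sets(2)]])
      fix m
      have "(\<lambda>\<nu>. frac (2 ^ l * (\<Sum>z\<in>points \<nu>. F z))) \<in> borel_measurable ?PM"
        using measurable_sum_points by measurable
      then show "Measurable.pred ?PM (\<lambda>\<nu>. m \<in> R n (frac (2 ^ l * (\<Sum>z\<in>points \<nu>. F z))))"
        by (rule measurable_compose[OF measurable_compose[OF _ R]]) simp
    qed
    have [measurable]: "(\<lambda>\<nu>. of_nat (card ((A \<inter> {z. idx l z = b}) \<inter> points \<nu>)) :: ennreal) \<in> borel_measurable ?PM" for b
      using sets_window_borel[OF A] by (intro measurable_compose[OF cnt]) auto
    show ?thesis unfolding h_def by measurable
  qed
  have "(\<lambda>\<nu>. h (lev (points \<nu>) (\<lambda>z. z)) (card (points \<nu>)) \<nu>) \<in> borel_measurable ?PM"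
    by (rule measurable_compose_countable[OF measurable_compose_countable[OF h N] lev])
  then have "(\<lambda>\<nu>. if k < card (points \<nu>) \<and> separated (points \<nu>) (\<lambda>z. z)
      then h (lev (points \<nu>) (\<lambda>z. z)) (card (points \<nu>)) \<nu> else emeasure \<nu> A) \<in> borel_measurable ?PM"
  proof (rule measurable_If[OF _ measurable_emeasure_point_measure_space[OF A]])
    have "Measurable.pred ?PM (\<lambda>\<nu>. k < card (points \<nu>))"
      by (rule measurable_compose[OF N]) simp
    then show "{\<nu>\<in>space ?PM. k < card (points \<nu>) \<and> separated (points \<nu>) (\<lambda>z. z)} \<in> sets ?PM"
      using sep unfolding pred_def by (intro sets.sets_Collect_conj)
  qed
  moreover have "emeasure (thin k R \<nu>) A = (if k < card (points \<nu>) \<and> separated (points \<nu>) (\<lambda>z. z)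
      then h (lev (points \<nu>) (\<lambda>z. z)) (card (points \<nu>)) \<nu> else emeasure \<nu> A)"
    if \<nu>: "\<nu> \<in> simple_point_measures S" for \<nu>
  proof -
    let ?C = "points \<nu>" and ?l = "lev (points \<nu>) (\<lambda>z. z)"
    let ?X = "sel (R (card ?C)) ?C (\<lambda>z. z)"
    have fin: "finite ?C" "finite ?X" and sub: "?X \<subseteq> S"
      by (rule finite_points[OF \<nu>], rule finite_subset[OF sel_subset finite_points[OF \<nu>]],
        rule order_trans[OF sel_subset points_subset[OF \<nu>]])
    have "emeasure (point_sum S ?X) A = of_nat (card (A \<inter> ?X))"
      by (rule emeasure_point_sum[OF fin(2) sub A])
    also have "of_nat (card (A \<inter> ?X)) = (\<Sum>z\<in>A \<inter> ?X. 1 :: ennreal)" by simp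
    also have "\<dots> = (\<Sum>b\<in>{0..2 ^ ?l}. \<Sum>z\<in>{z\<in>A \<inter> ?X. idx ?l z = b}. 1)"
      using fin by (intro sum_by_idx) simp
    also have "\<dots> = h ?l (card ?C) \<nu>"
      unfolding h_def
    proof (rule sum.cong[OF refl])
      fix b
      let ?V = "R (card ?C) (frac (2 ^ ?l * (\<Sum>z\<in>?C. F z)))"
      have "{k \<in> ?C. idx ?l k < c} = {z. idx ?l z < c} \<inter> ?C" for c by auto
      then have X: "z \<in> ?X \<longleftrightarrow> z \<in> ?C \<and> card ({y. idx ?l y < idx ?l z} \<inter> ?C) \<in> ?V" for z
        unfolding sel_def by (simp only: mem_Collect_eq)
      have "{z\<in>A \<inter> ?X. idx ?l z = b} = (if card ({z. idx ?l z < b} \<inter> ?C) \<in> ?V then (A \<inter> {z. idx ?l z = b}) \<inter> ?C else {})"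
        by (rule set_eqI) (auto simp add: X simp del: Collect_conj_eq)
      then show "(\<Sum>z\<in>{z\<in>A \<inter> ?X. idx ?l z = b}. 1) = (if card ({z. idx ?l z < b} \<inter> ?C) \<in> ?V
          then of_nat (card ((A \<inter> {z. idx ?l z = b}) \<inter> ?C)) else 0 :: ennreal)"
        by simp
    qed
    finally show ?thesis by (simp add: thin_def)
  qed
  ultimately show "(\<lambda>\<nu>. emeasure (thin k R \<nu>) A) \<in> borel_measurable ?PM"
    by (subst measurable_cong) auto
qed (auto intro: thin_simple)

text \<open>A proper \<open>T\<close> omits some label \<open>j\<close>. Integrating over that
  coordinate first gives the selection probability \<open>w (card T)\<close> whatever the other
  points are, while \<open>emp T\<close> does not see it; hence selection and selected points are
  independent.\<close>

lemma emeasure_sel: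
  assumes T: "T \<subset> {..<n}" and E: "E \<in> sets (point_measure_space S)"
    and R: "R \<in> borel \<rightarrow>\<^sub>M count_space UNIV" "\<And>v. R v \<subseteq> {..<n}"
    and w: "\<And>A. A \<subseteq> {..<n} \<Longrightarrow> emeasure lborel ({v. R v = A} \<inter> {0..<1}) = w (card A)"
  shows "emeasure (sample {..<n}) {x\<in>space (sample {..<n}). sel R {..<n} x = T \<and> emp T x \<in> E}
    = w (card T) * emeasure (law (card T)) E"
proof -
  let ?N = "{..<n}"
  obtain j where j: "j \<in> ?N" "j \<notin> T" using T by blast
  let ?I = "?N - {j}"
  have N: "?N = insert j ?I" using j by auto
  have TI: "T \<subseteq> ?I" using T j by auto
  have fin: "finite ?I" "finite T" using T finite_subset by auto
  have sel: "Measurable.pred (sample ?N) (\<lambda>x. sel R ?N x = T)"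
    by (rule measurable_sel[OF _ sample_component R(1)]) auto
  let ?A = "{x\<in>space (sample ?N). sel R ?N x = T \<and> emp T x \<in> E}"
  have A: "?A \<in> sets (sample ?N)"
    using sets.Int[OF sel[unfolded pred_def] emp_event[OF finite_lessThan _ E]] T by (auto simp: Int_def conj_ac)
  have "emeasure (sample ?N) ?A = (\<integral>\<^sup>+x. indicator ?A x \<partial>sample (insert j ?I))"
    using A N by simp
  also have "\<dots> = (\<integral>\<^sup>+y. \<integral>\<^sup>+z. indicator ?A (y(j := z)) \<partial>U \<partial>sample ?I)"
    using A N by (intro U_prod.product_nn_integral_insert) auto
  also have "\<dots> = (\<integral>\<^sup>+y. w (card T) * indicator {y\<in>space (sample ?I). emp T y \<in> E} y \<partial>sample ?I)"
  proof (rule nn_integral_cong_AE)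
    have "AE y in sample ?I. inj_on (\<lambda>i. F (y i)) ?I"
      by (rule AE_sample_inj[OF fin(1) F F_atomless])
    then show "AE y in sample ?I. (\<integral>\<^sup>+z. indicator ?A (y(j := z)) \<partial>U)
      = w (card T) * indicator {y\<in>space (sample ?I). emp T y \<in> E} y"
      using AE_space
    proof eventually_elim
      case (elim y)
      have sp: "y(j := z) \<in> space (sample ?N)" for z
        using elim(2) j by (subst N) (auto simp: space_PiM PiE_def extensional_def)
      have emp: "emp T (y(j := z)) = emp T y" for z
      proof -
        have "inj_on (y(j := z)) T \<longleftrightarrow> inj_on y T" "(y(j := z)) ` T = y ` T"
          using j(2) by (auto intro!: inj_on_cong)
        then show ?thesis by (simp add: emp_def good_def)
      qed
      have x: "(\<lambda>z. (y(j := z)) i) \<in> borel_measurable U" for i by (cases "i = j") auto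
      have selm: "Measurable.pred U (\<lambda>z. sel R ?N (y(j := z)) = T)"
        using measurable_sel[where x="\<lambda>z. y(j := z)" and N=U, OF _ x R(1)] by auto
      have "(\<integral>\<^sup>+z. indicator ?A (y(j := z)) \<partial>U)
        = (\<integral>\<^sup>+z. indicator {z. sel R ?N (y(j := z)) = T} z * indicator {y\<in>space (sample ?I). emp T y \<in> E} y \<partial>U)"
        using elim(2) sp by (intro nn_integral_cong) (auto simp: indicator_def emp)
      also have "\<dots> = emeasure U {z. sel R ?N (y(j := z)) = T} * indicator {y\<in>space (sample ?I). emp T y \<in> E} y"
        using selm by (subst nn_integral_multc) (auto simp: pred_def)
      also have "emeasure U {z. sel R ?N (y(j := z)) = T} = w (card T)"
        using T j elim(1) R w by (intro sel_one_point) auto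
      finally show ?case .
    qed
  qed
  also have "\<dots> = w (card T) * emeasure (law (card T)) E"
    using emp_event[OF fin(1) TI E] by (simp add: nn_integral_cmult emeasure_law[OF fin(1) TI E])
  finally show ?thesis .
qed

end

section \<open>The law of a thinned sample\<close>

lemma sum_Pow_card:
  fixes g :: "nat \<Rightarrow> ennreal"
  assumes "finite N"
  shows "(\<Sum>T\<in>Pow N. g (card T)) = (\<Sum>m\<le>card N. of_nat (card N choose m) * g m)"
proof -
  have "(\<Sum>T\<in>Pow N. g (card T)) = (\<Sum>m\<le>card N. \<Sum>T\<in>{T\<in>Pow N. card T = m}. g (card T))"
    using assms by (intro sum.group[symmetric]) (auto intro: card_mono)
  also have "\<dots> = (\<Sum>m\<le>card N. of_nat (card N choose m) * g m)"
    using n_subsets[OF assms] by (intro sum.cong) (simp_all add: Pow_def)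
  finally show ?thesis .
qed

text \<open>The size is drawn from \<open>\<pi>\<close>, then a uniform subset of that size; the
  bound on the support makes each of these size classes nonempty.\<close>

lemma random_subset_pmf:
  fixes \<pi> :: "nat pmf"
  assumes \<pi>: "\<And>m. m \<in> set_pmf \<pi> \<Longrightarrow> m \<le> n"
  obtains W :: "nat set pmf" where "set_pmf W = {A. A \<subseteq> {..<n} \<and> card A \<in> set_pmf \<pi>}"
    "\<And>A. A \<subseteq> {..<n} \<Longrightarrow> pmf W A = pmf \<pi> (card A) / (n choose card A)"
proof -
  define K where "K m = {A. A \<subseteq> {..<n} \<and> card A = m}" for m
  have fin: "finite (K m)" for m unfolding K_def by (rule finite_subset[of _ "Pow {..<n}"]) auto
  have cardK: "card (K m) = n choose m" for m using n_subsets[of "{..<n}" m] by (simp add: K_def)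
  have ne: "K m \<noteq> {}" if "m \<in> set_pmf \<pi>" for m
  proof -
    have "card (K m) \<noteq> 0" using \<pi>[OF that] by (simp add: cardK)
    then show ?thesis by auto
  qed
  define W where "W = bind_pmf \<pi> (\<lambda>m. pmf_of_set (K m))"
  show thesis
  proof (rule that[of W])
    show "set_pmf W = {A. A \<subseteq> {..<n} \<and> card A \<in> set_pmf \<pi>}"
      using ne fin by (auto simp: W_def set_pmf_of_set K_def)
    fix A :: "nat set" assume A: "A \<subseteq> {..<n}"
    have "ennreal (pmf W A) = (\<integral>\<^sup>+m. ennreal (pmf (pmf_of_set (K m)) A) \<partial>\<pi>)"
      unfolding W_def by (rule ennreal_pmf_bind)
    also have "\<dots> = (\<integral>\<^sup>+m. ennreal (1 / real (n choose card A)) * indicator {card A} m \<partial>\<pi>)"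
    proof (rule nn_integral_cong_AE, subst AE_measure_pmf_iff, intro ballI)
      fix m assume m: "m \<in> set_pmf \<pi>"
      show "ennreal (pmf (pmf_of_set (K m)) A) = ennreal (1 / real (n choose card A)) * indicator {card A} m"
        using A ne[OF m] fin[of m] by (auto simp: K_def[symmetric] cardK indicator_def) (auto simp: K_def)
    qed
    also have "\<dots> = ennreal (1 / real (n choose card A) * pmf \<pi> (card A))"
      by (subst ennreal_mult) (simp_all add: nn_integral_cmult emeasure_pmf_single)
    finally show "pmf W A = pmf \<pi> (card A) / (n choose card A)" by simp
  qed
qed

context uniform_mark
begin

text \<open>The event is split according to the selected label set. Given that this set is
  \<open>T\<close>, the retained points form a sample of size \<open>card T\<close>, and the number
  of sets of size \<open>m\<close> cancels the binomial coefficient in the weight.\<close>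

lemma emeasure_law_thin:
  assumes n: "k < n" and \<pi>: "\<And>m. m \<in> set_pmf \<pi> \<Longrightarrow> m < n"
    and E: "E \<in> sets (point_measure_space S)" and R: "\<And>n. R n \<in> borel \<rightarrow>\<^sub>M count_space UNIV"
    and Rn: "\<And>v. R n v \<subset> {..<n}"
    and w: "\<And>A. A \<subseteq> {..<n} \<Longrightarrow>
      emeasure lborel ({v. R n v = A} \<inter> {0..<1}) = ennreal (pmf \<pi> (card A) / (n choose card A))"
  shows "emeasure (distr (law n) (point_measure_space S) (thin k R)) E = (\<integral>\<^sup>+m. emeasure (law m) E \<partial>measure_pmf \<pi>)"
proof -
  let ?N = "{..<n}"
  let ?w = "\<lambda>m. ennreal (pmf \<pi> m / (n choose m))"
  let ?A = "\<lambda>T. {x\<in>space (sample ?N). sel (R n) ?N x = T \<and> emp T x \<in> E}"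
  have w0: "?w n = 0" using \<pi>[of n] by (auto simp: set_pmf_iff)
  have AE_sep: "AE x in sample ?N. good ?N x \<and> separated ?N x"
    using AE_good[OF finite_lessThan, of n] AE_sample_inj[OF finite_lessThan F F_atomless, of n]
    by eventually_elim (auto intro: separatedI)
  \<comment> \<open>Selecting every label would need every rank, whereas \<open>R n\<close> always
    yields a proper subset. So the one label set without a spare coordinate does not occur.\<close>
  have full: "sel (R n) ?N x \<noteq> ?N" if "separated ?N x" for x
  proof
    assume *: "sel (R n) ?N x = ?N"
    let ?r = "\<lambda>i. card {k\<in>?N. idx (lev ?N x) (x k) < idx (lev ?N x) (x i)}"
    have "?r ` ?N = {..<card ?N}"
      using bij_betw_rank[OF finite_lessThan separated_lev[OF that]] by (simp add: bij_betw_def)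
    moreover have "?r ` ?N \<subseteq> R n (frac (2 ^ lev ?N x * (\<Sum>i\<in>?N. F (x i))))"
      using * unfolding sel_def by blast
    ultimately show False using Rn by auto
  qed
  have meas: "?A T \<in> sets (sample ?N)" if "T \<subseteq> ?N" for T
  proof -
    have "{x\<in>space (sample ?N). emp T x \<in> E} \<in> sets (sample ?N)"
      by (rule emp_event[OF finite_lessThan that E])
    moreover have "{x\<in>space (sample ?N). sel (R n) ?N x = T} \<in> sets (sample ?N)"
      using measurable_sel[where x="\<lambda>x. x", OF finite_lessThan sample_component R] by (simp add: pred_def)
    ultimately have "{x\<in>space (sample ?N). sel (R n) ?N x = T} \<inter> {x\<in>space (sample ?N). emp T x \<in> E} \<in> sets (sample ?N)"
      by (intro sets.Int)
    then show ?thesis by (simp add: Int_def conj_ac)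
  qed
  have thinE: "thin k R -` E \<inter> simple_point_measures S \<in> sets (point_measure_space S)"
    using measurable_sets[OF measurable_thin[OF R] E] by simp
  have "emeasure (distr (law n) (point_measure_space S) (thin k R)) E
    = emeasure (law n) (thin k R -` E \<inter> simple_point_measures S)"
    using emeasure_distr[OF _ E, of "thin k R" "law n"] measurable_thin[OF R] by simp
  also have "\<dots> = emeasure (sample ?N) {x\<in>space (sample ?N). emp ?N x \<in> thin k R -` E \<inter> simple_point_measures S}"
    using emeasure_law[OF finite_lessThan order_refl thinE, of n] by simp
  also have "\<dots> = emeasure (sample ?N) (\<Union>T\<in>Pow ?N. ?A T)"
  proof (rule emeasure_eq_AE)
    show "AE x in sample ?N. x \<in> {x\<in>space (sample ?N). emp ?N x \<in> thin k R -` E \<inter> simple_point_measures S}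
        \<longleftrightarrow> x \<in> (\<Union>T\<in>Pow ?N. ?A T)"
      using AE_sep
    proof eventually_elim
      case (elim x)
      then have inj: "inj_on x ?N" and sub: "x ` ?N \<subseteq> S" by (auto simp: good_def)
      let ?T = "sel (R n) ?N x"
      have "good ?T x" using elim sel_subset[of "R n" ?N x] by (auto simp: good_def intro: inj_on_subset)
      have pts: "points (emp ?N x) = x ` ?N"
        using elim points_point_sum[OF _ sub] by (simp add: emp_def)
      have "thin k R (emp ?N x) = emp ?T x"
        using n elim inj \<open>good ?T x\<close>
        by (simp add: thin_def pts card_image separated_image[OF inj] sel_image[OF inj]) (simp add: emp_def)
      then show ?case
        using sel_subset[of "R n" ?N x] by (auto simp: emp_simple)
    qed
    show "{x\<in>space (sample ?N). emp ?N x \<in> thin k R -` E \<inter> simple_point_measures S} \<in> sets (sample ?N)"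
      using measurable_sets[OF measurable_emp[OF finite_lessThan] thinE, of n]
      by (simp add: vimage_def Int_def conj_ac)
    show "(\<Union>T\<in>Pow ?N. ?A T) \<in> sets (sample ?N)"
      using meas by (intro sets.finite_UN) auto
  qed
  also have "\<dots> = (\<Sum>T\<in>Pow ?N. emeasure (sample ?N) (?A T))"
    using meas by (intro sum_emeasure[symmetric]) (auto simp: disjoint_family_on_def)
  also have "\<dots> = (\<Sum>T\<in>Pow ?N. ?w (card T) * emeasure (law (card T)) E)"
  proof (rule sum.cong[OF refl])
    fix T assume "T \<in> Pow ?N"
    show "emeasure (sample ?N) (?A T) = ?w (card T) * emeasure (law (card T)) E"
    proof (cases "T = ?N")
      case True
      have "emeasure (sample ?N) (?A T) = emeasure (sample ?N) {}"
      proof (rule emeasure_eq_AE)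
        show "AE x in sample ?N. x \<in> ?A T \<longleftrightarrow> x \<in> {}"
          using AE_sep by eventually_elim (use full True in auto)
      qed (use meas True in auto)
      then show ?thesis using True w0 by simp
    next
      case False
      then show ?thesis
        using \<open>T \<in> Pow ?N\<close> Rn w by (intro emeasure_sel[OF _ E R]) auto
    qed
  qed
  also have "\<dots> = (\<Sum>m\<le>n. of_nat (n choose m) * (?w m * emeasure (law m) E))"
    using sum_Pow_card[OF finite_lessThan, of "\<lambda>m. ?w m * emeasure (law m) E" n] by simp
  also have "\<dots> = (\<Sum>m\<le>n. emeasure (law m) E * ennreal (pmf \<pi> m))"
  proof (rule sum.cong[OF refl])
    fix m assume "m \<in> {..n}"
    then have "real (n choose m) * (pmf \<pi> m / (n choose m)) = pmf \<pi> m" by simp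
    then have "of_nat (n choose m) * ?w m = ennreal (pmf \<pi> m)"
      by (subst ennreal_of_nat_eq_real_of_nat, subst ennreal_mult[symmetric]) auto
    then show "of_nat (n choose m) * (?w m * emeasure (law m) E) = emeasure (law m) E * ennreal (pmf \<pi> m)"
      by (simp add: mult.assoc[symmetric] mult.commute)
  qed
  also have "\<dots> = (\<integral>\<^sup>+m. emeasure (law m) E \<partial>measure_pmf \<pi>)"
    using \<pi> by (intro nn_integral_measure_pmf_support[symmetric]) (auto dest!: \<pi>)
  finally show ?thesis .
qed

lemma emeasure_law_thin_small:
  assumes n: "n \<le> k" and E: "E \<in> sets (point_measure_space S)" and R: "\<And>n. R n \<in> borel \<rightarrow>\<^sub>M count_space UNIV"
  shows "emeasure (distr (law n) (point_measure_space S) (thin k R)) E = emeasure (law n) E"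
proof -
  have "emeasure (distr (law n) (point_measure_space S) (thin k R)) E
    = emeasure (law n) (thin k R -` E \<inter> simple_point_measures S)"
    using emeasure_distr[OF _ E, of "thin k R" "law n"] measurable_thin[OF R] by simp
  also have "\<dots> = emeasure (law n) E"
  proof (rule emeasure_eq_AE)
    show "AE \<nu> in law n. \<nu> \<in> thin k R -` E \<inter> simple_point_measures S \<longleftrightarrow> \<nu> \<in> E"
      using AE_law_count[of n] AE_space
    proof eventually_elim
      case (elim \<nu>)
      then have \<nu>: "\<nu> \<in> simple_point_measures S" by simp
      have "S \<inter> points \<nu> = points \<nu>" using points_subset[OF \<nu>] by auto
      then have "card (points \<nu>) = n"
        using emeasure_eq_card_points[OF \<nu> S_window] elim(1) by simp
      then show ?case using n \<nu> by (simp add: thin_def)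
    qed
    show "thin k R -` E \<inter> simple_point_measures S \<in> sets (law n)"
      using measurable_sets[OF measurable_thin[OF R] E] by simp
  qed (use E in simp)
  finally show ?thesis .
qed

end

section \<open>The two implications for Poisson processes\<close>

context window
begin

text \<open>Given \<open>n\<close> points, the thinned configuration is a mixture of the laws
  \<open>law m\<close> with \<open>m\<close> drawn from \<open>\<pi> n\<close>. Averaging over
  \<open>n\<close> replaces the Poisson mixing law of intensity \<open>lam\<close> by the one of
  intensity \<open>mu\<close>, since the coupling has the right second marginal.\<close>

theorem poisson_thinning_exists:
  assumes M: "prob_space M" and P: "prob_space.poisson_process M S lam \<Phi>" and lam: "lam > 0" and mu: "mu > 0"
    and le: "\<And>n. n \<le> k \<Longrightarrow> pmf (poisson_pmf (lam * vol S)) n \<le> pmf (poisson_pmf (mu * vol S)) n"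
    and cdf: "\<And>j. k \<le> j \<Longrightarrow>
      (\<Sum>i\<le>Suc j. pmf (poisson_pmf (lam * vol S)) i) \<le> (\<Sum>i\<le>j. pmf (poisson_pmf (mu * vol S)) i)"
  shows "\<exists>f \<in> point_measure_space S \<rightarrow>\<^sub>M point_measure_space S.
    prob_space.poisson_process M S mu (\<lambda>\<omega>. f (\<Phi> \<omega>)) \<and>
    (\<forall>\<nu>\<in>simple_point_measures S. points (f \<nu>) \<subseteq> points \<nu>)"
proof -
  obtain F :: "'a \<Rightarrow> real" where "F \<in> borel_measurable borel" "\<And>z. 0 \<le> F z" "\<And>z. F z \<le> 1"
    "\<And>B. B \<in> sets borel \<Longrightarrow> emeasure U {z. F z \<in> B} = emeasure lborel (B \<inter> {0..<1})"
    by (rule uniform_coordinate) blast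
  then interpret uniform_mark S F by unfold_locales auto
  let ?p = "poisson_pmf (lam * vol S)" and ?q = "poisson_pmf (mu * vol S)"
  obtain \<pi> :: "nat \<Rightarrow> nat pmf" where \<pi>: "bind_pmf ?p \<pi> = ?q" "\<And>n. n \<le> k \<Longrightarrow> \<pi> n = return_pmf n"
    "\<And>n m. k < n \<Longrightarrow> m \<in> set_pmf (\<pi> n) \<Longrightarrow> m < n"
    using strict_thinning_coupling[OF le cdf] by metis
  have "\<exists>R. R \<in> borel \<rightarrow>\<^sub>M count_space UNIV \<and> (k < n \<longrightarrow> (\<forall>v. R v \<subset> {..<n}) \<and>
      (\<forall>A\<subseteq>{..<n}. emeasure lborel ({v. R v = A} \<inter> {0..<1 :: real}) = ennreal (pmf (\<pi> n) (card A) / (n choose card A))))" for n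
  proof (cases "k < n")
    case True
    have "\<And>m. m \<in> set_pmf (\<pi> n) \<Longrightarrow> m \<le> n" using \<pi>(3)[OF True] by (auto intro: less_imp_le)
    then obtain W :: "nat set pmf" where W: "set_pmf W = {A. A \<subseteq> {..<n} \<and> card A \<in> set_pmf (\<pi> n)}"
      "\<And>A. A \<subseteq> {..<n} \<Longrightarrow> pmf W A = pmf (\<pi> n) (card A) / (n choose card A)"
      using random_subset_pmf[of "\<pi> n" n] by metis
    obtain R :: "real \<Rightarrow> nat set" where R: "R \<in> borel \<rightarrow>\<^sub>M count_space UNIV" "\<And>v. R v \<in> set_pmf W"
      "\<And>x. emeasure lborel ({v. R v = x} \<inter> {0..<1}) = ennreal (pmf W x)"
      by (rule pmf_quantile[of W]) (rule that)
    \<comment> \<open>Values of \<open>R\<close> lie in the support of \<open>W\<close> for every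
      \<open>v\<close>, and sizes in the support of \<open>\<pi> n\<close> are below
      \<open>n\<close>.\<close>
    have "R v \<subset> {..<n}" for v
      using R(2)[of v] \<pi>(3)[OF True, of "card (R v)"] unfolding W(1) by auto
    then show ?thesis using R W(2) by (intro exI[of _ R]) auto
  qed (auto intro!: exI[of _ "\<lambda>_. {}"])
  then obtain R :: "nat \<Rightarrow> real \<Rightarrow> nat set" where R: "\<And>n. R n \<in> borel \<rightarrow>\<^sub>M count_space UNIV"
    "\<And>n v. k < n \<Longrightarrow> R n v \<subset> {..<n}"
    "\<And>n A. k < n \<Longrightarrow> A \<subseteq> {..<n} \<Longrightarrow>
      emeasure lborel ({v. R n v = A} \<inter> {0..<1}) = ennreal (pmf (\<pi> n) (card A) / (n choose card A))"
    by metis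
  let ?f = "thin k R"
  have f: "?f \<in> point_measure_space S \<rightarrow>\<^sub>M point_measure_space S" by (rule measurable_thin[OF R(1)])
  have \<Phi>: "\<Phi> \<in> M \<rightarrow>\<^sub>M point_measure_space S"
    using P M by (simp add: prob_space.poisson_process_def)
  have "distr M (point_measure_space S) (\<lambda>\<omega>. ?f (\<Phi> \<omega>)) = distr (poisson_mix lam) (point_measure_space S) ?f"
    unfolding distr_poisson_process[OF M P lam, symmetric] using f \<Phi> by (simp add: distr_distr o_def)
  also have "\<dots> = poisson_mix mu"
  proof (rule measure_eqI)
    fix E assume "E \<in> sets (distr (poisson_mix lam) (point_measure_space S) ?f)"
    then have E: "E \<in> sets (point_measure_space S)" by simp
    have thinE: "?f -` E \<inter> simple_point_measures S \<in> sets (point_measure_space S)"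
      using measurable_sets[OF f E] by simp
    have "emeasure (distr (poisson_mix lam) (point_measure_space S) ?f) E
      = emeasure (poisson_mix lam) (?f -` E \<inter> simple_point_measures S)"
      using emeasure_distr[OF _ E, of ?f "poisson_mix lam"] f by simp
    also have "\<dots> = (\<integral>\<^sup>+n. emeasure (law n) (?f -` E \<inter> simple_point_measures S) \<partial>?p)"
      by (rule emeasure_poisson_mix[OF thinE])
    also have "\<dots> = (\<integral>\<^sup>+n. \<integral>\<^sup>+m. emeasure (law m) E \<partial>\<pi> n \<partial>?p)"
    proof (rule nn_integral_cong)
      fix n
      have "emeasure (law n) (?f -` E \<inter> simple_point_measures S)
        = emeasure (distr (law n) (point_measure_space S) ?f) E"
        using emeasure_distr[OF _ E, of ?f "law n"] f by simp
      also have "\<dots> = (\<integral>\<^sup>+m. emeasure (law m) E \<partial>\<pi> n)"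
      proof (cases "k < n")
        case True
        show ?thesis
          by (rule emeasure_law_thin[of k n "\<pi> n" E R, OF True \<pi>(3)[OF True] E R(1) R(2)[OF True] R(3)[OF True]])
      next
        case False
        then show ?thesis using emeasure_law_thin_small[OF _ E R(1), of n k] \<pi>(2)[of n] by simp
      qed
      finally show "emeasure (law n) (?f -` E \<inter> simple_point_measures S) = (\<integral>\<^sup>+m. emeasure (law m) E \<partial>\<pi> n)" .
    qed
    also have "\<dots> = (\<integral>\<^sup>+m. emeasure (law m) E \<partial>bind_pmf ?p \<pi>)" by simp
    also have "\<dots> = emeasure (poisson_mix mu) E"
      unfolding \<pi>(1) by (rule emeasure_poisson_mix[OF E, symmetric])
    finally show "emeasure (distr (poisson_mix lam) (point_measure_space S) ?f) E = emeasure (poisson_mix mu) E" .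
  qed simp
  finally have "prob_space.poisson_process M S mu (\<lambda>\<omega>. ?f (\<Phi> \<omega>))"
    using f \<Phi> by (intro poisson_processI_distr[OF M P lam mu]) auto
  then show ?thesis using f points_thin by blast
qed

text \<open>If some configurations of \<open>n\<close> points are kept intact, those configurations alone force
  \<open>P(X = n) \<le> P(Y = n)\<close>, since both processes are uniform given their number of points.\<close>

theorem poisson_thinning_obstruction:
  assumes M: "prob_space M" and P: "prob_space.poisson_process M S lam \<Phi>" and lam: "lam > 0" and mu: "mu > 0"
    and f: "f \<in> point_measure_space S \<rightarrow>\<^sub>M point_measure_space S"
    and fP: "prob_space.poisson_process M S mu (\<lambda>\<omega>. f (\<Phi> \<omega>))"
    and sub: "AE \<omega> in M. points (f (\<Phi> \<omega>)) \<subseteq> points (\<Phi> \<omega>)"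
    and gt: "pmf (poisson_pmf (mu * vol S)) (Suc k) < pmf (poisson_pmf (lam * vol S)) (Suc k)"
  shows "(\<Sum>i\<le>Suc k. pmf (poisson_pmf (lam * vol S)) i) \<le> (\<Sum>i\<le>k. pmf (poisson_pmf (mu * vol S)) i)"
proof -
  interpret prob_space M by fact
  let ?PM = "point_measure_space S" and ?n = "Suc k"
  have \<Phi> [measurable]: "\<Phi> \<in> M \<rightarrow>\<^sub>M ?PM" using P by (simp add: poisson_process_def)
  have f\<Phi> [measurable]: "(\<lambda>\<omega>. f (\<Phi> \<omega>)) \<in> M \<rightarrow>\<^sub>M ?PM" using f \<Phi> by simp
  have sp: "\<Phi> \<omega> \<in> simple_point_measures S" "f (\<Phi> \<omega>) \<in> simple_point_measures S" if "\<omega> \<in> space M" for \<omega>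
    using measurable_space[OF \<Phi> that] measurable_space[OF f\<Phi> that] by auto
  \<comment> \<open>The configurations of \<open>Suc k\<close> points that \<open>f\<close> keeps
    intact.\<close>
  define E where "E = {\<nu>\<in>simple_point_measures S. emeasure \<nu> S = of_nat ?n \<and> f \<nu> = \<nu>}"
  have E: "E \<in> sets ?PM"
  proof -
    obtain \<B> :: "'a set set" where \<B>: "countable \<B>" "topological_basis \<B>"
      using ex_countable_basis by blast
    have SB: "S \<inter> B \<in> sets (restrict_space borel S)" if "B \<in> \<B>" for B
      using topological_basis_open[OF \<B>(2) that] by (auto simp: sets_restrict_space)
    have cnt: "(\<lambda>\<nu>. card (B \<inter> points \<nu>)) \<in> ?PM \<rightarrow>\<^sub>M count_space UNIV"
      and cntf: "(\<lambda>\<nu>. card (B \<inter> points (f \<nu>))) \<in> ?PM \<rightarrow>\<^sub>M count_space UNIV" if "B \<in> \<B>" for B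
      using measurable_card_points[of B] measurable_compose[OF f measurable_card_points[of B]]
        topological_basis_open[OF \<B>(2) that] by auto
    \<comment> \<open>A finite set is determined by which basic open sets it meets, because its
      complement is open. So being fixed by \<open>f\<close> is a countable conjunction of
      measurable conditions.\<close>
    have iff: "f \<nu> = \<nu> \<longleftrightarrow> (\<forall>B\<in>\<B>. (card (B \<inter> points (f \<nu>)) = 0) = (card (B \<inter> points \<nu>) = 0))"
      if \<nu>: "\<nu> \<in> simple_point_measures S" for \<nu>
    proof
      assume *: "\<forall>B\<in>\<B>. (card (B \<inter> points (f \<nu>)) = 0) = (card (B \<inter> points \<nu>) = 0)"
      have f\<nu>: "f \<nu> \<in> simple_point_measures S" using measurable_space[OF f, of \<nu>] \<nu> by simp
      note fin = finite_points[OF \<nu>] finite_points[OF f\<nu>]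
      have sub: "C \<subseteq> D" if fin: "finite C" "finite D" and
        sub: "\<forall>B\<in>\<B>. B \<inter> D = {} \<longrightarrow> B \<inter> C = {}" for C D :: "'a set"
      proof
        fix x assume x: "x \<in> C"
        show "x \<in> D"
        proof (rule ccontr)
          assume "x \<notin> D"
          moreover have "open (- D)" using fin by (simp add: finite_imp_closed open_Compl)
          ultimately obtain B where "B \<in> \<B>" "x \<in> B" "B \<subseteq> - D"
            using topological_basisE[OF \<B>(2), of "- D" x] by auto
          then show False using sub x by blast
        qed
      qed
      have "points (f \<nu>) = points \<nu>"
        using * fin by (intro equalityI sub) (auto simp: card_eq_0_iff)
      then show "f \<nu> = \<nu>" by (rule simple_point_measure_eqI[OF f\<nu> \<nu>])
    qed simp
    have "{\<nu>\<in>space ?PM. \<forall>B\<in>\<B>. (card (B \<inter> points (f \<nu>)) = 0) = (card (B \<inter> points \<nu>) = 0)} \<in> sets ?PM"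
    proof (rule sets.sets_Collect_countable_All'[OF _ \<B>(1)])
      fix B assume B: "B \<in> \<B>"
      have "Measurable.pred ?PM (\<lambda>\<nu>. card (B \<inter> points (f \<nu>)) = 0)" "Measurable.pred ?PM (\<lambda>\<nu>. card (B \<inter> points \<nu>) = 0)"
        by (rule measurable_compose[OF cntf[OF B]], simp, rule measurable_compose[OF cnt[OF B]], simp)
      then have "Measurable.pred ?PM (\<lambda>\<nu>. (card (B \<inter> points (f \<nu>)) = 0) = (card (B \<inter> points \<nu>) = 0))"
        by measurable
      then show "{\<nu>\<in>space ?PM. (card (B \<inter> points (f \<nu>)) = 0) = (card (B \<inter> points \<nu>) = 0)} \<in> sets ?PM"
        by (simp add: pred_def)
    qed
    from sets.Int[OF this count_level_measurable[OF S_window, of "of_nat ?n"]]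
    show ?thesis
      by (rule back_subst[of "\<lambda>A. A \<in> sets ?PM"]) (auto simp: E_def iff)
  qed
  have num: "emeasure \<nu> S = of_nat (card (points \<nu>))" if "\<nu> \<in> simple_point_measures S" for \<nu>
  proof -
    have "S \<inter> points \<nu> = points \<nu>" using points_subset[OF that] by auto
    then show ?thesis using emeasure_eq_card_points[OF that S_window] by simp
  qed
  have prE: "emeasure M {\<omega>\<in>space M. \<Psi> \<omega> \<in> E} = pmf (poisson_pmf (r * vol S)) ?n * emeasure (law ?n) E"
    if \<Psi>: "poisson_process S r \<Psi>" "r > 0" for \<Psi> r
  proof -
    have "\<Psi> \<in> M \<rightarrow>\<^sub>M ?PM" using \<Psi> by (simp add: poisson_process_def)
    then have "emeasure M {\<omega>\<in>space M. \<Psi> \<omega> \<in> E} = emeasure (distr M ?PM \<Psi>) E"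
      using E by (simp add: emeasure_distr vimage_def Int_def conj_commute)
    then show ?thesis
      using emeasure_poisson_mix_count[OF \<Psi>(2) E, of ?n] distr_poisson_process[OF M \<Psi>]
      by (simp add: E_def del: pmf_poisson of_nat_Suc)
  qed
  have setsE: "{\<omega>\<in>space M. f (\<Phi> \<omega>) \<in> E} \<in> sets M" "{\<omega>\<in>space M. \<Phi> \<omega> \<in> E} \<in> sets M"
    using measurable_sets[OF f\<Phi> E] measurable_sets[OF \<Phi> E] by (simp_all add: vimage_def Int_def conj_commute)
  \<comment> \<open>On the left event \<open>f\<close> fixes \<open>\<Phi> \<omega>\<close>, so the
    output is in \<open>E\<close> too. Both probabilities are Poisson weights times the same number,
    which \<open>gt\<close> forces to be 0.\<close>
  have "emeasure M {\<omega>\<in>space M. \<Phi> \<omega> \<in> E} \<le> emeasure M {\<omega>\<in>space M. f (\<Phi> \<omega>) \<in> E}"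
    using setsE by (intro emeasure_mono) (auto simp: E_def)
  then have le: "pmf (poisson_pmf (lam * vol S)) ?n * emeasure (law ?n) E
      \<le> pmf (poisson_pmf (mu * vol S)) ?n * emeasure (law ?n) E"
    by (simp only: prE[OF P lam] prE[OF fP mu])
  interpret law: prob_space "law ?n" by (rule prob_space_law)
  have "emeasure (law ?n) E = 0"
  proof (rule ccontr)
    assume "emeasure (law ?n) E \<noteq> 0"
    then have "measure (law ?n) E > 0" by (simp add: law.emeasure_eq_measure zero_less_measure_iff)
    moreover have "pmf (poisson_pmf (lam * vol S)) ?n * measure (law ?n) E
      \<le> pmf (poisson_pmf (mu * vol S)) ?n * measure (law ?n) E"
      using le by (simp only: law.emeasure_eq_measure) (simp add: ennreal_mult[symmetric] del: pmf_poisson)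
    ultimately show False using gt by (metis mult_le_cancel_right not_less)
  qed
  then have "emeasure M {\<omega>\<in>space M. \<Phi> \<omega> \<in> E} = 0" by (simp only: prE[OF P lam]) simp
  then have "AE \<omega> in M. \<Phi> \<omega> \<notin> E"
    using setsE by (intro AE_I'[of "{\<omega>\<in>space M. \<Phi> \<omega> \<in> E}"]) (auto intro!: null_setsI)
  \<comment> \<open>Off \<open>E\<close> a configuration of \<open>Suc k\<close> points is changed,
    and a sub-configuration of the same finite size would be all of it; so at most \<open>k\<close>
    points remain. Smaller configurations stay small by inclusion.\<close>
  then have AE: "AE \<omega> in M. emeasure (\<Phi> \<omega>) S \<le> of_nat ?n \<longrightarrow> emeasure (f (\<Phi> \<omega>)) S \<le> of_nat k"
    using sub AE_space
  proof eventually_elim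
    case (elim \<omega>)
    note sp = sp[OF elim(3)]
    have fin: "finite (points (\<Phi> \<omega>))" by (rule finite_points[OF sp(1)])
    show ?case
    proof
      assume "emeasure (\<Phi> \<omega>) S \<le> of_nat ?n"
      then have c: "card (points (\<Phi> \<omega>)) \<le> ?n" by (simp only: num[OF sp(1)] of_nat_le_iff)
      have "card (points (f (\<Phi> \<omega>))) \<noteq> ?n"
      proof
        assume *: "card (points (f (\<Phi> \<omega>))) = ?n"
        then have "points (f (\<Phi> \<omega>)) = points (\<Phi> \<omega>)"
          using c card_mono[OF fin elim(2)] by (intro card_subset_eq[OF fin elim(2)]) simp
        then have "f (\<Phi> \<omega>) = \<Phi> \<omega>" by (rule simple_point_measure_eqI[OF sp(2,1)])
        then show False using elim(1) * num[OF sp(1)] sp(1) by (simp add: E_def)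
      qed
      then have "card (points (f (\<Phi> \<omega>))) \<le> k"
        using c card_mono[OF fin elim(2)] by linarith
      then show "emeasure (f (\<Phi> \<omega>)) S \<le> of_nat k" by (simp only: num[OF sp(2)] of_nat_le_iff)
    qed
  qed
  have cdf: "emeasure M {\<omega>\<in>space M. emeasure (\<Psi> \<omega>) S \<le> of_nat j} = ennreal (\<Sum>i\<le>j. pmf (poisson_pmf (r * vol S)) i)"
    and cdf_sets: "{\<omega>\<in>space M. emeasure (\<Psi> \<omega>) S \<le> of_nat j} \<in> sets M"
    if \<Psi>: "poisson_process S r \<Psi>" "r > 0" for \<Psi> r j
  proof -
    have "\<Psi> \<in> M \<rightarrow>\<^sub>M ?PM" using \<Psi> by (simp add: poisson_process_def)
    then have m: "(\<lambda>\<omega>. emeasure (\<Psi> \<omega>) S) \<in> borel_measurable M"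
      by (rule measurable_compose) (rule measurable_emeasure_point_measure_space[OF S_window])
    then show "{\<omega>\<in>space M. emeasure (\<Psi> \<omega>) S \<le> of_nat j} \<in> sets M" by measurable
    have "emeasure M {\<omega>\<in>space M. emeasure (\<Psi> \<omega>) S \<le> of_nat j}
      = emeasure (distr M borel (\<lambda>\<omega>. emeasure (\<Psi> \<omega>) S)) {..of_nat j}"
      using m by (simp add: emeasure_distr vimage_def Int_def conj_commute)
    also have "\<dots> = emeasure (distr (measure_pmf (poisson_law (r * vol S))) borel (of_nat :: nat \<Rightarrow> ennreal)) {..of_nat j}"
      using \<Psi>(1) S_window unfolding poisson_process_def by simp
    also have "\<dots> = emeasure (measure_pmf (poisson_law (r * vol S))) {..j}"
      by (subst emeasure_distr) (auto intro!: arg_cong2[where f=emeasure])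
    also have "\<dots> = ennreal (\<Sum>i\<le>j. pmf (poisson_law (r * vol S)) i)"
      by (simp add: emeasure_measure_pmf_finite)
    also have "poisson_law (r * vol S) = poisson_pmf (r * vol S)"
      using \<Psi>(2) vol_S by (simp add: poisson_law_def)
    finally show "emeasure M {\<omega>\<in>space M. emeasure (\<Psi> \<omega>) S \<le> of_nat j} = ennreal (\<Sum>i\<le>j. pmf (poisson_pmf (r * vol S)) i)" .
  qed
  have "ennreal (\<Sum>i\<le>?n. pmf (poisson_pmf (lam * vol S)) i) \<le> ennreal (\<Sum>i\<le>k. pmf (poisson_pmf (mu * vol S)) i)"
    unfolding cdf[OF P lam, symmetric] cdf[OF fP mu, symmetric]
    using AE by (intro emeasure_mono_AE cdf_sets[OF fP mu]) (auto elim!: eventually_mono)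
  then show ?thesis by (simp add: sum_nonneg del: pmf_poisson sum.atMost_Suc)
qed

end

lemma (in prob_space) poisson_variable_prob:
  assumes "poisson_variable X r" and "r > 0"
  shows "\<P>(\<omega> in M. X \<omega> = n) = pmf (poisson_pmf r) n"
    and "\<P>(\<omega> in M. X \<omega> \<le> n) = (\<Sum>i\<le>n. pmf (poisson_pmf r) i)"
proof -
  have X: "X \<in> M \<rightarrow>\<^sub>M count_space UNIV"
    and d: "distr M (count_space UNIV) X = measure_pmf (poisson_pmf r)"
    using assms by (auto simp: poisson_variable_def poisson_law_def)
  have "\<P>(\<omega> in M. X \<omega> \<in> A) = measure (measure_pmf (poisson_pmf r)) A" for A
    unfolding d[symmetric] using X by (simp add: measure_distr vimage_def Int_def conj_commute)
  from this[of "{n}"] this[of "{..n}"]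
  show "\<P>(\<omega> in M. X \<omega> = n) = pmf (poisson_pmf r) n"
    and "\<P>(\<omega> in M. X \<omega> \<le> n) = (\<Sum>i\<le>n. pmf (poisson_pmf r) i)"
    by (simp_all add: measure_pmf_single measure_measure_pmf_finite del: pmf_poisson)
qed

theorem theorem1:
  fixes lam mu :: real and S :: "(real ^ 'd) set"
    and M :: "'w measure" and \<Phi> :: "'w \<Rightarrow> (real ^ 'd) measure"
    and P :: "'x measure" and X :: "'x \<Rightarrow> nat"
    and Q :: "'y measure" and Y :: "'y \<Rightarrow> nat"
  assumes "lam > mu" and "mu > 0"
    and "S \<in> sets borel" and "0 < emeasure lborel S" and "emeasure lborel S < \<infinity>"
    and "prob_space M" and "prob_space.poisson_process M S lam \<Phi>"
    and "prob_space P" and "prob_space.poisson_variable P X (lam * measure lborel S)"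
    and "prob_space Q" and "prob_space.poisson_variable Q Y (mu * measure lborel S)"
  defines "cond_i \<equiv> \<exists>f \<in> point_measure_space S \<rightarrow>\<^sub>M point_measure_space S.
      prob_space.poisson_process M S mu (\<lambda>\<omega>. f (\<Phi> \<omega>)) \<and>
      (AE \<omega> in M. points (f (\<Phi> \<omega>)) \<subseteq> points (\<Phi> \<omega>))"
    and "cond_ii \<equiv> \<exists>k::nat.
      \<P>(\<omega> in P. X \<omega> = k) \<le> \<P>(\<omega> in Q. Y \<omega> = k) \<and>
      \<P>(\<omega> in P. X \<omega> \<le> k + 1) \<le> \<P>(\<omega> in Q. Y \<omega> \<le> k)"
    and "cond_iii \<equiv> \<not> (\<exists>k::nat.
      \<P>(\<omega> in P. X \<omega> = k + 1) > \<P>(\<omega> in Q. Y \<omega> = k + 1) \<and>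
      \<P>(\<omega> in P. X \<omega> \<le> k + 1) > \<P>(\<omega> in Q. Y \<omega> \<le> k))"
  shows "(cond_i \<longleftrightarrow> cond_ii) \<and> (cond_ii \<longleftrightarrow> cond_iii)"
proof -
  interpret window S using assms(3-5) by unfold_locales
  interpret two_rates "lam * vol S" "mu * vol S"
    using assms(1,2) vol_S by unfold_locales auto
  have pos: "lam * vol S > 0" "mu * vol S > 0" using b ab by auto
  have lam: "lam > 0" using assms(1,2) by simp
  note PX = prob_space.poisson_variable_prob[OF assms(8,9) pos(1)]
    and QY = prob_space.poisson_variable_prob[OF assms(10,11) pos(2)]
  have ii: "cond_ii \<longleftrightarrow> (\<exists>k. p k \<le> q k \<and> (\<Sum>i\<le>Suc k. p i) \<le> (\<Sum>i\<le>k. q i))"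
    unfolding cond_ii_def PX QY Suc_eq_plus1 ..
  have iii: "cond_iii \<longleftrightarrow> \<not> (\<exists>k. p (Suc k) > q (Suc k) \<and> (\<Sum>i\<le>Suc k. p i) > (\<Sum>i\<le>k. q i))"
    unfolding cond_iii_def PX QY Suc_eq_plus1 ..
  have ii_iii: "cond_ii \<longleftrightarrow> cond_iii" unfolding ii iii by (rule existence_iff_no_obstruction)
  have "cond_i" if cond_ii
  proof -
    obtain k where k: "p k \<le> q k" "D k \<le> 0" using \<open>cond_ii\<close> unfolding ii D_def by auto
    \<comment> \<open>The single \<open>k\<close> of (ii) supplies both hypotheses of the
      construction: the masses compare below \<open>k\<close>, the distribution functions from
      \<open>k\<close> on.\<close>
    have le: "p n \<le> q n" if "n \<le> k" for n using p_le_q_mono[OF k(1) that] .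
    have cdf: "(\<Sum>i\<le>Suc j. p i) \<le> (\<Sum>i\<le>j. q i)" if "k \<le> j" for j
      using D_le_0_mono[OF k(2) that] by (simp only: D_def diff_le_0_iff_le)
    obtain f where f: "f \<in> point_measure_space S \<rightarrow>\<^sub>M point_measure_space S"
      "prob_space.poisson_process M S mu (\<lambda>\<omega>. f (\<Phi> \<omega>))"
      "\<forall>\<nu>\<in>simple_point_measures S. points (f \<nu>) \<subseteq> points \<nu>"
      using poisson_thinning_exists[OF assms(6,7) lam assms(2) le cdf] by blast
    have "\<Phi> \<in> M \<rightarrow>\<^sub>M point_measure_space S"
      using assms(6,7) by (simp add: prob_space.poisson_process_def)
    then have "AE \<omega> in M. points (f (\<Phi> \<omega>)) \<subseteq> points (\<Phi> \<omega>)"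
      by (intro AE_I2 f(3)[rule_format]) (auto dest: measurable_space)
    then show cond_i unfolding cond_i_def using f by blast
  qed
  moreover have cond_iii if cond_i
  proof -
    obtain f where f: "f \<in> point_measure_space S \<rightarrow>\<^sub>M point_measure_space S"
      "prob_space.poisson_process M S mu (\<lambda>\<omega>. f (\<Phi> \<omega>))"
      "AE \<omega> in M. points (f (\<Phi> \<omega>)) \<subseteq> points (\<Phi> \<omega>)"
      using \<open>cond_i\<close> unfolding cond_i_def by blast
    show ?thesis
      unfolding iii using poisson_thinning_obstruction[OF assms(6,7) lam assms(2) f] by (meson not_le)
  qed
  ultimately show ?thesis using ii_iii by blast
qed

end
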